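(* Let $X=V(f)\subseteq \mathbb{P}_k^{n-1}$ be a reduced hypersurface of degree $d\geq 3$ with only isolated singularities. Assume that $\mathrm{Sing}(X)$ consists of exactly $n$ points. Then the following are equivalent: (a) $X$ is Veronese-Avoiding; (b) $\mathrm{Sing}(X)$ consists of $n$ nodes in general linear position.
   Context: $k$ is an algebraically closed field of characteristic zero, $R=k[x_1,\ldots,x_n]$ is the standard graded polynomial ring with graded pieces $R_m$, and $f\in R_d$ is a reduced (squarefree) homogeneous polynomial. The gradient ideal of $f$ is $J_f=(\partial f/\partial x_1,\ldots,\partial f/\partial x_n)\subseteq R$, with degree-$m$ piece $(J_f)_m\subseteq R_m$. Set $T=n(d-2)$. $\mathbb{P}(R_m)$ is the projective space of lines in $R_m$, $\mathbb{P}((J_f)_m)\subseteq\mathbb{P}(R_m)$ is the projective linear subspace attached to $(J_f)_m$, and its codimension is $\dim_k R_m-\dim_k (J_f)_m$. The Veronese variety $V_n^m\subseteq \mathbb{P}(R_m)$ is the image of $\mathbb{P}(R_1)\to\mathbb{P}(R_m)$, $[\ell]\mapsto[\ell^m]$. A reduced hypersurface $X=V(f)$ of degree $d\ge 3$ is called Veronese-Avoiding if both of the following hold: (I) $\mathrm{codim}_{\mathbb{P}(R_{T-1})}\mathbb{P}((J_f)_{T-1})=n$; (II) $\mathbb{P}((J_f)_{T-1})\cap V_n^{T-1}=\emptyset$. $\mathrm{Sing}(X)$ is the set of singular points of $X$. A node is an ordinary double point, i.e. a singular point at which the quadratic part of a local equation of $X$ in $n-1$ affine coordinates is a nondegenerate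 quadratic form. A set of $n$ points in $\mathbb{P}_k^{n-1}$ is in general linear position if it spans $\mathbb{P}_k^{n-1}$ (equivalently, no nonzero linear form vanishes at all of them). *)

theory Defs
  imports
    "HOL-Analysis.Cartesian_Space"
    "HOL-Library.Poly_Mapping"
    "HOL-Computational_Algebra.Polynomial"
    "HOL-Computational_Algebra.Squarefree"
begin

text \<open>
  The ring \<open>R = k[x\<^sub>1, \<dots>, x\<^sub>n]\<close> is the type of finitely supported functions from exponent
  vectors to \<open>k\<close>, with the convolution product of \<open>HOL-Library.Poly_Mapping\<close>. The variables are
  indexed by a finite type \<open>'n\<close>, so that \<open>n = CARD('n)\<close>.
\<close>

type_synonym ('n, 'k) mpoly = "('n \<Rightarrow>\<^sub>0 nat) \<Rightarrow>\<^sub>0 'k"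

definition Const :: "'k \<Rightarrow> ('n, 'k::zero) mpoly" where
  "Const c = Poly_Mapping.single 0 c"

definition Var :: "'n \<Rightarrow> ('n, 'k::zero_neq_one) mpoly" where
  "Var i = Poly_Mapping.single (Poly_Mapping.single i 1) 1"

definition total_degree :: "('n::finite \<Rightarrow>\<^sub>0 nat) \<Rightarrow> nat" where
  "total_degree m = (\<Sum>i\<in>UNIV. Poly_Mapping.lookup m i)"

definition graded_piece :: "nat \<Rightarrow> ('n::finite, 'k::zero) mpoly set" where
  "graded_piece d = {p. \<forall>m\<in>Poly_Mapping.keys p. total_degree m = d}"

definition hom_component :: "nat \<Rightarrow> ('n::finite, 'k::comm_monoid_add) mpoly \<Rightarrow> ('n, 'k) mpoly" where
  "hom_component d p =
     (\<Sum>m | m \<in> Poly_Mapping.keys p \<and> total_degree m = d.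
        Poly_Mapping.single m (Poly_Mapping.lookup p m))"

definition eval_at :: "'k ^ 'n::finite \<Rightarrow> ('n, 'k::comm_semiring_1) mpoly \<Rightarrow> 'k" where
  "eval_at v p =
     (\<Sum>m\<in>Poly_Mapping.keys p. Poly_Mapping.lookup p m * (\<Prod>i\<in>UNIV. v $ i ^ Poly_Mapping.lookup m i))"

definition subst_vars ::
  "('n::finite \<Rightarrow> ('n, 'k::comm_semiring_1) mpoly) \<Rightarrow> ('n, 'k) mpoly \<Rightarrow> ('n, 'k) mpoly" where
  "subst_vars \<sigma> p =
     (\<Sum>m\<in>Poly_Mapping.keys p.
        Const (Poly_Mapping.lookup p m) * (\<Prod>i\<in>UNIV. \<sigma> i ^ Poly_Mapping.lookup m i))"

text \<open>
  The truncated exponent subtraction is harmless: if \<open>x\<^sub>i\<close> does not occur in a monomial, the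
  coefficient of its derivative is zero.
\<close>

definition partial_deriv :: "'n \<Rightarrow> ('n, 'k::comm_semiring_1) mpoly \<Rightarrow> ('n, 'k) mpoly" where
  "partial_deriv i p =
     (\<Sum>m\<in>Poly_Mapping.keys p.
        Poly_Mapping.single (m - Poly_Mapping.single i 1)
          (of_nat (Poly_Mapping.lookup m i) * Poly_Mapping.lookup p m))"

abbreviation scale_mpoly :: "'k \<Rightarrow> ('n, 'k::field) mpoly \<Rightarrow> ('n, 'k) mpoly" where
  "scale_mpoly c p \<equiv> Const c * p"

global_interpretation mpoly: vector_space "scale_mpoly :: 'k::field \<Rightarrow> ('n, 'k) mpoly \<Rightarrow> _"
proof
  fix a b :: 'k and x y :: "('n, 'k) mpoly"
  show "scale_mpoly a (x + y) = scale_mpoly a x + scale_mpoly a y"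
    by (simp add: algebra_simps)
  show "scale_mpoly (a + b) x = scale_mpoly a x + scale_mpoly b x"
    by (simp add: Const_def single_add algebra_simps)
  show "scale_mpoly a (scale_mpoly b x) = scale_mpoly (a * b) x"
    by (simp add: Const_def mult_single mult.assoc [symmetric])
  show "scale_mpoly 1 x = x"
    by (simp add: Const_def)
qed

text \<open>The ideal generated by a set is its span in the ring regarded as a module over itself.\<close>

global_interpretation mpoly_ideal: module "(*) :: ('n, 'k::comm_ring_1) mpoly \<Rightarrow> _"
  by standard (simp_all add: algebra_simps)

definition gradient_ideal :: "('n, 'k::comm_ring_1) mpoly \<Rightarrow> ('n, 'k) mpoly set" where
  "gradient_ideal f = mpoly_ideal.span (range (\<lambda>i. partial_deriv i f))"

text \<open>A point of a projective space is a line through the origin, as a set of vectors.\<close>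

definition projectivization :: "('k::comm_ring_1 \<Rightarrow> 'v \<Rightarrow> 'v) \<Rightarrow> 'v::ab_group_add set \<Rightarrow> 'v set set"
  where "projectivization smul W = (\<lambda>v. module.span smul {v}) ` (W - {0})"

definition proj_codim :: "('n::finite, 'k::field) mpoly set \<Rightarrow> ('n, 'k) mpoly set \<Rightarrow> nat" where
  "proj_codim V W = mpoly.dim V - mpoly.dim W"

definition veronese_variety :: "nat \<Rightarrow> ('n::finite, 'k::field) mpoly set set" where
  "veronese_variety m = (\<lambda>l. mpoly.span {l ^ m}) ` (graded_piece 1 - {0})"

text \<open>
  The subtractions below do not truncate when \<open>d \<ge> 3\<close>, because \<open>CARD('n) \<ge> 1\<close>.
\<close>

definition veronese_avoiding :: "nat \<Rightarrow> ('n::finite, 'k::field) mpoly \<Rightarrow> bool" where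
  "veronese_avoiding d f \<longleftrightarrow>
     (let T = CARD('n) * (d - 2);
          R = graded_piece (T - 1);
          J = gradient_ideal f \<inter> R
      in proj_codim R J = CARD('n) \<and>
         projectivization scale_mpoly J \<inter> veronese_variety (T - 1) = {})"

definition zero_locus :: "('n::finite, 'k::field) mpoly \<Rightarrow> ('k ^ 'n) set set" where
  "zero_locus g = {P \<in> projectivization (*s) UNIV. \<forall>v\<in>P. eval_at v g = 0}"

definition Sing :: "('n::finite, 'k::field) mpoly \<Rightarrow> ('k ^ 'n) set set" where
  "Sing f = {P \<in> zero_locus f. \<forall>i. P \<in> zero_locus (partial_deriv i f)}"

text \<open>Isolatedness in the Zariski topology, whose basic open sets are complements of
  \<open>zero_locus g\<close> with \<open>g\<close> homogeneous.\<close>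

definition isolated_singularities :: "('n::finite, 'k::field) mpoly \<Rightarrow> bool" where
  "isolated_singularities f \<longleftrightarrow>
     (\<forall>P\<in>Sing f. \<exists>e. \<exists>g\<in>graded_piece e. Sing f - zero_locus g = {P})"

text \<open>
  The equation of \<open>V(f)\<close> in the chart \<open>x\<^sub>i = 1\<close>, with affine coordinates \<open>x\<^sub>j\<close> (\<open>j \<noteq> i\<close>) centred
  at the point with homogeneous coordinates \<open>v\<close>, normalized by \<open>v $ i = 1\<close>.
\<close>

definition local_equation ::
  "'n \<Rightarrow> 'k ^ 'n::finite \<Rightarrow> ('n, 'k::field) mpoly \<Rightarrow> ('n, 'k) mpoly" where
  "local_equation i v f = subst_vars (\<lambda>j. if j = i then 1 else Const (v $ j) + Var j) f"

text \<open>Nondegeneracy on a subspace \<open>W\<close> means that the polar bilinear form has zero radical.\<close>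

definition nondegenerate_on :: "('k ^ 'n::finite) set \<Rightarrow> ('n, 'k::field) mpoly \<Rightarrow> bool" where
  "nondegenerate_on W q \<longleftrightarrow>
     (\<forall>u\<in>W. (\<forall>w\<in>W. eval_at (u + w) q - eval_at u q - eval_at w q = 0) \<longrightarrow> u = 0)"

definition is_node :: "('n::finite, 'k::field) mpoly \<Rightarrow> ('k ^ 'n) set \<Rightarrow> bool" where
  "is_node f P \<longleftrightarrow> P \<in> Sing f \<and>
     (\<exists>i. \<exists>v\<in>P. v $ i = 1 \<and>
        nondegenerate_on {u. u $ i = 0} (hom_component 2 (local_equation i v f)))"

definition general_linear_position :: "('k::field ^ 'n::finite) set set \<Rightarrow> bool" where
  "general_linear_position S \<longleftrightarrow> card S = CARD('n) \<and> vec.span (\<Union>S) = UNIV"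

end

theory Submission
  imports Defs "HOL-Analysis.Determinants" "HOL-Library.Function_Algebras"
begin

text \<open>
  Put \<open>e = d - 1\<close> and \<open>m = T - 1 = n (e - 1) - 1\<close>, let \<open>f\<^sub>1, \<dots>, f\<^sub>n\<close> be the partial derivatives of \<open>f\<close>, \<open>J\<close> the
  gradient ideal, and \<open>I\<close> the ideal of the \<open>n\<close> singular points. Then \<open>J \<subseteq> I\<close>, and \<open>I\<^sub>m\<close> has codimension
  \<open>n\<close> in \<open>R\<^sub>m\<close>, because distinct points impose independent conditions in degrees \<open>\<ge> n - 1\<close>. So condition (I)
  says that \<open>J\<^sub>m = I\<^sub>m\<close>.

  If \<open>J\<^sub>m = I\<^sub>m\<close>, then (II) forbids a nonzero linear form that vanishes at all the points, since its \<open>m\<close>-th power would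
  lie in \<open>I\<^sub>m\<close>; hence the points span. Moreover the derivative at a singular point \<open>v\<close> of an element of \<open>J\<close> is
  zero in every direction of the kernel of the Hessian, while \<open>I\<^sub>m\<close> contains a product of a linear form
  through \<open>v\<close> with powers of a linear form through the other points, whose derivative at \<open>v\<close> can be
  nonzero in any direction other than \<open>v\<close>. (Only for binary cubics is \<open>m\<close> too small for such a product; they
  would have a third singular point.) So this kernel is the line through \<open>v\<close>, which means that \<open>v\<close> is
  a node (\<open>veronese_avoiding_imp_nodes\<close>).

  Conversely, let the singular points be spanning nodes. Condition (II) holds because \<open>J\<close> vanishes at the
  points. Condition (I) is the main difficulty. Near a node \<open>J\<close> coincides with the ideal of the point
  (\<open>node_local_generators\<close>), so by the Nullstellensatz \<open>J\<close> and \<open>I\<close> agree in large degrees. If \<open>y\<close> is a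
  linear form that vanishes at none of the points, it follows that \<open>R\<^sub>N\<^sub>+\<^sub>1 = J\<^sub>N\<^sub>+\<^sub>1 + y\<^sup>N R\<^sub>1\<close> for large \<open>N\<close>: the
  values at the points of a form of degree \<open>N + 1\<close> are those of some \<open>y\<^sup>N l\<close>
  (\<open>nodes_almost_complete_intersection\<close>).

  From this fact alone the codimension follows. The \<open>n + 1\<close> forms \<open>f\<^sub>1, \<dots>, f\<^sub>n, y\<^sup>N\<close> generate an ideal that
  contains powers of the \<open>n\<close> variables, so their Koszul complex is exact in homological degrees
  \<open>\<ge> 2\<close>, and by local duality the homology in degree \<open>1\<close> is dual to the quotient by the ideal; internal degree
  \<open>m\<close> corresponds to internal degree \<open>N + 1\<close>, where the quotient is zero (\<open>koszul_exact\<close>). The duality is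
  carried out by dimension shifting along \<open>R / (x\<^sub>a\<^sup>L | a \<in> A)\<close>, where \<open>A\<close> grows to the set of all variables
  (\<open>koszul_exact_mod_step\<close>); there it becomes the pairing of complementary monomials
  (\<open>koszul_exact_mod_top\<close>). As the complex is exact in internal degree \<open>m\<close>, the dimension of \<open>J\<^sub>m\<close> is determined by
  the degrees of the forms, so it is the same as for \<open>x\<^sub>1\<^sup>e, \<dots>, x\<^sub>n\<^sup>e\<close>, whose quotient has exactly \<open>n\<close>
  monomials in degree \<open>m\<close> (\<open>dim_ideal_piece_almost_complete_intersection\<close>).
\<close>

abbreviation "lookup \<equiv> Poly_Mapping.lookup"
abbreviation "keys \<equiv> Poly_Mapping.keys"
abbreviation "single \<equiv> Poly_Mapping.single"
abbreviation "ideal \<equiv> mpoly_ideal.span"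
abbreviation "is_ideal \<equiv> mpoly_ideal.subspace"

section \<open>Polynomials\<close>

text \<open>As rewrite rules, these instances of the module law reassociate products to the left, against
  the normal form of \<open>algebra_simps\<close>.\<close>

declare mpoly_ideal.scale_scale [simp del] mpoly.scale_scale [simp del]

lemma mpoly_eq_sum_monomials:
  "p = (\<Sum>m\<in>keys p. single m (lookup p m))"
proof (rule poly_mapping_eqI)
  fix k
  have "lookup (\<Sum>m\<in>keys p. single m (lookup p m)) k
      = (\<Sum>m\<in>keys p. if m = k then lookup p m else 0)"
    by (simp add: lookup_sum lookup_single when_def)
  also have "\<dots> = lookup p k"
    by (simp add: in_keys_iff)
  finally show "lookup p k =
      lookup (\<Sum>m\<in>keys p. single m (lookup p m)) k" ..
qed

lemma Const_0 [simp]: "Const 0 = 0" and Const_1 [simp]: "Const 1 = 1"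
  by (simp_all add: Const_def)

lemma Const_add: "Const (a + b) = Const a + Const b"
  and Const_mult: "Const (a * b) = (Const a * Const b :: ('n, 'k::comm_semiring_1) mpoly)"
  by (simp_all add: Const_def single_add mult_single)

lemma Const_diff: "Const (a - b) = (Const a - Const b :: ('n, 'k::comm_ring_1) mpoly)"
  by (simp add: Const_def single_diff)

lemma Const_of_nat: "Const (of_nat n) = (of_nat n :: ('n, 'k::comm_semiring_1) mpoly)"
  by (simp add: Const_def)

lemma Const_sum: "Const (sum g I) = (\<Sum>i\<in>I. Const (g i) :: ('n, 'k::comm_semiring_1) mpoly)"
  by (induction I rule: infinite_finite_induct) (simp_all add: Const_add)

lemma lookup_Const_mult [simp]:
  "lookup (Const c * p) m = c * lookup p (m :: 'n \<Rightarrow>\<^sub>0 nat)"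
  for p :: "('n, 'k::comm_semiring_1) mpoly"
proof -
  have "Const c * p = Poly_Mapping.map ((*) c) p"
    by (simp add: Const_def mult_map_scale_conv_mult)
  then show ?thesis by (simp add: Poly_Mapping.map.rep_eq when_def)
qed

lemma keys_Const_mult: "keys (Const c * p) \<subseteq> keys p"
  for p :: "('n, 'k::comm_semiring_1) mpoly"
  by (auto simp: in_keys_iff)

lemma Const_mult_single: "Const c * single m a = single m (c * a)"
  by (simp add: Const_def mult_single)

lemma Var_power: "Var i ^ e = single (single i e) (1::'k::comm_semiring_1)"
  by (induction e) (simp_all add: Var_def mult_single single_add [symmetric])

lemma prod_monomials:
  "(\<Prod>i\<in>I. single (g i) (1::'k::comm_semiring_1)) = single (\<Sum>i\<in>I. g i :: 'n \<Rightarrow>\<^sub>0 nat) 1"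
  by (induction I rule: infinite_finite_induct) (simp_all add: mult_single)

lemma sum_single_lookup: "(\<Sum>i\<in>UNIV. single i (lookup m i)) = (m :: 'n::finite \<Rightarrow>\<^sub>0 nat)"
  by (rule poly_mapping_eqI) (simp add: lookup_sum lookup_single when_def)

lemma monomial_eq_prod_Var:
  "single m 1 = (\<Prod>i\<in>UNIV. Var i ^ lookup (m :: 'n::finite \<Rightarrow>\<^sub>0 nat) i :: ('n, 'k::comm_semiring_1) mpoly)"
  by (simp add: Var_power prod_monomials sum_single_lookup)

lemma single_eq_Const_mult: "single m c = (Const c * single m 1 :: ('n, 'k::comm_semiring_1) mpoly)"
  by (simp add: Const_mult_single)

lemma mpoly_induct [case_names Const Var add mult]:
  fixes p :: "('n::finite, 'k::comm_semiring_1) mpoly"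
  assumes C: "\<And>c. P (Const c)" and V: "\<And>i. P (Var i)"
    and add: "\<And>p q. P p \<Longrightarrow> P q \<Longrightarrow> P (p + q)" and mult: "\<And>p q. P p \<Longrightarrow> P q \<Longrightarrow> P (p * q)"
  shows "P p"
proof -
  have P0: "P 0" and P1: "P 1" using C[of 0] C[of 1] by simp_all
  have pw: "P (q ^ e)" if "P q" for q e
    by (induction e) (auto intro: P1 mult that)
  have pr: "P (\<Prod>i\<in>I. g i)" if "\<And>i. P (g i)" for g and I :: "'n set"
    by (induction I rule: infinite_finite_induct) (auto intro: P1 mult that)
  have "P (single m c)" for m c
    by (subst single_eq_Const_mult, subst monomial_eq_prod_Var) (intro mult C pr pw V)
  then have "P (\<Sum>m\<in>I. single m (g m))" for g I
    by (induction I rule: infinite_finite_induct) (auto intro: P0 add)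
  then show ?thesis by (subst mpoly_eq_sum_monomials)
qed

subsection \<open>Evaluation homomorphisms\<close>

text \<open>Evaluation at a point, substitution and restriction to a line are the extensions of a homomorphism on
  the coefficients by values for the variables.\<close>

locale coefficient_hom =
  fixes \<gamma> :: "'k::comm_semiring_1 \<Rightarrow> 'b::comm_semiring_1"
  assumes hom_0: "\<gamma> 0 = 0" and hom_1: "\<gamma> 1 = 1"
    and hom_add: "\<gamma> (a + b) = \<gamma> a + \<gamma> b" and hom_mult: "\<gamma> (a * b) = \<gamma> a * \<gamma> b"
begin

definition ext :: "('n::finite \<Rightarrow> 'b) \<Rightarrow> ('n, 'k) mpoly \<Rightarrow> 'b" where
  "ext x p = (\<Sum>m\<in>keys p. \<gamma> (lookup p m) * (\<Prod>i\<in>UNIV. x i ^ lookup m i))"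

lemma ext_superset:
  assumes "finite S" "keys p \<subseteq> S"
  shows "ext x p = (\<Sum>m\<in>S. \<gamma> (lookup p m) * (\<Prod>i\<in>UNIV. x i ^ lookup m i))"
  unfolding ext_def by (rule sum.mono_neutral_left) (use assms in \<open>auto simp: in_keys_iff hom_0\<close>)

lemma ext_0 [simp]: "ext x 0 = 0"
  by (simp add: ext_def)

lemma ext_add: "ext x (p + q) = ext x p + ext x q"
proof -
  let ?S = "keys p \<union> keys q"
  have "keys (p + q) \<subseteq> ?S" by (rule keys_add)
  then show ?thesis
    by (simp add: ext_superset[of ?S] lookup_add hom_add sum.distrib algebra_simps)
qed

lemma ext_sum: "ext x (sum g I) = (\<Sum>i\<in>I. ext x (g i))"
  by (induction I rule: infinite_finite_induct) (simp_all add: ext_add)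

lemma ext_single: "ext x (single m c) = \<gamma> c * (\<Prod>i\<in>UNIV. x i ^ lookup m i)"
  by (subst ext_superset[of "{m}"]) (auto simp: hom_0 split: if_splits)

lemma ext_Const [simp]: "ext x (Const c) = \<gamma> c"
  by (simp add: Const_def ext_single)

lemma ext_Var [simp]: "ext x (Var i) = x i"
proof -
  have "(\<Prod>j\<in>UNIV. x j ^ lookup (single i 1) j) = (\<Prod>j\<in>UNIV. if i = j then x j else 1)"
    by (intro prod.cong) (auto simp: lookup_single when_def)
  then show ?thesis by (simp add: Var_def ext_single hom_1)
qed

lemma ext_mult: "ext x (p * q) = ext x p * ext x q"
proof -
  have single: "ext x (single m a * single m' b) =
      ext x (single m a) * ext x (single m' b)" for m m' a b
    by (simp add: mult_single ext_single hom_mult lookup_add power_add prod.distrib algebra_simps)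
  let ?p = "\<lambda>p. \<Sum>m\<in>keys p. single m (lookup p m)"
  have "ext x (?p p * ?p q) = ext x (?p p) * ext x (?p q)"
    by (simp add: sum_product ext_sum single)
  then show ?thesis by (simp flip: mpoly_eq_sum_monomials)
qed

lemma ext_1 [simp]: "ext x 1 = 1"
  using ext_Const[of x 1] by (simp add: hom_1)

lemma ext_power: "ext x (p ^ e) = ext x p ^ e"
  by (induction e) (simp_all add: ext_mult)

lemma ext_prod: "ext x (prod g I) = (\<Prod>i\<in>I. ext x (g i))"
  by (induction I rule: infinite_finite_induct) (simp_all add: ext_mult)

end

global_interpretation eval_hom: coefficient_hom "\<lambda>c. c :: 'k::comm_semiring_1"
  by standard auto

lemma eval_at_eq_ext: "eval_at v p = eval_hom.ext (($) v) p"
  by (simp add: eval_at_def eval_hom.ext_def)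

lemma eval_at_0 [simp]: "eval_at v 0 = 0"
  and eval_at_1 [simp]: "eval_at v 1 = 1"
  and eval_at_Const [simp]: "eval_at v (Const c) = c"
  and eval_at_Var [simp]: "eval_at v (Var i) = v $ i"
  and eval_at_add [simp]: "eval_at v (p + q) = eval_at v p + eval_at v q"
  and eval_at_mult [simp]: "eval_at v (p * q) = eval_at v p * eval_at v q"
  and eval_at_power [simp]: "eval_at v (p ^ e) = eval_at v p ^ e"
  unfolding eval_at_eq_ext
  by (rule eval_hom.ext_0 eval_hom.ext_1 eval_hom.ext_Const eval_hom.ext_Var eval_hom.ext_add
      eval_hom.ext_mult eval_hom.ext_power)+

lemma eval_at_sum: "eval_at v (sum g I) = (\<Sum>i\<in>I. eval_at v (g i))"
  and eval_at_prod: "eval_at v (prod g I) = (\<Prod>i\<in>I. eval_at v (g i))"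
  unfolding eval_at_eq_ext by (rule eval_hom.ext_sum eval_hom.ext_prod)+

lemma eval_at_minus [simp]: "eval_at v (- p) = - eval_at v p"
  and eval_at_diff [simp]: "eval_at v (p - q) = eval_at v p - eval_at v q"
  for p q :: "('n::finite, 'k::comm_ring_1) mpoly"
proof -
  show m: "eval_at v (- p) = - eval_at v p" for p
    using eval_at_add[of v "- p" p] by (simp add: eq_neg_iff_add_eq_0 del: eval_at_add)
  show "eval_at v (p - q) = eval_at v p - eval_at v q"
    using eval_at_add[of v p "- q"] by (simp add: m del: eval_at_add)
qed

global_interpretation subst_hom: coefficient_hom "Const :: 'k::comm_semiring_1 \<Rightarrow> ('n::finite, 'k) mpoly"
  by standard (simp_all add: Const_add Const_mult)

lemma subst_vars_eq_ext: "subst_vars \<sigma> p = subst_hom.ext \<sigma> p"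
  by (simp add: subst_vars_def subst_hom.ext_def)

lemma subst_vars_Const [simp]: "subst_vars \<sigma> (Const c) = Const c"
  and subst_vars_Var [simp]: "subst_vars \<sigma> (Var i) = \<sigma> i"
  and subst_vars_add [simp]: "subst_vars \<sigma> (p + q) = subst_vars \<sigma> p + subst_vars \<sigma> q"
  and subst_vars_mult [simp]: "subst_vars \<sigma> (p * q) = subst_vars \<sigma> p * subst_vars \<sigma> q"
  by (simp_all add: subst_vars_eq_ext subst_hom.ext_add subst_hom.ext_mult)

text \<open>The restriction of a polynomial to the affine line \<open>t \<mapsto> v + t u\<close>, a polynomial in \<open>t\<close>. Its
  coefficients are the Taylor coefficients at \<open>v\<close> in the direction \<open>u\<close>.\<close>

global_interpretation line_hom: coefficient_hom "\<lambda>c :: 'k::comm_semiring_1. [:c:]"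
  by standard (auto simp: one_pCons mult.commute)

definition restrict_line :: "'k ^ 'n::finite \<Rightarrow> 'k ^ 'n \<Rightarrow> ('n, 'k::comm_semiring_1) mpoly \<Rightarrow> 'k poly" where
  "restrict_line v u p = line_hom.ext (\<lambda>i. [:v $ i, u $ i:]) p"

lemma restrict_line_Const [simp]: "restrict_line v u (Const c) = [:c:]"
  and restrict_line_1 [simp]: "restrict_line v u 1 = 1"
  and restrict_line_0 [simp]: "restrict_line v u 0 = 0"
  and restrict_line_Var [simp]: "restrict_line v u (Var i) = [:v $ i, u $ i:]"
  and restrict_line_add [simp]: "restrict_line v u (p + q) = restrict_line v u p + restrict_line v u q"
  and restrict_line_mult [simp]: "restrict_line v u (p * q) = restrict_line v u p * restrict_line v u q"
  by (simp_all add: restrict_line_def line_hom.ext_add line_hom.ext_mult)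

lemma poly_restrict_line: "poly (restrict_line v u p) t = eval_at (v + t *s u) p"
  by (induction p rule: mpoly_induct) (simp_all add: algebra_simps)

lemma coeff_0_restrict_line: "coeff (restrict_line v u p) 0 = eval_at v p"
  using poly_restrict_line[of v u p 0] by (simp add: poly_0_coeff_0)

subsection \<open>The grading\<close>

lemma total_degree_0 [simp]: "total_degree 0 = 0"
  and total_degree_add [simp]: "total_degree (a + b) = total_degree a + total_degree b"
  by (simp_all add: total_degree_def lookup_add sum.distrib)

lemma total_degree_single [simp]: "total_degree (single i e) = e"
  by (simp add: total_degree_def lookup_single when_def)

lemma graded_piece_iff:
  "p \<in> graded_piece d \<longleftrightarrow> (\<forall>m. lookup p m \<noteq> 0 \<longrightarrow> total_degree m = d)"
  by (auto simp: graded_piece_def in_keys_iff)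

lemma graded_piece_0_mem [simp]: "0 \<in> graded_piece d"
  by (simp add: graded_piece_iff)

lemma graded_piece_add: "p \<in> graded_piece d \<Longrightarrow> q \<in> graded_piece d \<Longrightarrow> p + q \<in> graded_piece d"
  unfolding graded_piece_iff by (metis add.right_neutral lookup_add)

lemma graded_piece_mult:
  fixes p q :: "('n::finite, 'k::comm_semiring_1) mpoly"
  assumes "p \<in> graded_piece a" "q \<in> graded_piece b"
  shows "p * q \<in> graded_piece (a + b)"
  using keys_mult[of p q] assms unfolding graded_piece_def by fastforce

lemma graded_piece_minus: "- p \<in> graded_piece d \<longleftrightarrow> p \<in> graded_piece d"
  for p :: "('n::finite, 'k::comm_ring_1) mpoly"
  by (simp add: graded_piece_iff)

lemma graded_piece_diff: "p \<in> graded_piece d \<Longrightarrow> q \<in> graded_piece d \<Longrightarrow> p - q \<in> graded_piece d"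
  for p :: "('n::finite, 'k::comm_ring_1) mpoly"
  using graded_piece_add[of p d "- q"] by (simp add: graded_piece_minus)

lemma graded_piece_sum: "(\<And>i. i \<in> I \<Longrightarrow> g i \<in> graded_piece d) \<Longrightarrow> sum g I \<in> graded_piece d"
  by (induction I rule: infinite_finite_induct) (auto intro: graded_piece_add)

lemma graded_piece_single [simp]: "total_degree m = d \<Longrightarrow> single m c \<in> graded_piece d"
  by (auto simp: graded_piece_def)

lemma graded_piece_Const [simp]: "Const c \<in> graded_piece 0"
  by (simp add: Const_def)

lemma graded_piece_1 [simp]: "1 \<in> graded_piece 0"
  by (metis Const_1 graded_piece_Const)

lemma graded_piece_Var [simp]: "Var i \<in> graded_piece 1" "Var i \<in> graded_piece (Suc 0)"
  by (simp_all add: Var_def)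

lemma graded_piece_power: "p \<in> graded_piece d \<Longrightarrow> p ^ e \<in> graded_piece (e * d)"
  for p :: "('n::finite, 'k::comm_semiring_1) mpoly"
  by (induction e) (auto intro: graded_piece_mult)

lemma graded_piece_Const_mult: "p \<in> graded_piece d \<Longrightarrow> Const c * p \<in> graded_piece d"
  for p :: "('n::finite, 'k::comm_semiring_1) mpoly"
  using graded_piece_mult[of "Const c" 0 p d] by simp

lemma graded_piece_prod:
  fixes g :: "'i \<Rightarrow> ('n::finite, 'k::comm_semiring_1) mpoly"
  shows "(\<And>i. i \<in> I \<Longrightarrow> g i \<in> graded_piece (\<delta> i)) \<Longrightarrow> prod g I \<in> graded_piece (sum \<delta> I)"
  by (induction I rule: infinite_finite_induct) (auto intro: graded_piece_mult)

lemma lookup_hom_component: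
  "lookup (hom_component d p) m = (if total_degree m = d then lookup p m else 0)"
proof -
  have "lookup (hom_component d p) m =
      (\<Sum>m'\<in>{m' \<in> keys p. total_degree m' = d}. if m' = m then lookup p m' else 0)"
    by (simp add: hom_component_def lookup_sum lookup_single when_def)
  also have "\<dots> = (if total_degree m = d then lookup p m else 0)"
    by (subst sum.delta) (auto simp: in_keys_iff)
  finally show ?thesis .
qed

lemma hom_component_add: "hom_component d (p + q) = hom_component d p + hom_component d q"
  by (rule poly_mapping_eqI) (simp add: lookup_hom_component lookup_add)

lemma hom_component_0 [simp]: "hom_component d 0 = 0"
  by (rule poly_mapping_eqI) (simp add: lookup_hom_component)

lemma hom_component_sum: "hom_component d (sum g I) = (\<Sum>i\<in>I. hom_component d (g i))"
  by (induction I rule: infinite_finite_induct) (simp_all add: hom_component_add)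

lemma hom_component_graded_piece [simp]: "hom_component d p \<in> graded_piece d"
  by (simp add: graded_piece_iff lookup_hom_component)

lemma hom_component_of_graded: "p \<in> graded_piece d \<Longrightarrow> hom_component e p = (if e = d then p else 0)"
  by (rule poly_mapping_eqI) (auto simp: lookup_hom_component graded_piece_iff)

lemma degree_bound: obtains D where "\<And>m. m \<in> keys p \<Longrightarrow> total_degree m < D"
proof -
  have "finite (total_degree ` keys p)" by simp
  then obtain D where "\<forall>x \<in> total_degree ` keys p. x < D"
    by (metis finite_nat_bounded lessThan_iff subsetD)
  then show ?thesis using that by auto
qed

lemma sum_hom_components:
  assumes "\<And>m. m \<in> keys p \<Longrightarrow> total_degree m < D"
  shows "(\<Sum>d<D. hom_component d p) = p"
proof (rule poly_mapping_eqI)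
  fix m
  have "lookup (\<Sum>d<D. hom_component d p) m = (\<Sum>d<D. if total_degree m = d then lookup p m else 0)"
    by (simp add: lookup_sum lookup_hom_component)
  also have "\<dots> = lookup p m"
    using assms[of m] by (auto simp: in_keys_iff)
  finally show "lookup (\<Sum>d<D. hom_component d p) m = lookup p m" .
qed

lemma hom_component_mult_graded:
  fixes p q :: "('n::finite, 'k::comm_semiring_1) mpoly"
  assumes q: "q \<in> graded_piece b"
  shows "hom_component m (p * q) = (if b \<le> m then hom_component (m - b) p * q else 0)"
proof -
  obtain D where D: "\<And>m. m \<in> keys p \<Longrightarrow> total_degree m < D"
    by (rule degree_bound[of p]) blast
  let ?D = "max D (Suc m)"
  have p: "p = (\<Sum>d<?D. hom_component d p)"
    using sum_hom_components[of p ?D] D by (simp add: less_max_iff_disj)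
  have "hom_component m (p * q) = (\<Sum>d<?D. hom_component m (hom_component d p * q))"
    by (subst p) (simp only: sum_distrib_right hom_component_sum)
  also have "\<dots> = (\<Sum>d<?D. if m = d + b then hom_component d p * q else 0)"
    by (intro sum.cong refl hom_component_of_graded graded_piece_mult hom_component_graded_piece q)
  also have "\<dots> = (\<Sum>d<?D. if d = m - b \<and> b \<le> m then hom_component d p * q else 0)"
    by (intro sum.cong refl) auto
  also have "\<dots> = (if b \<le> m then hom_component (m - b) p * q else 0)"
    by (cases "b \<le> m") auto
  finally show ?thesis .
qed

lemma restrict_line_origin_graded:
  fixes p :: "('n::finite, 'k::comm_semiring_1) mpoly"
  assumes "p \<in> graded_piece d"
  shows "restrict_line 0 u p = monom (eval_at u p) d"
proof -
  have *: "restrict_line 0 u (single m c) = monom (eval_at u (single m c)) (total_degree m)"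
    for m c
  proof -
    have "restrict_line 0 u (single m c) = [:c:] * (\<Prod>i\<in>UNIV. monom (u $ i) 1 ^ lookup m i)"
      by (simp add: restrict_line_def line_hom.ext_single monom_altdef)
    also have "(\<Prod>i\<in>UNIV. monom (u $ i) 1 ^ lookup m i) =
        (\<Prod>i\<in>UNIV. monom (u $ i ^ lookup m i) (lookup m i))"
      by (simp add: monom_power)
    also have "\<dots> = monom (\<Prod>i\<in>UNIV. u $ i ^ lookup m i) (total_degree m)"
    proof -
      have "(\<Prod>i\<in>I. monom (g i) (h i)) = monom (\<Prod>i\<in>I. g i) (\<Sum>i\<in>I. h i)"
        for I :: "'n set" and g :: "'n \<Rightarrow> 'k" and h
        by (induction I rule: infinite_finite_induct) (simp_all add: mult_monom one_pCons monom_0)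
      then show ?thesis by (simp add: total_degree_def)
    qed
    finally show ?thesis
      by (simp add: eval_at_eq_ext eval_hom.ext_single smult_monom)
  qed
  have "restrict_line 0 u p = (\<Sum>m\<in>keys p. restrict_line 0 u (single m (lookup p m)))"
    by (subst mpoly_eq_sum_monomials) (simp add: restrict_line_def line_hom.ext_sum)
  also have "\<dots> = (\<Sum>m\<in>keys p. monom (eval_at u (single m (lookup p m))) d)"
    by (intro sum.cong refl) (use assms in \<open>simp add: * graded_piece_def\<close>)
  also have "\<dots> = monom (\<Sum>m\<in>keys p. eval_at u (single m (lookup p m))) d"
    by (rule poly_eqI) (simp add: coeff_sum)
  also have "(\<Sum>m\<in>keys p. eval_at u (single m (lookup p m))) = eval_at u p"
    by (simp flip: eval_at_sum mpoly_eq_sum_monomials)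
  finally show ?thesis .
qed

lemma coeff_restrict_line_origin: "coeff (restrict_line 0 u p) d = eval_at u (hom_component d p)"
proof -
  obtain D where D: "\<And>m. m \<in> keys p \<Longrightarrow> total_degree m < D"
    by (rule degree_bound[of p]) blast
  let ?D = "max D (Suc d)"
  have p: "p = (\<Sum>d<?D. hom_component d p)"
    using sum_hom_components[of p ?D] D by (simp add: less_max_iff_disj)
  have "restrict_line 0 u p = (\<Sum>d<?D. restrict_line 0 u (hom_component d p))"
    by (subst p) (simp only: restrict_line_def line_hom.ext_sum)
  also have "\<dots> = (\<Sum>d<?D. monom (eval_at u (hom_component d p)) d)"
    by (intro sum.cong refl restrict_line_origin_graded) simp
  finally show ?thesis
    by (simp add: coeff_sum)
qed

lemma eval_at_scale:
  assumes "p \<in> graded_piece d"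
  shows "eval_at (c *s v) p = c ^ d * eval_at v p"
  using poly_restrict_line[of 0 v p c] restrict_line_origin_graded[OF assms, of v]
  by (simp add: poly_monom mult.commute)

subsection \<open>Partial derivatives\<close>

lemma lookup_partial_deriv:
  fixes p :: "('n, 'k::comm_semiring_1) mpoly"
  shows "lookup (partial_deriv i p) m =
   of_nat (Suc (lookup m i)) * lookup p (m + single i 1)"
proof -
  let ?\<delta> = "single i (1::nat)"
  have eq: "(if m' - ?\<delta> = m then of_nat (lookup m' i) * lookup p m' else 0) =
      (if m' = m + ?\<delta> then of_nat (lookup m' i) * lookup p m' else 0)" for m'
  proof (cases "lookup m' i = 0")
    case False
    have "m' - ?\<delta> = m \<longleftrightarrow> m' = m + ?\<delta>"
    proof
      assume "m' - ?\<delta> = m"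
      then show "m' = m + ?\<delta>"
        using False by (intro poly_mapping_eqI) (auto simp: lookup_add lookup_minus lookup_single when_def)
    qed simp
    then show ?thesis by simp
  qed auto
  have "lookup (partial_deriv i p) m = (\<Sum>m'\<in>keys p.
      if m' - ?\<delta> = m then of_nat (lookup m' i) * lookup p m' else 0)"
    by (simp add: partial_deriv_def lookup_sum lookup_single when_def)
  also have "\<dots> = of_nat (Suc (lookup m i)) * lookup p (m + ?\<delta>)"
    unfolding eq by (auto simp: lookup_add in_keys_iff)
  finally show ?thesis .
qed

lemma partial_deriv_0 [simp]: "partial_deriv i 0 = 0"
  by (simp add: partial_deriv_def)

lemma partial_deriv_add: "partial_deriv i (p + q) = partial_deriv i p + partial_deriv i q"
  by (rule poly_mapping_eqI) (simp only: lookup_partial_deriv lookup_add distrib_left)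

lemma partial_deriv_sum: "partial_deriv i (sum g I) = (\<Sum>j\<in>I. partial_deriv i (g j))"
  by (induction I rule: infinite_finite_induct) (simp_all add: partial_deriv_add)

lemma partial_deriv_single:
  "partial_deriv i (single m c) =
    single (m - single i 1) (of_nat (lookup m i) * c)"
  by (cases "c = 0") (simp_all add: partial_deriv_def)

lemma partial_deriv_Const [simp]: "partial_deriv i (Const c) = 0"
  by (simp add: Const_def partial_deriv_single)

lemma partial_deriv_1 [simp]: "partial_deriv i 1 = 0"
  using partial_deriv_Const[of i 1] by simp

lemma partial_deriv_Var: "partial_deriv i (Var j) = (if i = j then 1 else 0)"
  by (auto simp: Var_def partial_deriv_single lookup_single)

lemma partial_deriv_mult:
  "partial_deriv i (p * q) = partial_deriv i p * q + p * partial_deriv i (q :: ('n, 'k::comm_semiring_1) mpoly)"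
proof -
  let ?\<delta> = "single i (1::nat)"
  have single: "partial_deriv i (single m a * single m' b) =
     partial_deriv i (single m a) * single m' b +
     single m a * partial_deriv i (single m' b :: ('n, 'k) mpoly)" for m m' a b
  proof -
    have shift: "single (m + m' - ?\<delta>) (of_nat (lookup m i) * c) =
        single (m - ?\<delta> + m') (of_nat (lookup m i) * c)" for m m' and c :: 'k
    proof (cases "lookup m i = 0")
      case False
      then have "m + m' - ?\<delta> = m - ?\<delta> + m'"
        by (intro poly_mapping_eqI) (auto simp: lookup_add lookup_minus lookup_single when_def)
      then show ?thesis by simp
    qed simp
    show ?thesis
      using shift[of m m' "a * b"] shift[of m' m "a * b"]
      by (simp add: mult_single partial_deriv_single lookup_add distrib_left distrib_right single_add algebra_simps)
  qed
  let ?p = "\<lambda>p. \<Sum>m\<in>keys p. single m (lookup p m)"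
  have "partial_deriv i (?p p * ?p q) = partial_deriv i (?p p) * ?p q + ?p p * partial_deriv i (?p q)"
    by (simp add: sum_product partial_deriv_sum single sum.distrib)
  then show ?thesis by (simp flip: mpoly_eq_sum_monomials)
qed

lemma partial_deriv_commute: "partial_deriv i (partial_deriv j p) = partial_deriv j (partial_deriv i p)"
  by (rule poly_mapping_eqI)
    (auto simp: lookup_partial_deriv lookup_add lookup_single when_def algebra_simps)

lemma partial_deriv_graded:
  assumes "p \<in> graded_piece (Suc d)"
  shows "partial_deriv i p \<in> graded_piece d"
  unfolding graded_piece_iff
proof (intro allI impI)
  fix m assume "lookup (partial_deriv i p) m \<noteq> 0"
  then have "lookup p (m + single i 1) \<noteq> 0"
    by (auto simp: lookup_partial_deriv)
  then have "total_degree (m + single i 1) = Suc d"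
    using assms unfolding graded_piece_iff by blast
  then show "total_degree m = d" by simp
qed

lemma Euler_identity:
  fixes p :: "('n::finite, 'k::comm_semiring_1) mpoly"
  assumes "p \<in> graded_piece d"
  shows "(\<Sum>i\<in>UNIV. Var i * partial_deriv i p) = of_nat d * p"
proof -
  have single: "Var i * partial_deriv i (single m c) =
      (of_nat (lookup m i) * single m c :: ('n, 'k) mpoly)" for m c i
  proof (cases "lookup m i = 0")
    case False
    then have "single i (1::nat) + (m - single i 1) = m"
      by (intro poly_mapping_eqI) (auto simp: lookup_add lookup_minus lookup_single when_def)
    then show ?thesis
      by (simp add: Var_def partial_deriv_single mult_single Const_mult_single flip: Const_of_nat)
  qed (simp add: partial_deriv_single)
  have *: "(\<Sum>i\<in>UNIV. Var i * partial_deriv i (single m c)) =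
      (of_nat (total_degree m) * single m c :: ('n, 'k) mpoly)" for m c
    unfolding single by (simp add: total_degree_def sum_distrib_right)
  have "(\<Sum>i\<in>UNIV. Var i * partial_deriv i p) =
      (\<Sum>m\<in>keys p. \<Sum>i\<in>UNIV. Var i * partial_deriv i (single m (lookup p m)))"
    by (subst mpoly_eq_sum_monomials) (simp only: partial_deriv_sum sum_distrib_left sum.swap[of _ UNIV])
  also have "\<dots> = (\<Sum>m\<in>keys p. of_nat d * single m (lookup p m))"
    by (intro sum.cong refl) (use assms in \<open>simp add: * graded_piece_def\<close>)
  also have "\<dots> = of_nat d * p"
    by (simp flip: sum_distrib_left mpoly_eq_sum_monomials)
  finally show ?thesis .
qed

lemma Euler_identity_at:
  assumes "p \<in> graded_piece d"
  shows "(\<Sum>i\<in>UNIV. v $ i * eval_at v (partial_deriv i p)) = of_nat d * eval_at v p"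
  using arg_cong[OF Euler_identity[OF assms], of "eval_at v"]
  by (simp add: eval_at_sum flip: Const_of_nat)

lemma pderiv_restrict_line:
  fixes p :: "('n::finite, 'k::{comm_semiring_1,semiring_no_zero_divisors}) mpoly"
  shows "pderiv (restrict_line v u p) = (\<Sum>i\<in>UNIV. smult (u $ i) (restrict_line v u (partial_deriv i p)))"
proof (induction p rule: mpoly_induct)
  case (Var j)
  have "(\<Sum>i\<in>UNIV. smult (u $ i) (restrict_line v u (partial_deriv i (Var j)))) =
      (\<Sum>i\<in>UNIV. if i = j then [:u $ i:] else 0)"
    by (intro sum.cong) (auto simp: partial_deriv_Var)
  then show ?case by (simp add: pderiv_pCons)
next
  case (mult p q)
  then show ?case
    by (simp add: pderiv_mult partial_deriv_mult smult_add_right sum.distrib sum_distrib_left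
        sum_distrib_right algebra_simps)
qed (simp_all add: pderiv_pCons pderiv_add partial_deriv_add smult_add_right sum.distrib)

section \<open>Homogeneous ideals and the projective Nullstellensatz\<close>

definition homogeneous_ideal :: "('n::finite, 'k::comm_ring_1) mpoly set \<Rightarrow> bool" where
  "homogeneous_ideal I \<longleftrightarrow> is_ideal I \<and> (\<forall>p\<in>I. \<forall>d. hom_component d p \<in> I)"

lemma finite_total_degree: "finite {m :: 'n::finite \<Rightarrow>\<^sub>0 nat. total_degree m = d}"
proof (rule finite_imageD)
  have "lookup ` {m :: 'n \<Rightarrow>\<^sub>0 nat. total_degree m = d} \<subseteq> PiE UNIV (\<lambda>_. {..d})"
    by (auto simp: total_degree_def PiE_def extensional_def intro: member_le_sum)
  then show "finite (lookup ` {m :: 'n \<Rightarrow>\<^sub>0 nat. total_degree m = d})"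
    by (rule finite_subset) (intro finite_PiE; simp)
qed (simp add: inj_on_def lookup_inject)

lemma span_monomials:
  "mpoly.span ((\<lambda>m. single m 1) ` M) = {p :: ('n, 'k::field) mpoly. keys p \<subseteq> M}"
    (is "mpoly.span ?M = _")
proof
  show "{p. keys p \<subseteq> M} \<subseteq> mpoly.span ?M"
  proof
    fix p :: "('n, 'k) mpoly" assume p: "p \<in> {p. keys p \<subseteq> M}"
    have "(\<Sum>m\<in>keys p. Const (lookup p m) * single m 1) \<in> mpoly.span ?M"
      by (intro mpoly.span_sum mpoly.span_scale mpoly.span_base) (use p in auto)
    then show "p \<in> mpoly.span ?M"
      by (simp add: Const_mult_single flip: mpoly_eq_sum_monomials)
  qed
  have "mpoly.subspace {p :: ('n, 'k) mpoly. keys p \<subseteq> M}"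
  proof (rule mpoly.subspaceI)
    fix p q :: "('n, 'k) mpoly" and c
    assume "p \<in> {p. keys p \<subseteq> M}" "q \<in> {p. keys p \<subseteq> M}"
    then show "p + q \<in> {p. keys p \<subseteq> M}" "Const c * p \<in> {p. keys p \<subseteq> M}"
      using keys_add[of p q] keys_Const_mult[of c p] by auto
  qed simp
  then show "mpoly.span ?M \<subseteq> {p. keys p \<subseteq> M}"
    by (rule mpoly.span_minimal[rotated]) auto
qed

lemma graded_piece_span:
  "graded_piece d = mpoly.span ((\<lambda>m. single m 1) ` {m. total_degree m = d} :: ('n::finite, 'k::field) mpoly set)"
  by (auto simp: span_monomials graded_piece_def)

lemma graded_piece_0_D: "p \<in> graded_piece 0 \<Longrightarrow> p = Const (eval_at v p)"
  for p :: "('n::finite, 'k::comm_semiring_1) mpoly"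
proof -
  assume "p \<in> graded_piece 0"
  then have "m = 0" if "m \<in> keys p" for m
    using that by (intro poly_mapping_eqI) (auto simp: graded_piece_def total_degree_def)
  then have "p = Const (lookup p 0)"
    by (intro poly_mapping_eqI) (auto simp: Const_def lookup_single when_def in_keys_iff)
  then show ?thesis by (metis eval_at_Const)
qed

text \<open>In characteristic zero, Euler's identity exhibits a form of positive degree as an explicit
  combination of the variables. It replaces arguments by monomials in the inductions on degrees.\<close>

lemma graded_piece_Suc_D:
  fixes p :: "('n::finite, 'k::field_char_0) mpoly"
  assumes "p \<in> graded_piece (Suc d)"
  obtains q where "\<And>i. q i \<in> graded_piece d" "p = (\<Sum>i\<in>UNIV. Var i * q i)"
proof
  let ?c = "inverse (of_nat (Suc d)) :: 'k"
  show "Const ?c * partial_deriv i p \<in> graded_piece d" for i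
    by (intro graded_piece_Const_mult partial_deriv_graded assms)
  have "(\<Sum>i\<in>UNIV. Var i * (Const ?c * partial_deriv i p)) = Const ?c * (\<Sum>i\<in>UNIV. Var i * partial_deriv i p)"
    by (simp add: sum_distrib_left algebra_simps)
  also have "\<dots> = Const (?c * of_nat (Suc d)) * p"
    by (simp only: Euler_identity[OF assms] Const_mult Const_of_nat mult.assoc)
  also have "\<dots> = p"
    by (subst left_inverse) (simp_all del: of_nat_Suc)
  finally show "p = (\<Sum>i\<in>UNIV. Var i * (Const ?c * partial_deriv i p))" ..
qed

lemma graded_piece_mult_subset_ideal:
  fixes I :: "('n::finite, 'k::field_char_0) mpoly set"
  assumes "is_ideal I" "\<And>p q. p \<in> graded_piece a \<Longrightarrow> q \<in> graded_piece b \<Longrightarrow> p * q \<in> I"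
  shows "graded_piece (a + b) \<subseteq> I"
  using assms
proof (induction a arbitrary: I)
  case 0
  then show ?case using "0.prems"(2)[OF graded_piece_1] by auto
next
  case (Suc a)
  have "Var i * r \<in> I" if "r \<in> graded_piece (a + b)" for i r
  proof -
    have "is_ideal {r. Var i * r \<in> I}"
      using Suc.prems(1) unfolding mpoly_ideal.subspace_def
      by (auto simp: distrib_left mult.left_commute[of "Var i"])
    moreover have "Var i * (p * q) \<in> I" if "p \<in> graded_piece a" "q \<in> graded_piece b" for p q
      using Suc.prems(2)[of "Var i * p" q] that graded_piece_mult[of "Var i" 1 p a]
      by (simp add: mult.assoc)
    ultimately show ?thesis using Suc.IH[of "{r. Var i * r \<in> I}"] that by auto
  qed
  then have "(\<Sum>i\<in>UNIV. Var i * q i) \<in> I" if "\<And>i. q i \<in> graded_piece (a + b)" for q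
    using that by (auto intro!: mpoly_ideal.subspace_sum Suc.prems(1))
  then have "p \<in> I" if "p \<in> graded_piece (Suc (a + b))" for p
    using graded_piece_Suc_D[OF that] by metis
  then show ?case by auto
qed

lemma graded_piece_subset_ideal_mono:
  fixes I :: "('n::finite, 'k::field_char_0) mpoly set"
  assumes I: "is_ideal I" and sub: "graded_piece m \<subseteq> I" and "m \<le> m'"
  shows "graded_piece m' \<subseteq> I"
proof -
  have "graded_piece ((m' - m) + m) \<subseteq> I"
    using sub by (intro graded_piece_mult_subset_ideal I mpoly_ideal.subspace_scale[OF I]) auto
  then show ?thesis using \<open>m \<le> m'\<close> by simp
qed

text \<open>Replacing each variable \<open>x\<^sub>j\<close> by \<open>c\<^sub>j y\<close>, which is congruent to it, turns a form into a multiple of a power of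
  \<open>y\<close>.\<close>

lemma congruent_evaluation:
  fixes p :: "('n::finite, 'k::field_char_0) mpoly"
  assumes I: "is_ideal I" and lin: "\<And>j. Var j - Const (c $ j) * y \<in> I"
    and p: "p \<in> graded_piece m"
  shows "p - Const (eval_at c p) * y ^ m \<in> I"
  using p
proof (induction m arbitrary: p)
  case 0
  then show ?case using graded_piece_0_D[of p c] mpoly_ideal.subspace_0[OF I] by simp
next
  case (Suc m)
  from Suc.prems obtain q where q: "\<And>i. q i \<in> graded_piece m" and p: "p = (\<Sum>i\<in>UNIV. Var i * q i)"
    by (rule graded_piece_Suc_D) blast
  have "p - Const (eval_at c p) * y ^ Suc m =
      (\<Sum>i\<in>UNIV. Var i * (q i - Const (eval_at c (q i)) * y ^ m) +
        (Const (eval_at c (q i)) * y ^ m) * (Var i - Const (c $ i) * y))"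
    by (simp add: p eval_at_sum Const_mult algebra_simps sum.distrib sum_subtractf sum_distrib_left
        Const_sum)
  also have "\<dots> \<in> I"
    by (intro mpoly_ideal.subspace_sum[OF I] mpoly_ideal.subspace_add[OF I] mpoly_ideal.subspace_scale[OF I] Suc.IH q lin)
  finally show ?case .
qed

lemma (in vector_space) nontrivial_relation:
  fixes u :: "nat \<Rightarrow> 'b"
  assumes "finite B" "card B \<le> D" "\<And>a. a \<le> D \<Longrightarrow> u a \<in> span B"
  obtains \<alpha> where "\<exists>a\<le>D. \<alpha> a \<noteq> 0" "(\<Sum>a\<le>D. scale (\<alpha> a) (u a)) = 0"
proof (cases "inj_on u {..D}")
  case True
  have "dependent (u ` {..D})"
  proof (rule ccontr)
    assume "independent (u ` {..D})"
    then have "card (u ` {..D}) \<le> card B"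
      using independent_span_bound[OF assms(1)] assms(3) by blast
    then show False using assms(2) by (simp add: card_image[OF True])
  qed
  then obtain \<beta> where \<beta>: "\<exists>v\<in>u ` {..D}. \<beta> v \<noteq> 0" "(\<Sum>v\<in>u ` {..D}. scale (\<beta> v) v) = 0"
    by (auto simp: dependent_finite)
  show ?thesis
    by (rule that[of "\<beta> \<circ> u"]) (use \<beta> in \<open>auto simp: sum.reindex[OF True]\<close>)
next
  case False
  then obtain a b where ab: "a \<le> D" "b \<le> D" "a \<noteq> b" "u a = u b" by (auto simp: inj_on_def)
  let ?\<alpha> = "\<lambda>c. if c = a then 1 else if c = b then -1 else 0"
  have "(\<Sum>c\<le>D. scale (?\<alpha> c) (u c)) = (\<Sum>c\<in>{a, b}. scale (?\<alpha> c) (u c))"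
    using ab by (intro sum.mono_neutral_right) auto
  also have "\<dots> = 0" using ab by simp
  finally show ?thesis using ab by (intro that[of ?\<alpha>]) auto
qed

text \<open>A homogeneous prime ideal that contains a binary form in \<open>x\<close> and \<open>y\<close> contains one of its
  linear factors, which exist because the field is algebraically closed.\<close>

lemma binary_form_linear_factor:
  fixes x y :: "('n::finite, 'k::alg_closed_field) mpoly"
  assumes prime: "\<And>g h a b. g \<in> graded_piece a \<Longrightarrow> h \<in> graded_piece b \<Longrightarrow> g * h \<in> I \<Longrightarrow> g \<in> I \<or> h \<in> I"
    and I: "is_ideal I"
    and x: "x \<in> graded_piece 1" and y: "y \<in> graded_piece 1" and y_pow: "\<And>e. y ^ e \<notin> I"
    and "P \<noteq> 0" "degree P \<le> E" "(\<Sum>a\<le>E. Const (coeff P a) * x ^ a * y ^ (E - a)) \<in> I"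
  shows "\<exists>c. x - Const c * y \<in> I"
  using assms(6-8)
proof (induction E arbitrary: P)
  case 0
  then have "coeff P 0 \<noteq> 0" by (metis le_zero_eq leading_coeff_0_iff)
  moreover have "Const (coeff P 0) \<in> I" using 0 by simp
  then have "Const (inverse (coeff P 0)) * Const (coeff P 0) \<in> I"
    by (rule mpoly_ideal.subspace_scale[OF I])
  ultimately have "1 \<in> I" by (simp flip: Const_mult)
  then show ?case using y_pow[of 0] by simp
next
  case (Suc E)
  show ?case
  proof (cases "degree P = 0")
    case True
    then obtain c where P: "P = [:c:]" by (rule degree_eq_zeroE)
    then have "c \<noteq> 0" using Suc.prems by simp
    have "(\<Sum>a\<le>Suc E. Const (coeff P a) * x ^ a * y ^ (Suc E - a)) = Const c * y ^ Suc E"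
    proof -
      have "(\<Sum>a\<le>Suc E. Const (coeff P a) * x ^ a * y ^ (Suc E - a)) =
          (\<Sum>a\<in>{0}. Const (coeff P a) * x ^ a * y ^ (Suc E - a))"
        by (rule sum.mono_neutral_right) (auto simp: P coeff_pCons split: nat.splits)
      then show ?thesis by (simp add: P)
    qed
    then have "Const (inverse c) * (Const c * y ^ Suc E) \<in> I"
      using mpoly_ideal.subspace_scale[OF I] Suc.prems(3) by metis
    then have "y ^ Suc E \<in> I"
      using \<open>c \<noteq> 0\<close> by (simp add: mult.assoc [symmetric] del: power_Suc flip: Const_mult)
    then show ?thesis using y_pow by blast
  next
    case False
    then obtain c where "poly P c = 0" using alg_closed_imp_poly_has_root[of P] by blast
    then obtain Q where Q: "P = [:-c, 1:] * Q" by (metis dvdE poly_eq_0_iff_dvd)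
    then have "Q \<noteq> 0" using Suc.prems by auto
    have dQ: "degree Q \<le> E"
    proof -
      have "degree P = Suc (degree Q)" unfolding Q using \<open>Q \<noteq> 0\<close> by (subst degree_mult_eq) auto
      then show ?thesis using Suc.prems by simp
    qed
    let ?H = "\<Sum>a\<le>E. Const (coeff Q a) * x ^ a * y ^ (E - a)"
    have coeff_P: "coeff P a = (case a of 0 \<Rightarrow> 0 | Suc b \<Rightarrow> coeff Q b) - c * coeff Q a" for a
      by (simp add: Q coeff_pCons split: nat.splits)
    have "(\<Sum>a\<le>Suc E. Const (coeff P a) * x ^ a * y ^ (Suc E - a)) =
        (\<Sum>a\<le>Suc E. Const (case a of 0 \<Rightarrow> 0 | Suc b \<Rightarrow> coeff Q b) * x ^ a * y ^ (Suc E - a)) -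
        (\<Sum>a\<le>Suc E. Const (c * coeff Q a) * x ^ a * y ^ (Suc E - a))"
      by (simp add: coeff_P Const_diff left_diff_distrib sum_subtractf)
    also have "(\<Sum>a\<le>Suc E. Const (case a of 0 \<Rightarrow> 0 | Suc b \<Rightarrow> coeff Q b) * x ^ a * y ^ (Suc E - a)) = x * ?H"
      by (subst sum.atMost_Suc_shift) (simp add: sum_distrib_left algebra_simps)
    also have "(\<Sum>a\<le>Suc E. Const (c * coeff Q a) * x ^ a * y ^ (Suc E - a)) =
        (\<Sum>a\<le>E. Const (c * coeff Q a) * x ^ a * y ^ (Suc E - a))"
      using dQ by (simp add: coeff_eq_0)
    also have "\<dots> = Const c * y * ?H"
      unfolding sum_distrib_left
      by (intro sum.cong refl) (simp add: Const_mult Suc_diff_le algebra_simps)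
    finally have "(x - Const c * y) * ?H \<in> I"
      using Suc.prems(3) by (simp add: left_diff_distrib)
    moreover have "x - Const c * y \<in> graded_piece 1"
      by (intro graded_piece_diff graded_piece_Const_mult x y)
    moreover have "?H \<in> graded_piece E"
    proof (rule graded_piece_sum)
      fix a assume "a \<in> {..E}"
      then show "Const (coeff Q a) * x ^ a * y ^ (E - a) \<in> graded_piece E"
        using graded_piece_mult[OF graded_piece_Const_mult[OF graded_piece_power[OF x, of a]] graded_piece_power[OF y, of "E - a"]]
        by simp
    qed
    ultimately consider "x - Const c * y \<in> I" | "?H \<in> I" using prime by blast
    then show ?thesis
    proof cases
      case 2
      then show ?thesis using Suc.IH[OF \<open>Q \<noteq> 0\<close> dQ] by simp
    qed blast
  qed
qed

lemma homogeneous_ideal_insert: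
  fixes I :: "('n::finite, 'k::comm_ring_1) mpoly set"
  assumes I: "homogeneous_ideal I" and h: "h \<in> graded_piece b"
  shows "homogeneous_ideal {p. \<exists>c. p - c * h \<in> I}"
  unfolding homogeneous_ideal_def
proof (intro conjI ballI allI)
  have sub: "is_ideal I" using I by (simp add: homogeneous_ideal_def)
  show "is_ideal {p. \<exists>c. p - c * h \<in> I}"
  proof (rule mpoly_ideal.subspaceI)
    show "0 \<in> {p. \<exists>c. p - c * h \<in> I}" using mpoly_ideal.subspace_0[OF sub] by (auto intro: exI[of _ 0])
  next
    fix p q assume "p \<in> {p. \<exists>c. p - c * h \<in> I}" "q \<in> {p. \<exists>c. p - c * h \<in> I}"
    then obtain c c' where "p - c * h \<in> I" "q - c' * h \<in> I" by blast
    from mpoly_ideal.subspace_add[OF sub this] show "p + q \<in> {p. \<exists>c. p - c * h \<in> I}"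
      by (auto intro!: exI[of _ "c + c'"] simp: algebra_simps)
  next
    fix r p assume "p \<in> {p. \<exists>c. p - c * h \<in> I}"
    then obtain c where "p - c * h \<in> I" by blast
    from mpoly_ideal.subspace_scale[OF sub this, of r] show "r * p \<in> {p. \<exists>c. p - c * h \<in> I}"
      by (auto intro!: exI[of _ "r * c"] simp: algebra_simps)
  qed
next
  fix p d assume "p \<in> {p. \<exists>c. p - c * h \<in> I}"
  then obtain c where "p - c * h \<in> I" by blast
  then have "hom_component d (p - c * h) \<in> I" using I by (simp add: homogeneous_ideal_def)
  moreover have "hom_component d p = hom_component d (p - c * h) + hom_component d (c * h)"
    by (simp flip: hom_component_add)
  ultimately have "hom_component d p - (if b \<le> d then hom_component (d - b) c else 0) * h \<in> I"
    by (simp add: hom_component_mult_graded[OF h] split: if_splits)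
  then show "hom_component d p \<in> {p. \<exists>c. p - c * h \<in> I}" by blast
qed

text \<open>Zorn's lemma applies because graded pieces have finite dimension: if the union of a chain of ideals
  contains \<open>R\<^sub>m\<close>, so does a member of the chain.\<close>

lemma maximal_relevant_ideal:
  fixes A :: "('n::finite, 'k::field_char_0) mpoly set"
  assumes A: "homogeneous_ideal A" and rel: "\<And>m. \<not> graded_piece m \<subseteq> A"
  obtains B where "homogeneous_ideal B" "A \<subseteq> B" "\<And>m. \<not> graded_piece m \<subseteq> B"
    "\<And>C. homogeneous_ideal C \<Longrightarrow> B \<subset> C \<Longrightarrow> \<exists>m. graded_piece m \<subseteq> C"
proof -
  let ?S = "{B. homogeneous_ideal B \<and> A \<subseteq> B \<and> (\<forall>m. \<not> graded_piece m \<subseteq> B)}"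
  have "\<exists>M\<in>?S. \<forall>X\<in>?S. M \<subseteq> X \<longrightarrow> X = M"
  proof (rule subset_Zorn_nonempty)
    show "?S \<noteq> {}" using A rel by blast
    fix \<C> assume ne: "\<C> \<noteq> {}" and chain: "subset.chain ?S \<C>"
    then have mem: "C \<in> ?S" if "C \<in> \<C>" for C using that by (auto simp: subset_chain_def)
    have tot: "C \<subseteq> C' \<or> C' \<subseteq> C" if "C \<in> \<C>" "C' \<in> \<C>" for C C'
      using chain that by (auto simp: subset_chain_def)
    have sub: "is_ideal C" if "C \<in> \<C>" for C
      using mem[OF that] by (simp add: homogeneous_ideal_def)
    have "is_ideal (\<Union>\<C>)"
    proof (rule mpoly_ideal.subspaceI)
      show "0 \<in> \<Union>\<C>" using ne sub mpoly_ideal.subspace_0 by blast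
      show "p + q \<in> \<Union>\<C>" if pq: "p \<in> \<Union>\<C>" "q \<in> \<Union>\<C>" for p q
      proof -
        obtain C C' where C: "C \<in> \<C>" "p \<in> C" "C' \<in> \<C>" "q \<in> C'" using pq by blast
        then show ?thesis
          using tot[of C C'] mpoly_ideal.subspace_add[OF sub, of C p q] mpoly_ideal.subspace_add[OF sub, of C' p q]
          by blast
      qed
      show "r * p \<in> \<Union>\<C>" if "p \<in> \<Union>\<C>" for r p
        using that mpoly_ideal.subspace_scale[OF sub] by blast
    qed
    moreover have "hom_component d p \<in> \<Union>\<C>" if "p \<in> \<Union>\<C>" for p d
      using that mem by (fastforce simp: homogeneous_ideal_def)
    moreover have "A \<subseteq> \<Union>\<C>" using ne mem by blast
    moreover have False if "graded_piece m \<subseteq> \<Union>\<C>" for m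
    proof -
      let ?M = "(\<lambda>m. single m 1) ` {k. total_degree k = m} :: ('n, 'k) mpoly set"
      have "finite ?M" using finite_total_degree by blast
      moreover have "?M \<subseteq> \<Union>\<C>" using that by (intro image_subsetI subsetD[OF that]) simp
      ultimately obtain C where C: "C \<in> \<C>" "?M \<subseteq> C"
        using finite_subset_Union_chain[OF _ _ ne chain] by metis
      have "mpoly.subspace C"
        using sub[OF C(1)] by (auto simp: mpoly.subspace_def mpoly_ideal.subspace_def)
      then have "graded_piece m \<subseteq> C"
        unfolding graded_piece_span using C(2) by (rule mpoly.span_minimal[rotated])
      then show False using mem[OF C(1)] by blast
    qed
    ultimately show "\<Union>\<C> \<in> ?S" by (auto simp: homogeneous_ideal_def)
  qed
  then obtain B where B: "B \<in> ?S" and max: "\<forall>X\<in>?S. B \<subseteq> X \<longrightarrow> X = B" by (rule bexE)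
  show ?thesis
  proof (rule that[of B])
    fix C assume C: "homogeneous_ideal C" "B \<subset> C"
    show "\<exists>m. graded_piece m \<subseteq> C"
    proof (rule ccontr)
      assume "\<nexists>m. graded_piece m \<subseteq> C"
      with C B have "C \<in> ?S" by auto
      with max have "B \<subseteq> C \<longrightarrow> C = B" by (rule bspec)
      with C show False by auto
    qed
  qed (use B in auto)
qed

text \<open>A maximal ideal \<open>B\<close> among the homogeneous ideals without a full graded piece is prime. The dimensions of the
  graded pieces of \<open>R/B\<close> are bounded, so two linear forms satisfy a binary equation modulo \<open>B\<close>,
  and one of its linear factors lies in \<open>B\<close>. Hence \<open>B\<close> is the ideal of a point. The elements of \<open>A\<close> need
  not be homogeneous; therefore the nonzero value in the hypothesis may be taken anywhere on the line
  through \<open>c\<close>.\<close>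

theorem projective_Nullstellensatz:
  fixes A :: "('n::finite, 'k::{alg_closed_field, field_char_0}) mpoly set"
  assumes A: "homogeneous_ideal A" and no_zero: "\<And>c. c \<noteq> 0 \<Longrightarrow> \<exists>p\<in>A. \<exists>t. eval_at (t *s c) p \<noteq> 0"
  shows "\<exists>m. graded_piece m \<subseteq> A"
proof (rule ccontr)
  assume "\<not> ?thesis"
  then have "\<And>m. \<not> graded_piece m \<subseteq> A" by blast
  from maximal_relevant_ideal[OF A this] obtain B where B: "homogeneous_ideal B" "A \<subseteq> B"
    and rel: "\<And>m. \<not> graded_piece m \<subseteq> B"
    and max: "\<And>C. homogeneous_ideal C \<Longrightarrow> B \<subset> C \<Longrightarrow> \<exists>m. graded_piece m \<subseteq> C" by metis
  have sub: "is_ideal B" using B by (simp add: homogeneous_ideal_def)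
  note B_add = mpoly_ideal.subspace_add[OF sub] and B_scale = mpoly_ideal.subspace_scale[OF sub]
  have insert: "\<exists>m. \<forall>p\<in>graded_piece m. \<exists>c. p - c * h \<in> B" if "h \<in> graded_piece b" "h \<notin> B" for h b
  proof -
    have "B \<subset> {p. \<exists>c. p - c * h \<in> B}"
    proof
      show "B \<subseteq> {p. \<exists>c. p - c * h \<in> B}" by (auto intro: exI[of _ 0])
      have "h - 1 * h \<in> B" using mpoly_ideal.subspace_0[OF sub] by simp
      then show "B \<noteq> {p. \<exists>c. p - c * h \<in> B}" using \<open>h \<notin> B\<close> by blast
    qed
    then show ?thesis using max[OF homogeneous_ideal_insert[OF B(1) that(1)]] by blast
  qed
  have prime: "g \<in> B \<or> h \<in> B" if g: "g \<in> graded_piece a" and h: "h \<in> graded_piece b" and gh: "g * h \<in> B" for g h a b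
  proof (rule ccontr)
    assume "\<not> (g \<in> B \<or> h \<in> B)"
    then obtain m m' where m: "\<forall>p\<in>graded_piece m. \<exists>c. p - c * g \<in> B"
      and m': "\<forall>q\<in>graded_piece m'. \<exists>c. q - c * h \<in> B"
      using insert g h by meson
    have "p * q \<in> B" if pq: "p \<in> graded_piece m" "q \<in> graded_piece m'" for p q
    proof -
      obtain c c' where c: "p - c * g \<in> B" "q - c' * h \<in> B" using m m' pq by blast
      have "q * (p - c * g) + (c * g) * (q - c' * h) + (c * c') * (g * h) \<in> B"
        by (rule B_add[OF B_add[OF B_scale[OF c(1)] B_scale[OF c(2)]] B_scale[OF gh]])
      then show ?thesis by (simp add: algebra_simps)
    qed
    then show False using graded_piece_mult_subset_ideal[OF sub] rel by blast
  qed
  obtain i where i: "Var i \<notin> B"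
  proof (rule ccontr)
    assume "\<not> thesis"
    then have "Var i \<in> B" for i using that by blast
    then have "(\<Sum>i\<in>UNIV. Var i * q i) \<in> B" for q
      using B_scale by (intro mpoly_ideal.subspace_sum[OF sub]) (metis mult.commute)
    then have "p \<in> B" if "p \<in> graded_piece (Suc 0)" for p
      using graded_piece_Suc_D[OF that] by metis
    then show False using rel by blast
  qed
  let ?y = "Var i :: ('n, 'k) mpoly"
  have y_pow: "?y ^ e \<notin> B" for e
  proof (induction e)
    case 0
    have "p \<in> B" if "1 \<in> B" for p using B_scale[OF that, of p] by simp
    then show ?case using rel by auto
  next
    case (Suc e)
    then show ?case using prime[of ?y 1 "?y ^ e" e] i graded_piece_power[of ?y 1 e] by auto
  qed
  \<comment> \<open>Modulo \<open>B\<close>, multiplication by powers of \<open>y\<close> is onto in large degrees; so the dimensions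
    of the graded pieces of \<open>R/B\<close> stay bounded.\<close>
  obtain m where "\<forall>p\<in>graded_piece m. \<exists>c. p - c * ?y \<in> B"
    using insert[OF graded_piece_Var(1) i] by blast
  then have m: "graded_piece m \<subseteq> {p. \<exists>c. p - c * ?y \<in> B}" by blast
  have reduce: "\<exists>q\<in>graded_piece m. p - ?y ^ D * q \<in> B" if "p \<in> graded_piece (D + m)" for p D
    using that
  proof (induction D arbitrary: p)
    case 0
    then show ?case using mpoly_ideal.subspace_0[OF sub] by (intro bexI[of _ p]) auto
  next
    case (Suc D)
    have "homogeneous_ideal {p. \<exists>c. p - c * ?y \<in> B}"
      by (rule homogeneous_ideal_insert[OF B(1) graded_piece_Var(1)])
    then have "is_ideal {p. \<exists>c. p - c * ?y \<in> B}"
      unfolding homogeneous_ideal_def by (rule conjunct1)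
    then have "graded_piece (Suc D + m) \<subseteq> {p. \<exists>c. p - c * ?y \<in> B}"
      using m by (rule graded_piece_subset_ideal_mono) simp
    then obtain c where "p - c * ?y \<in> B" using Suc.prems by blast
    then have "hom_component (Suc D + m) (p - c * ?y) \<in> B" using B(1) by (simp add: homogeneous_ideal_def)
    moreover have "p = hom_component (Suc D + m) (p - c * ?y) + hom_component (D + m) c * ?y"
      using hom_component_add[of "Suc D + m" "p - c * ?y" "c * ?y"] hom_component_of_graded[OF Suc.prems]
        hom_component_mult_graded[OF graded_piece_Var(1), of "Suc D + m" c i] by simp
    ultimately have 1: "p - hom_component (D + m) c * ?y \<in> B" by (metis add_diff_cancel_right')
    obtain q where q: "q \<in> graded_piece m" "hom_component (D + m) c - ?y ^ D * q \<in> B"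
      using Suc.IH[OF hom_component_graded_piece] by blast
    have "(p - hom_component (D + m) c * ?y) + ?y * (hom_component (D + m) c - ?y ^ D * q) \<in> B"
      by (rule B_add[OF 1 B_scale[OF q(2)]])
    then have "p - ?y ^ Suc D * q \<in> B" by (simp add: algebra_simps)
    then show ?case using q(1) by blast
  qed
  have "\<exists>c. Var j - Const c * ?y \<in> B" for j
  proof -
    \<comment> \<open>All \<open>?D + 1\<close> products below reduce to \<open>y\<^sup>D\<close> times elements of the span of \<open>?D\<close> monomials,
      so they are linearly dependent modulo \<open>B\<close>.\<close>
    let ?M = "(\<lambda>m. single m 1) ` {k. total_degree k = m} :: ('n, 'k) mpoly set"
    let ?D = "card ?M" let ?E = "?D + m"
    have fin: "finite ?M" using finite_total_degree by blast
    have gr: "Var j ^ a * ?y ^ (?E - a) \<in> graded_piece (?D + m)" if "a \<le> ?D" for a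
      using graded_piece_mult[OF graded_piece_power[OF graded_piece_Var(1)[of j], of a] graded_piece_power[OF graded_piece_Var(1)[of i], of "?E - a"]] that
      by simp
    then have "\<exists>q. q \<in> graded_piece m \<and> Var j ^ a * ?y ^ (?E - a) - ?y ^ ?D * q \<in> B" if "a \<le> ?D" for a
      using reduce that by blast
    then obtain q where q: "\<And>a. a \<le> ?D \<Longrightarrow> q a \<in> graded_piece m"
      and qB: "\<And>a. a \<le> ?D \<Longrightarrow> Var j ^ a * ?y ^ (?E - a) - ?y ^ ?D * q a \<in> B" by metis
    have "q a \<in> mpoly.span ?M" if "a \<le> ?D" for a
      using q[OF that] by (simp only: graded_piece_span)
    then obtain \<alpha> where \<alpha>: "\<exists>a\<le>?D. \<alpha> a \<noteq> 0" "(\<Sum>a\<le>?D. Const (\<alpha> a) * q a) = 0"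
      by (rule mpoly.nontrivial_relation[OF fin order_refl])
    let ?P = "\<Sum>a\<le>?D. monom (\<alpha> a) a"
    have cP: "coeff ?P a = (if a \<le> ?D then \<alpha> a else 0)" for a
      by (simp add: coeff_sum)
    obtain a where "a \<le> ?D" "\<alpha> a \<noteq> 0" using \<alpha>(1) by blast
    then have "coeff ?P a \<noteq> 0" unfolding cP by simp
    then have P: "?P \<noteq> 0" by (rule contrapos_nn) (simp only: coeff_0)
    have deg_P: "degree ?P \<le> ?E" by (rule degree_le) (simp add: cP)
    have P_mem: "(\<Sum>a\<le>?E. Const (coeff ?P a) * Var j ^ a * ?y ^ (?E - a)) \<in> B"
    proof -
      have "(\<Sum>a\<le>?E. Const (coeff ?P a) * Var j ^ a * ?y ^ (?E - a)) =
          (\<Sum>a\<le>?D. Const (\<alpha> a) * Var j ^ a * ?y ^ (?E - a))"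
        by (rule sum.mono_neutral_cong_right) (auto simp: cP)
      also have "\<dots> = (\<Sum>a\<le>?D. Const (\<alpha> a) * (Var j ^ a * ?y ^ (?E - a) - ?y ^ ?D * q a)) +
          ?y ^ ?D * (\<Sum>a\<le>?D. Const (\<alpha> a) * q a)"
        by (simp add: sum_distrib_left sum_subtractf algebra_simps)
      also have "\<dots> \<in> B"
        unfolding \<alpha>(2) mult_zero_right add_0_right
        by (rule mpoly_ideal.subspace_sum[OF sub]) (use qB in \<open>auto intro: B_scale\<close>)
      finally show ?thesis .
    qed
    show ?thesis
      by (rule binary_form_linear_factor[OF _ sub graded_piece_Var(1) graded_piece_Var(1) y_pow P deg_P P_mem])
        (rule prime)
  qed
  then obtain c where c: "\<And>j. Var j - Const (c j) * ?y \<in> B" by metis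
  define v where "v = (\<chi> j. c j)"
  have lin: "Var j - Const (v $ j) * ?y \<in> B" for j using c by (simp add: v_def)
  have scale_y: "a = 0" if "Const a * ?y ^ e \<in> B" for a e
  proof (rule ccontr)
    assume "a \<noteq> 0"
    have "Const (inverse a) * (Const a * ?y ^ e) \<in> B" using that by (rule B_scale)
    then show False using y_pow[of e] \<open>a \<noteq> 0\<close> by (simp add: mult.assoc [symmetric] flip: Const_mult)
  qed
  have "Const (1 - v $ i) * ?y ^ 1 \<in> B" using lin[of i] by (simp add: Const_diff algebra_simps)
  from scale_y[OF this] have "v $ i = 1" by simp
  then have "v \<noteq> 0" by auto
  then obtain p t where p: "p \<in> A" "eval_at (t *s v) p \<noteq> 0" using no_zero by blast
  obtain D where D: "\<And>m. m \<in> keys p \<Longrightarrow> total_degree m < D"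
    by (rule degree_bound[of p]) blast
  have "eval_at (t *s v) (hom_component d p) = 0" for d
  proof -
    let ?q = "hom_component d p"
    have "?q \<in> B" using p A B by (auto simp: homogeneous_ideal_def)
    moreover have "?q - Const (eval_at v ?q) * ?y ^ d \<in> B"
      by (rule congruent_evaluation[OF sub lin]) simp
    ultimately have "Const (eval_at v ?q) * ?y ^ d \<in> B"
      using mpoly_ideal.subspace_diff[OF sub, of ?q "?q - Const (eval_at v ?q) * ?y ^ d"] by simp
    then have "eval_at v ?q = 0" by (rule scale_y)
    then show ?thesis by (simp add: eval_at_scale[where d = d])
  qed
  then have "eval_at (t *s v) (\<Sum>d<D. hom_component d p) = 0" by (simp add: eval_at_sum)
  then show False using p(2) sum_hom_components[of p D] D by simp
qed

section \<open>The Koszul complex\<close>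

definition koszul_sign :: "nat \<Rightarrow> nat set \<Rightarrow> 'a::comm_ring_1" where
  "koszul_sign i S = (-1) ^ card {j \<in> S. j < i}"

text \<open>A chain assigns to a finite set \<open>S\<close> the coefficient of the exterior monomial
  \<open>\<And>\<^sub>s\<^sub>\<in>\<^sub>S e\<^sub>s\<close> (factors in increasing order).\<close>

definition koszul_d :: "nat \<Rightarrow> (nat \<Rightarrow> 'a::comm_ring_1) \<Rightarrow> (nat set \<Rightarrow> 'a) \<Rightarrow> nat set \<Rightarrow> 'a" where
  "koszul_d r g u S = (\<Sum>i\<in>{..<r} - S. koszul_sign i S * g i * u (insert i S))"

definition koszul_wedge :: "nat \<Rightarrow> (nat set \<Rightarrow> 'a::comm_ring_1) \<Rightarrow> nat set \<Rightarrow> 'a" where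
  "koszul_wedge s u S = (if s \<in> S then koszul_sign s (S - {s}) * u (S - {s}) else 0)"

lemma koszul_sign_sq [simp]: "koszul_sign i S * koszul_sign i S = 1"
  by (simp add: koszul_sign_def flip: power_add mult_2)

lemma koszul_sign_insert:
  assumes "i \<notin> S"
  shows "koszul_sign j (insert i S) = (if i < j then - koszul_sign j S else koszul_sign j S)"
proof -
  have "{k \<in> insert i S. k < j} = (if i < j then insert i {k \<in> S. k < j} else {k \<in> S. k < j})"
    by auto
  then show ?thesis using assms by (simp add: koszul_sign_def)
qed

lemma koszul_sign_swap:
  assumes "i \<noteq> j" "i \<notin> S" "j \<notin> S"
  shows "koszul_sign i S * koszul_sign j (insert i S) = - (koszul_sign j S * koszul_sign i (insert j S))"
  using assms by (auto simp: koszul_sign_insert)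

lemma koszul_d_d: "koszul_d r g (koszul_d r g u) S = (0 :: 'a::comm_ring_1)"
proof -
  let ?A = "{..<r} - S"
  define F where "F i j = koszul_sign i S * koszul_sign j (insert i S) * (g i * g j * u (insert j (insert i S)))" for i j
  have swap: "F i j = - F j i" if "i \<in> ?A" "j \<in> ?A" "i \<noteq> j" for i j
  proof -
    have "F i j = koszul_sign i S * koszul_sign j (insert i S) * (g j * g i * u (insert i (insert j S)))"
      by (simp add: F_def insert_commute mult.commute[of "g i"])
    also have "koszul_sign i S * koszul_sign j (insert i S) = - (koszul_sign j S * koszul_sign i (insert j S) :: 'a)"
      using that by (intro koszul_sign_swap) auto
    finally show ?thesis by (simp add: F_def)
  qed
  have "koszul_d r g (koszul_d r g u) S = (\<Sum>i\<in>?A. \<Sum>j\<in>?A - {i}. F i j)"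
    unfolding koszul_d_def sum_distrib_left
    by (intro sum.cong refl) (auto simp: F_def algebra_simps)
  also have "\<dots> = (\<Sum>i\<in>?A. \<Sum>j\<in>?A. (if j < i then F i j else 0) + (if i < j then F i j else 0))"
    by (intro sum.cong refl sum.mono_neutral_cong_left) auto
  also have "\<dots> = (\<Sum>i\<in>?A. \<Sum>j\<in>?A. if j < i then F i j else 0) + (\<Sum>i\<in>?A. \<Sum>j\<in>?A. if j < i then F j i else 0)"
    unfolding sum.distrib by (subst (2) sum.swap) simp
  also have "\<dots> = (\<Sum>i\<in>?A. \<Sum>j\<in>?A. if j < i then F i j + F j i else 0)"
    unfolding sum.distrib [symmetric] by (intro sum.cong refl) simp
  also have "\<dots> = 0"
  proof (intro sum.neutral ballI)
    fix i j assume "i \<in> ?A" "j \<in> ?A"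
    then show "(if j < i then F i j + F j i else 0) = 0" using swap[of i j] by simp
  qed
  finally show ?thesis .
qed

text \<open>Wedging with \<open>e\<^sub>s\<close> is a homotopy from \<open>0\<close> to the multiplication by \<open>g\<^sub>s\<close>. Therefore the ideal of
  the \<open>g\<^sub>s\<close> annihilates the homology.\<close>

lemma koszul_d_wedge:
  fixes g :: "nat \<Rightarrow> 'a::comm_ring_1"
  assumes "s < r"
  shows "koszul_d r g (koszul_wedge s u) S = g s * u S - koszul_wedge s (koszul_d r g u) S"
proof (cases "s \<in> S")
  case True
  define S' where "S' = S - {s}"
  have S: "S = insert s S'" "s \<notin> S'" using True by (auto simp: S'_def)
  have A: "{..<r} - S' = insert s ({..<r} - S)" using S assms by auto
  have "koszul_wedge s (koszul_d r g u) S =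
      koszul_sign s S' * (\<Sum>i\<in>insert s ({..<r} - S). koszul_sign i S' * g i * u (insert i S'))"
    using True by (simp add: koszul_wedge_def koszul_d_def A flip: S'_def)
  also have "\<dots> = koszul_sign s S' * (koszul_sign s S' * g s * u S +
      (\<Sum>i\<in>{..<r} - S. koszul_sign i S' * g i * u (insert i S')))"
    using True by (subst sum.insert) (auto simp: S(1))
  also have "\<dots> = g s * u S + (\<Sum>i\<in>{..<r} - S. koszul_sign s S' * koszul_sign i S' * g i * u (insert i S'))"
    by (simp add: distrib_left sum_distrib_left mult.assoc [symmetric])
  finally have 1: "koszul_wedge s (koszul_d r g u) S =
      g s * u S + (\<Sum>i\<in>{..<r} - S. koszul_sign s S' * koszul_sign i S' * g i * u (insert i S'))" .
  have "koszul_d r g (koszul_wedge s u) S =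
      (\<Sum>i\<in>{..<r} - S. - (koszul_sign s S' * koszul_sign i S' * g i * u (insert i S')))"
    unfolding koszul_d_def
  proof (intro sum.cong refl)
    fix i assume i: "i \<in> {..<r} - S"
    have "insert i S - {s} = insert i S'" using S i True by auto
    moreover have "koszul_sign i S * koszul_sign s (insert i S') = - (koszul_sign s S' * koszul_sign i S' :: 'a)"
    proof -
      have "i \<notin> S'" "i \<noteq> s" using i S by auto
      then show ?thesis
        unfolding S(1) koszul_sign_insert[OF S(2)] koszul_sign_insert[OF \<open>i \<notin> S'\<close>]
        by (cases "i < s") (auto simp: mult.commute)
    qed
    ultimately have "koszul_wedge s u (insert i S) = koszul_sign s (insert i S') * u (insert i S')"
      and sign: "koszul_sign i S * koszul_sign s (insert i S') = - (koszul_sign s S' * koszul_sign i S' :: 'a)"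
      using True by (simp_all add: koszul_wedge_def)
    then have "koszul_sign i S * g i * koszul_wedge s u (insert i S) =
        (koszul_sign i S * koszul_sign s (insert i S')) * (g i * u (insert i S'))"
      by (simp only: ac_simps)
    then show "koszul_sign i S * g i * koszul_wedge s u (insert i S) =
        - (koszul_sign s S' * koszul_sign i S' * g i * u (insert i S'))"
      by (simp only: sign mult_minus_left mult.assoc)
  qed
  then show ?thesis by (simp add: 1 sum_negf)
next
  case False
  have "koszul_d r g (koszul_wedge s u) S =
      (\<Sum>i\<in>{..<r} - S. if i = s then koszul_sign s S * g s * (koszul_sign s S * u S) else 0)"
    unfolding koszul_d_def using False by (intro sum.cong refl) (auto simp: koszul_wedge_def)
  also have "\<dots> = koszul_sign s S * g s * (koszul_sign s S * u S)"
    using False assms by (subst sum.delta) auto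
  also have "\<dots> = (koszul_sign s S * koszul_sign s S) * (g s * u S)"
    by (simp only: ac_simps)
  finally show ?thesis using False by (simp add: koszul_wedge_def)
qed

lemma koszul_d_diff: "koszul_d r g (\<lambda>S. u S - v S) S = koszul_d r g u S - koszul_d r g v S"
  by (simp add: koszul_d_def right_diff_distrib sum_subtractf)

lemma koszul_d_add: "koszul_d r g (\<lambda>S. u S + v S) S = koszul_d r g u S + koszul_d r g v S"
  by (simp add: koszul_d_def distrib_left sum.distrib)

lemma koszul_d_scale: "koszul_d r g (\<lambda>S. c * u S) S = c * koszul_d r g u S"
  by (simp add: koszul_d_def sum_distrib_left algebra_simps)

lemma koszul_d_sum: "koszul_d r g (\<lambda>S. \<Sum>s\<in>I. u s S) S = (\<Sum>s\<in>I. koszul_d r g (u s) S)"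
  by (simp add: koszul_d_def sum_distrib_left sum.swap[of _ I])

subsection \<open>Graded chains\<close>

text \<open>The exterior monomial of \<open>S\<close> has degree \<open>sum \<delta> S\<close>, where \<open>\<delta> s\<close> is the degree of \<open>g s\<close>; the condition on
  the internal degree \<open>m\<close> is additive, so that coefficients of negative degree are zero.\<close>

definition koszul_chains ::
  "nat \<Rightarrow> (nat \<Rightarrow> nat) \<Rightarrow> nat \<Rightarrow> nat \<Rightarrow> (nat set \<Rightarrow> ('n::finite, 'k::comm_ring_1) mpoly) set" where
  "koszul_chains r \<delta> i m =
     {u. \<forall>S. (u S \<noteq> 0 \<longrightarrow> S \<subseteq> {..<r} \<and> card S = i) \<and>
         (\<forall>k\<in>keys (u S). total_degree k + sum \<delta> S = m)}"

lemma koszul_chains_0 [simp]: "(\<lambda>S. 0) \<in> koszul_chains r \<delta> i m"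
  by (simp add: koszul_chains_def)

lemma koszul_chains_large: "u \<in> koszul_chains r \<delta> i m \<Longrightarrow> r < i \<Longrightarrow> u S = 0"
  unfolding koszul_chains_def using card_mono[of "{..<r}" S] by fastforce

lemma koszul_chains_degree:
  "u \<in> koszul_chains r \<delta> i m \<Longrightarrow> k \<in> keys (u S) \<Longrightarrow> total_degree k + sum \<delta> S = m"
  by (simp add: koszul_chains_def)

lemma keys_sign_mult: "keys (koszul_sign i S * p) = keys p"
  for p :: "('n, 'k::comm_ring_1) mpoly"
proof -
  have "koszul_sign i S * p = p \<or> koszul_sign i S * p = - p"
    by (cases "even (card {j \<in> S. j < i})") (simp_all add: koszul_sign_def)
  then show ?thesis by (auto simp: in_keys_iff)
qed

lemma koszul_d_chains:
  fixes g :: "nat \<Rightarrow> ('n::finite, 'k::comm_ring_1) mpoly"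
  assumes g: "\<And>s. s < r \<Longrightarrow> g s \<in> graded_piece (\<delta> s)" and u: "u \<in> koszul_chains r \<delta> (Suc i) m"
  shows "koszul_d r g u \<in> koszul_chains r \<delta> i m"
  unfolding koszul_chains_def
proof (intro CollectI allI conjI impI ballI)
  have supp: "insert s S \<subseteq> {..<r}" "card (insert s S) = Suc i" if "u (insert s S) \<noteq> 0" for s S
    using u that by (auto simp: koszul_chains_def)
  show "S \<subseteq> {..<r}" "card S = i" if nz: "koszul_d r g u S \<noteq> 0" for S
  proof -
    obtain s where "s \<notin> S" "u (insert s S) \<noteq> 0"
      using nz unfolding koszul_d_def by (metis (no_types, lifting) DiffD2 mult_zero_right sum.neutral)
    then show "S \<subseteq> {..<r}" "card S = i"
      using supp[of s S] finite_subset[of S "{..<r}"] by auto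
  qed
  fix S k assume "k \<in> keys (koszul_d r g u S)"
  then obtain s where s: "s < r" "s \<notin> S" "k \<in> keys (koszul_sign s S * (g s * u (insert s S)))"
    unfolding koszul_d_def using keys_sum[of "\<lambda>i. koszul_sign i S * g i * u (insert i S)" "{..<r} - S"]
    by (auto simp: mult.assoc)
  then have k: "k \<in> keys (g s * u (insert s S))" by (simp add: keys_sign_mult)
  then obtain a b where ab: "k = a + b" "a \<in> keys (g s)" "b \<in> keys (u (insert s S))"
    using keys_mult by blast
  have "total_degree a = \<delta> s" using g[OF s(1)] ab(2) by (simp add: graded_piece_def)
  moreover have "total_degree b + sum \<delta> (insert s S) = m" using u ab(3) by (simp add: koszul_chains_def)
  moreover have "u (insert s S) \<noteq> 0" using ab(3) by auto
  from supp(1)[OF this] have "finite S" by (meson finite_insert finite_lessThan finite_subset)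
  ultimately show "total_degree k + sum \<delta> S = m" using s ab by simp
qed

subsection \<open>Ideals generated by powers of variables\<close>

definition var_power_ideal :: "nat \<Rightarrow> 'n set \<Rightarrow> ('n, 'k::zero) mpoly set" where
  "var_power_ideal L A = {p. \<forall>k\<in>keys p. \<exists>a\<in>A. L \<le> lookup k a}"

lemma var_power_ideal_empty: "p \<in> var_power_ideal L {} \<longleftrightarrow> p = 0"
  by (auto simp: var_power_ideal_def)

lemma var_power_ideal_add:
  "p \<in> var_power_ideal L A \<Longrightarrow> q \<in> var_power_ideal L A \<Longrightarrow> p + q \<in> var_power_ideal L A"
  using keys_add[of p q] by (auto simp: var_power_ideal_def)

lemma var_power_ideal_mult:
  fixes p q :: "('n, 'k::comm_ring_1) mpoly"
  assumes "p \<in> var_power_ideal L A"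
  shows "q * p \<in> var_power_ideal L A"
  unfolding var_power_ideal_def
proof (intro CollectI ballI)
  fix k assume "k \<in> keys (q * p)"
  then obtain a b where k: "k = a + b" "b \<in> keys p" using keys_mult by blast
  then obtain c where "c \<in> A" "L \<le> lookup b c" using assms by (auto simp: var_power_ideal_def)
  then show "\<exists>a\<in>A. L \<le> lookup k a" using k(1) by (intro bexI[of _ c]) (auto simp: lookup_add)
qed

lemma subspace_var_power_ideal:
  "is_ideal (var_power_ideal L A :: ('n, 'k::comm_ring_1) mpoly set)"
proof (rule mpoly_ideal.subspaceI)
  show "0 \<in> var_power_ideal L A" by (simp add: var_power_ideal_def)
qed (rule var_power_ideal_add var_power_ideal_mult; assumption)+

lemma var_power_ideal_mono: "A \<subseteq> B \<Longrightarrow> var_power_ideal L A \<subseteq> var_power_ideal L B"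
  unfolding var_power_ideal_def by blast

lemma lookup_single_mult:
  fixes z :: "('n, 'k::comm_semiring_1) mpoly"
  shows "lookup (single m c * z) (m + k) = c * lookup z k"
proof -
  have "single m c * z = (\<Sum>j\<in>keys z. single (m + j) (c * lookup z j))"
    by (subst (1) mpoly_eq_sum_monomials[of z]) (simp only: sum_distrib_left mult_single)
  then have "lookup (single m c * z) (m + k) =
      (\<Sum>j\<in>keys z. if j = k then c * lookup z j else 0)"
    by (simp add: lookup_sum lookup_single when_def)
  then show ?thesis by (auto simp: in_keys_iff)
qed

lemma lookup_Var_power_mult:
  fixes z :: "('n, 'k::comm_semiring_1) mpoly"
  shows "lookup (Var a ^ L * z) k =
    (if L \<le> lookup k a then lookup z (k - single a L) else 0)"
proof (cases "L \<le> lookup k a")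
  case True
  then have "k = single a L + (k - single a L)"
    by (intro poly_mapping_eqI) (auto simp: lookup_add lookup_minus lookup_single when_def)
  then show ?thesis using True lookup_single_mult[of "single a L" 1 z "k - single a L"]
    by (simp add: Var_power)
next
  case False
  have "k \<notin> keys (Var a ^ L * z)"
    using keys_mult[of "Var a ^ L" z] False by (auto simp: Var_power lookup_add)
  then show ?thesis using False by (simp add: in_keys_iff)
qed

lemma var_power_ideal_cancel:
  fixes p :: "('n, 'k::comm_ring_1) mpoly"
  assumes "Var a ^ L * p \<in> var_power_ideal L' A" "a \<notin> A"
  shows "p \<in> var_power_ideal L' A"
  unfolding var_power_ideal_def
proof (intro CollectI ballI)
  fix k assume "k \<in> keys p"
  then have "single a L + k \<in> keys (Var a ^ L * p)"
    by (simp add: in_keys_iff Var_power lookup_single_mult)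
  then obtain b where "b \<in> A" "L' \<le> lookup (single a L + k) b"
    using assms(1) by (auto simp: var_power_ideal_def)
  then show "\<exists>b\<in>A. L' \<le> lookup k b"
    using assms(2) by (intro bexI[of _ b]) (auto simp: lookup_add lookup_single when_def split: if_splits)
qed

text \<open>This is the quotient in the division by \<open>x\<^sub>a\<^sup>L\<close>: the monomials with a smaller exponent are dropped.\<close>

definition divide_var_power :: "'n \<Rightarrow> nat \<Rightarrow> ('n, 'k::zero) mpoly \<Rightarrow> ('n, 'k) mpoly" where
  "divide_var_power a L = Poly_Mapping.map_key (\<lambda>k. k + single a L)"

lemma lookup_divide_var_power:
  fixes p :: "('n, 'k::zero) mpoly"
  shows "lookup (divide_var_power a L p) k = lookup p (k + single a L)"
proof -
  have "inj (\<lambda>k :: 'n \<Rightarrow>\<^sub>0 nat. k + single a L)" by (rule injI) simp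
  then show ?thesis by (simp add: divide_var_power_def Poly_Mapping.map_key.rep_eq)
qed

lemma divide_var_power_0 [simp]: "divide_var_power a L 0 = 0"
  by (rule poly_mapping_eqI) (simp add: lookup_divide_var_power)

lemma var_power_ideal_insert:
  fixes p :: "('n, 'k::comm_ring_1) mpoly"
  assumes "p \<in> var_power_ideal L (insert a A)"
  shows "p - Var a ^ L * divide_var_power a L p \<in> var_power_ideal L A"
  unfolding var_power_ideal_def
proof (intro CollectI ballI)
  fix k assume k: "k \<in> keys (p - Var a ^ L * divide_var_power a L p)"
  have "k - single a L + single a L = k" if "L \<le> lookup k a"
    using that by (intro poly_mapping_eqI) (auto simp: lookup_add lookup_minus lookup_single when_def)
  then have "lookup (p - Var a ^ L * divide_var_power a L p) k =
      (if L \<le> lookup k a then 0 else lookup p k)"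
    by (simp add: lookup_minus lookup_Var_power_mult lookup_divide_var_power)
  then have "\<not> L \<le> lookup k a" "k \<in> keys p"
    using k by (auto simp: in_keys_iff split: if_splits)
  then show "\<exists>b\<in>A. L \<le> lookup k b"
    using assms by (auto simp: var_power_ideal_def)
qed

subsection \<open>Exactness\<close>

text \<open>Exactness in homological degree \<open>i\<close> and internal degree \<open>m\<close> of the Koszul complex with
  coefficients in \<open>R / (x\<^sub>a\<^sup>L | a \<in> A)\<close>.\<close>

definition koszul_exact_mod ::
  "nat \<Rightarrow> (nat \<Rightarrow> ('n::finite, 'k::comm_ring_1) mpoly) \<Rightarrow> (nat \<Rightarrow> nat) \<Rightarrow> nat \<Rightarrow> 'n set \<Rightarrow> nat \<Rightarrow> nat \<Rightarrow> bool" where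
  "koszul_exact_mod r g \<delta> L A i m \<longleftrightarrow>
    (\<forall>w\<in>koszul_chains r \<delta> i m. (\<forall>S. koszul_d r g w S \<in> var_power_ideal L A) \<longrightarrow>
      (\<exists>v\<in>koszul_chains r \<delta> (Suc i) m. \<forall>S. w S - koszul_d r g v S \<in> var_power_ideal L A))"

text \<open>Write \<open>X\<close> for \<open>x\<^sub>a\<^sup>L\<close>. As \<open>X\<close> is a nonzerodivisor modulo the other powers and annihilates the
  homology, the long exact sequence of the multiplication by \<open>X\<close> embeds the homology in degree \<open>i\<close>
  into the homology in degree \<open>i + 1\<close> modulo \<open>X\<close>. In terms of chains: \<open>X w\<close> is the boundary of some
  \<open>w'\<close>, which is a cycle modulo \<open>X\<close>, so \<open>w' = \<partial>v + X z\<close> and \<open>w = \<partial>z\<close>.\<close>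

lemma koszul_exact_mod_step:
  fixes g :: "nat \<Rightarrow> ('n::finite, 'k::comm_ring_1) mpoly"
  assumes g: "\<And>s. s < r \<Longrightarrow> g s \<in> graded_piece (\<delta> s)"
    and q: "\<And>s k. s < r \<Longrightarrow> k \<in> keys (q s) \<Longrightarrow> total_degree k + \<delta> s = L"
    and X: "Var a ^ L = (\<Sum>s<r. q s * g s)"
    and a: "a \<notin> A"
    and exact: "koszul_exact_mod r g \<delta> L (insert a A) (Suc i) (m + L)"
  shows "koszul_exact_mod r g \<delta> L A i m"
  unfolding koszul_exact_mod_def
proof (intro ballI impI)
  let ?d = "koszul_d r g" and ?Q = "var_power_ideal L A :: ('n, 'k) mpoly set"
    and ?X = "Var a ^ L :: ('n, 'k) mpoly"
  have Q_0: "0 \<in> ?Q" by (rule mpoly_ideal.subspace_0[OF subspace_var_power_ideal])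
  note Q_sum = mpoly_ideal.subspace_sum[OF subspace_var_power_ideal]
  have X_mem: "?X * p \<in> var_power_ideal L (insert a A)" for p
  proof -
    have "?X \<in> var_power_ideal L (insert a A)"
      by (auto simp: var_power_ideal_def Var_power)
    from var_power_ideal_mult[OF this, of p] show ?thesis by (simp add: mult.commute)
  qed
  have d_mem: "?d u S \<in> var_power_ideal L' B" if "\<And>S. u S \<in> var_power_ideal L' B" for u S L' B
    unfolding koszul_d_def
    by (intro mpoly_ideal.subspace_sum[OF subspace_var_power_ideal] var_power_ideal_mult that)
  fix w assume w: "w \<in> koszul_chains r \<delta> i m" and cycle: "\<forall>S. ?d w S \<in> ?Q"
  define w' where "w' S = (\<Sum>s<r. q s * koszul_wedge s w S)" for S
  have w': "w' \<in> koszul_chains r \<delta> (Suc i) (m + L)"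
    unfolding koszul_chains_def
  proof (intro CollectI allI conjI impI ballI)
    have wedge: "S \<subseteq> {..<r} \<and> card S = Suc i" if "s < r" "koszul_wedge s w S \<noteq> 0" for s S
    proof -
      have s: "s \<in> S" and "w (S - {s}) \<noteq> 0"
        using that by (auto simp: koszul_wedge_def split: if_splits)
      then have *: "S - {s} \<subseteq> {..<r}" "card (S - {s}) = i" using w by (auto simp: koszul_chains_def)
      then have "finite (S - {s})" by (meson finite_lessThan finite_subset)
      then have "finite S" by simp
      then have "card S = Suc (card (S - {s}))" using s by (metis card_Suc_Diff1)
      then show ?thesis using * that(1) by auto
    qed
    show "S \<subseteq> {..<r}" "card S = Suc i" if nz: "w' S \<noteq> 0" for S
    proof -
      obtain s where "s < r" "koszul_wedge s w S \<noteq> 0"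
        using nz unfolding w'_def by (metis (no_types, lifting) lessThan_iff mult_zero_right sum.neutral)
      from wedge[OF this] show "S \<subseteq> {..<r}" "card S = Suc i" by auto
    qed
    fix S k assume "k \<in> keys (w' S)"
    then obtain s where s: "s < r" "k \<in> keys (q s * koszul_wedge s w S)"
      unfolding w'_def using keys_sum[of "\<lambda>s. q s * koszul_wedge s w S" "{..<r}"] by auto
    then obtain k1 k2 where k: "k = k1 + k2" "k1 \<in> keys (q s)" "k2 \<in> keys (koszul_wedge s w S)"
      using keys_mult by blast
    have "s \<in> S" "k2 \<in> keys (w (S - {s}))"
      using k(3) by (auto simp: koszul_wedge_def keys_sign_mult split: if_splits)
    moreover have "koszul_wedge s w S \<noteq> 0" using k(3) by auto
    with wedge[OF s(1)] have "S \<subseteq> {..<r}" by blast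
    then have "finite S" by (meson finite_lessThan finite_subset)
    ultimately have "total_degree k2 + sum \<delta> (S - {s}) = m" "sum \<delta> S = \<delta> s + sum \<delta> (S - {s})"
      using w by (auto simp: koszul_chains_def sum.remove)
    then show "total_degree k + sum \<delta> S = m + L" using q[OF s(1) k(2)] k(1) by simp
  qed
  have "?X * w S - ?d w' S = (\<Sum>s<r. q s * koszul_wedge s (?d w) S)" for S
  proof -
    have "?d w' S = (\<Sum>s<r. q s * ?d (koszul_wedge s w) S)"
      by (simp add: w'_def [abs_def] koszul_d_sum koszul_d_scale)
    also have "\<dots> = (\<Sum>s<r. q s * (g s * w S - koszul_wedge s (?d w) S))"
      by (intro sum.cong refl) (simp add: koszul_d_wedge)
    finally show ?thesis
      by (simp add: X right_diff_distrib sum_subtractf sum_distrib_right mult.assoc)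
  qed
  moreover have "(\<Sum>s<r. q s * koszul_wedge s (?d w) S) \<in> ?Q" for S
  proof (intro Q_sum var_power_ideal_mult)
    show "koszul_wedge s (?d w) S \<in> ?Q" for s
      using cycle var_power_ideal_mult[of "?d w (S - {s})" L A] Q_0
      by (simp add: koszul_wedge_def)
  qed
  ultimately have dw': "?X * w S - ?d w' S \<in> ?Q" for S by simp
  have "?d w' S \<in> var_power_ideal L (insert a A)" for S
  proof -
    have "?X * w S - ?d w' S \<in> var_power_ideal L (insert a A)"
      using dw' var_power_ideal_mono[of A "insert a A" L] by blast
    from mpoly_ideal.subspace_diff[OF subspace_var_power_ideal X_mem[of "w S"] this] show ?thesis by simp
  qed
  with exact w' obtain v where v: "v \<in> koszul_chains r \<delta> (Suc (Suc i)) (m + L)"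
    and w'v: "\<And>S. w' S - ?d v S \<in> var_power_ideal L (insert a A)"
    unfolding koszul_exact_mod_def by blast
  define z where "z S = divide_var_power a L (w' S - ?d v S)" for S
  have dv: "?d v \<in> koszul_chains r \<delta> (Suc i) (m + L)" by (rule koszul_d_chains[OF g v])
  have z: "z \<in> koszul_chains r \<delta> (Suc i) m"
    unfolding koszul_chains_def
  proof (intro CollectI allI conjI impI ballI)
    show "S \<subseteq> {..<r}" "card S = Suc i" if "z S \<noteq> 0" for S
    proof -
      have "w' S \<noteq> 0 \<or> ?d v S \<noteq> 0" using that by (auto simp: z_def)
      then show "S \<subseteq> {..<r}" "card S = Suc i" using w' dv by (auto simp: koszul_chains_def)
    qed
    fix S k assume "k \<in> keys (z S)"
    then have "k + single a L \<in> keys (w' S) \<union> keys (?d v S)"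
      by (auto simp: z_def in_keys_iff lookup_divide_var_power lookup_minus)
    then have "total_degree (k + single a L) + sum \<delta> S = m + L"
      using koszul_chains_degree[OF w'] koszul_chains_degree[OF dv] by blast
    then show "total_degree k + sum \<delta> S = m" by simp
  qed
  have zQ: "w' S - ?d v S - ?X * z S \<in> ?Q" for S
    unfolding z_def by (rule var_power_ideal_insert[OF w'v])
  have "w S - ?d z S \<in> ?Q" for S
  proof -
    have "?d (\<lambda>S. w' S - ?d v S - ?X * z S) S \<in> ?Q" by (rule d_mem[OF zQ])
    moreover have "?d (\<lambda>S. w' S - ?d v S - ?X * z S) S = ?d w' S - ?X * ?d z S"
      by (simp add: koszul_d_diff koszul_d_scale koszul_d_d)
    ultimately have "(?X * w S - ?d w' S) + (?d w' S - ?X * ?d z S) \<in> ?Q"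
      using dw' by (intro var_power_ideal_add) auto
    then have "?X * (w S - ?d z S) \<in> ?Q" by (simp add: right_diff_distrib)
    then show ?thesis by (rule var_power_ideal_cancel[OF _ a])
  qed
  with z show "\<exists>v\<in>koszul_chains r \<delta> (Suc i) m. \<forall>S. w S - ?d v S \<in> ?Q" by blast
qed

lemma span_image_sum:
  fixes g :: "'i \<Rightarrow> ('n, 'k::comm_ring_1) mpoly"
  assumes "finite I" "p \<in> ideal (g ` I)"
  obtains q where "p = (\<Sum>i\<in>I. q i * g i)"
proof -
  have "\<exists>q. p = (\<Sum>i\<in>I. q i * g i)"
    using assms(2)
  proof (induction rule: mpoly_ideal.span_induct_alt)
    case base
    show ?case by (rule exI[of _ "\<lambda>_. 0"]) simp
  next
    case (step c x y)
    then obtain i q where i: "i \<in> I" "x = g i" "y = (\<Sum>i\<in>I. q i * g i)" by auto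
    have "c * x + y = (\<Sum>j\<in>I. (q j + (if j = i then c else 0)) * g j)"
    proof -
      have "(\<Sum>j\<in>I. (if j = i then c else 0) * g j) = (\<Sum>j\<in>I. if j = i then c * g j else 0)"
        by (intro sum.cong) auto
      then show ?thesis using i assms(1) by (simp add: distrib_right sum.distrib)
    qed
    then show ?case by (rule exI[of _ "\<lambda>j. q j + (if j = i then c else 0)"])
  qed
  then show ?thesis using that by blast
qed

lemma graded_span_image_sum:
  fixes g :: "'i \<Rightarrow> ('n::finite, 'k::comm_ring_1) mpoly"
  assumes "finite I" "\<And>i. i \<in> I \<Longrightarrow> g i \<in> graded_piece (\<delta> i)"
    and p: "p \<in> ideal (g ` I)" "p \<in> graded_piece m"
  obtains q where "p = (\<Sum>i\<in>I. q i * g i)"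
    "\<And>i k. i \<in> I \<Longrightarrow> k \<in> keys (q i) \<Longrightarrow> total_degree k + \<delta> i = m"
proof -
  obtain q where q: "p = (\<Sum>i\<in>I. q i * g i)" using span_image_sum[OF assms(1) p(1)] .
  let ?q = "\<lambda>i. if \<delta> i \<le> m then hom_component (m - \<delta> i) (q i) else 0"
  have "p = hom_component m p" using hom_component_of_graded[OF p(2)] by simp
  also have "\<dots> = (\<Sum>i\<in>I. ?q i * g i)"
    unfolding q hom_component_sum
    by (intro sum.cong refl) (simp add: hom_component_mult_graded[OF assms(2)])
  finally have "p = (\<Sum>i\<in>I. ?q i * g i)" .
  moreover have "total_degree k + \<delta> i = m" if "k \<in> keys (?q i)" for i k
    using that hom_component_graded_piece[of "m - \<delta> i" "q i"] by (auto simp: graded_piece_def split: if_splits)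
  ultimately show ?thesis by (rule that)
qed

text \<open>In the top homological degree a cycle modulo all \<open>x\<^sub>a\<^sup>L\<close> is a polynomial \<open>u\<close> that the ideal \<open>(g)\<close>
  multiplies into \<open>(x\<^sub>a\<^sup>L)\<close>. If \<open>u\<close> had a monomial \<open>x\<^sup>k\<close> with all exponents below \<open>L\<close>, the complementary
  monomial would have degree \<open>c\<close>, so lie in \<open>(g)\<close>, and move \<open>x\<^sup>k\<close> to the socle monomial, which is not in
  \<open>(x\<^sub>a\<^sup>L)\<close>.\<close>

lemma koszul_exact_mod_top:
  fixes g :: "nat \<Rightarrow> ('n::finite, 'k::comm_ring_1) mpoly"
  assumes forms: "graded_piece c \<subseteq> ideal (g ` {..<r})"
    and deg: "m + c = CARD('n) * L + sum \<delta> {..<r}"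
  shows "koszul_exact_mod r g \<delta> (Suc L) UNIV r m"
  unfolding koszul_exact_mod_def
proof (intro ballI impI bexI[of _ "\<lambda>S. 0"] allI)
  let ?Q = "var_power_ideal (Suc L) UNIV :: ('n, 'k) mpoly set"
  fix w S assume w: "w \<in> koszul_chains r \<delta> r m" and cycle: "\<forall>S. koszul_d r g w S \<in> ?Q"
  let ?u = "w {..<r}"
  have gu: "g s * ?u \<in> ?Q" if "s < r" for s
  proof -
    let ?S = "{..<r} - {s}" and ?\<epsilon> = "koszul_sign s ({..<r} - {s}) :: ('n, 'k) mpoly"
    have "{..<r} - ?S = {s}" "insert s ?S = {..<r}" using that by auto
    then have "koszul_d r g w ?S = ?\<epsilon> * g s * ?u" by (simp add: koszul_d_def)
    then have "?\<epsilon> * (?\<epsilon> * g s * ?u) \<in> ?Q" using cycle var_power_ideal_mult by metis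
    moreover have "?\<epsilon> * (?\<epsilon> * g s * ?u) = (?\<epsilon> * ?\<epsilon>) * (g s * ?u)" by (simp only: ac_simps)
    ultimately show ?thesis by simp
  qed
  have u: "?u \<in> ?Q"
    unfolding var_power_ideal_def
  proof (intro CollectI ballI, rule ccontr)
    fix k assume k: "k \<in> keys ?u" and "\<not> (\<exists>a\<in>UNIV. Suc L \<le> lookup k a)"
    then have small: "lookup k a \<le> L" for a using not_less_eq_eq by blast
    define b where "b = (\<Sum>a\<in>UNIV. single a (L - lookup k a))"
    have b: "lookup b a = L - lookup k a" for a
      by (simp add: b_def lookup_sum lookup_single when_def)
    have "total_degree b + total_degree k = CARD('n) * L"
      using small by (simp add: total_degree_def b flip: sum.distrib)
    moreover have "total_degree k + sum \<delta> {..<r} = m" using w k by (simp add: koszul_chains_def)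
    ultimately have "total_degree b = c" using deg by simp
    then have "single b 1 \<in> ideal (g ` {..<r})" using forms by auto
    then obtain q where q: "single b 1 = (\<Sum>s<r. q s * g s)"
      by (rule span_image_sum[rotated]) auto
    have "(\<Sum>s<r. q s * (g s * ?u)) \<in> ?Q"
      by (intro mpoly_ideal.subspace_sum[OF subspace_var_power_ideal] var_power_ideal_mult gu) simp
    then have "single b 1 * ?u \<in> ?Q"
      by (simp add: q sum_distrib_right mult.assoc)
    moreover have "b + k \<in> keys (single b 1 * ?u)"
      using k by (simp add: in_keys_iff lookup_single_mult)
    ultimately obtain a where "Suc L \<le> lookup (b + k) a"
      by (auto simp: var_power_ideal_def)
    then show False using small[of a] by (simp add: lookup_add b)
  qed
  have "w S \<in> ?Q"
  proof (cases "w S = 0")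
    case True
    then show ?thesis using mpoly_ideal.subspace_0[OF subspace_var_power_ideal] by simp
  next
    case False
    then have "S \<subseteq> {..<r}" "card S = card {..<r}" using w by (auto simp: koszul_chains_def)
    then have "S = {..<r}" by (metis card_subset_eq finite_lessThan)
    then show ?thesis using u by simp
  qed
  then show "w S - koszul_d r g (\<lambda>S. 0) S \<in> ?Q" by (simp add: koszul_d_def)
qed simp

text \<open>The shift through all \<open>n\<close> variables leads from homological degree \<open>i\<close> to \<open>i + n\<close>. There are
  \<open>n + 1\<close> forms, so only \<open>i = 1\<close> leads to a nonzero term, namely the top one; the degree condition makes
  this term vanish.\<close>

lemma koszul_exact:
  fixes g :: "nat \<Rightarrow> ('n::finite, 'k::field_char_0) mpoly"
  assumes g: "\<And>s. s \<le> CARD('n) \<Longrightarrow> g s \<in> graded_piece (\<delta> s)"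
    and forms: "graded_piece c \<subseteq> ideal (g ` {..CARD('n)})"
    and deg: "m + c + CARD('n) = sum \<delta> {..CARD('n)}"
    and "0 < i" and w: "w \<in> koszul_chains (Suc (CARD('n))) \<delta> i m"
    and cycle: "\<And>S. koszul_d (Suc (CARD('n))) g w S = 0"
  obtains v where "v \<in> koszul_chains (Suc (CARD('n))) \<delta> (Suc i) m" "w = koszul_d (Suc (CARD('n))) g v"
proof -
  let ?r = "Suc (CARD('n))"
  note r = lessThan_Suc_atMost[symmetric]
  have g': "g s \<in> graded_piece (\<delta> s)" if "s < ?r" for s using g that by simp
  have forms': "graded_piece c \<subseteq> ideal (g ` {..<?r})" using forms by (simp only: r)
  \<comment> \<open>The exponent \<open>L = c + 1\<close> is large enough for the powers \<open>x\<^sub>a\<^sup>L\<close> to lie in the ideal.\<close>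
  have exact_UNIV: "koszul_exact_mod ?r g \<delta> (Suc c) UNIV (i + CARD('n)) (m + CARD('n) * Suc c)"
  proof (cases "i = 1")
    case True
    have "m + CARD('n) * Suc c + c = CARD('n) * c + sum \<delta> {..<?r}" using deg by (simp add: r)
    from koszul_exact_mod_top[OF forms' this] show ?thesis using True by simp
  next
    case False
    show ?thesis unfolding koszul_exact_mod_def
    proof (intro ballI impI bexI[of _ "\<lambda>S. 0"] allI)
      fix w :: "nat set \<Rightarrow> ('n, 'k) mpoly" and S
      assume "w \<in> koszul_chains ?r \<delta> (i + CARD('n)) (m + CARD('n) * Suc c)"
      then have "w S = 0" by (rule koszul_chains_large) (use False \<open>0 < i\<close> in simp)
      then show "w S - koszul_d ?r g (\<lambda>S. 0) S \<in> var_power_ideal (Suc c) UNIV"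
        by (simp add: koszul_d_def var_power_ideal_def)
    qed simp
  qed
  have "koszul_exact_mod ?r g \<delta> (Suc c) (UNIV - B) (i + CARD('n) - card B) (m + (CARD('n) - card B) * Suc c)"
    if "finite B" for B :: "'n set"
    using that
  proof (induction B)
    case empty
    then show ?case using exact_UNIV by simp
  next
    case (insert a B)
    have "graded_piece (Suc c) \<subseteq> ideal (g ` {..<?r})"
      by (rule graded_piece_subset_ideal_mono[OF _ forms']) auto
    moreover have "(Var a ^ Suc c :: ('n, 'k) mpoly) \<in> graded_piece (Suc c)"
      using graded_piece_power[OF graded_piece_Var(1), of a "Suc c"] by (simp del: power_Suc)
    ultimately obtain q where q: "Var a ^ Suc c = (\<Sum>s<?r. q s * g s)"
      "\<And>s k. s < ?r \<Longrightarrow> k \<in> keys (q s) \<Longrightarrow> total_degree k + \<delta> s = Suc c"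
      using graded_span_image_sum[of "{..<?r}" g \<delta> "Var a ^ Suc c" "Suc c"] g' by auto
    have B: "card (insert a B) = Suc (card B)" "card (insert a B) \<le> CARD('n)"
      using insert card_mono[of "UNIV :: 'n set" "insert a B"] by auto
    have "insert a (UNIV - insert a B) = UNIV - B" using insert by auto
    moreover have "i + CARD('n) - card B = Suc (i + CARD('n) - card (insert a B))"
      "m + (CARD('n) - card B) * Suc c = m + (CARD('n) - card (insert a B)) * Suc c + Suc c"
    proof -
      obtain t where "CARD('n) = card (insert a B) + t" using B(2) le_Suc_ex by blast
      then show "i + CARD('n) - card B = Suc (i + CARD('n) - card (insert a B))"
        "m + (CARD('n) - card B) * Suc c = m + (CARD('n) - card (insert a B)) * Suc c + Suc c"
        using B(1) by auto
    qed
    ultimately have *: "koszul_exact_mod ?r g \<delta> (Suc c) (insert a (UNIV - insert a B))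
        (Suc (i + CARD('n) - card (insert a B))) (m + (CARD('n) - card (insert a B)) * Suc c + Suc c)"
      using insert.IH by (simp only:)
    show ?case
      by (rule koszul_exact_mod_step[where q = q, OF _ _ q(1) _ *]) (use g' q(2) in auto)
  qed
  from this[of UNIV] have "koszul_exact_mod ?r g \<delta> (Suc c) {} i m" by simp
  then obtain v where "v \<in> koszul_chains ?r \<delta> (Suc i) m" "\<And>S. w S - koszul_d ?r g v S = 0"
    using w cycle unfolding koszul_exact_mod_def var_power_ideal_empty by blast
  then show ?thesis by (intro that[of v]) (auto simp: fun_eq_iff)
qed

section \<open>The Hilbert function of the ideal generated by n forms of equal degree\<close>

lemma (in vector_space_pair) rank_nullity:
  assumes f: "Vector_Spaces.linear s1 s2 f" and V: "vs1.subspace V" and B: "finite B" "V \<subseteq> vs1.span B"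
  shows "vs2.dim (f ` V) + vs1.dim {x \<in> V. f x = 0} = vs1.dim V"
proof -
  interpret f: Vector_Spaces.linear s1 s2 f by (rule f)
  let ?K = "{x \<in> V. f x = 0}"
  obtain C0 where C0: "C0 \<subseteq> ?K" "vs1.independent C0" "?K \<subseteq> vs1.span C0"
    by (rule vs1.maximal_independent_subset)
  have "C0 \<subseteq> V" using C0(1) by blast
  then obtain C where C: "C0 \<subseteq> C" "C \<subseteq> V" "vs1.independent C" "V \<subseteq> vs1.span C"
    using C0(2) by (rule vs1.maximal_independent_subset_extend)
  have fin: "finite C"
    using vs1.independent_span_bound[OF B(1) C(3)] C(2) B(2) by blast
  let ?D = "C - C0"
  have span_D: "vs1.span ?D \<subseteq> V" using C(2) V by (intro vs1.span_minimal) auto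
  have inj: "inj_on f (vs1.span ?D)"
    unfolding f.inj_on_iff_eq_0[OF vs1.subspace_span]
  proof (intro ballI impI)
    fix x assume x: "x \<in> vs1.span ?D" "f x = 0"
    then have x0: "x \<in> vs1.span C0" using span_D C0(3) by blast
    have xC: "x \<in> vs1.span C" using x(1) vs1.span_mono[of ?D C] by blast
    have "vs1.representation C x b = 0" for b
    proof (rule ccontr)
      assume "vs1.representation C x b \<noteq> 0"
      then have "vs1.representation ?D x b \<noteq> 0" "vs1.representation C0 x b \<noteq> 0"
        using vs1.representation_extend[OF C(3) x(1)] vs1.representation_extend[OF C(3) x0 C(1)] by auto
      then have "b \<in> ?D" "b \<in> C0" by (blast dest: vs1.representation_ne_zero)+
      then show False by blast
    qed
    then show "x = 0" using vs1.sum_nonzero_representation_eq[OF C(3) xC] by simp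
  qed
  have "vs2.independent (f ` ?D)"
    by (rule f.independent_injective_image[OF vs1.independent_mono[OF C(3)] inj]) auto
  moreover have "f ` V \<subseteq> vs2.span (f ` ?D)"
  proof safe
    fix x assume "x \<in> V"
    then have "x \<in> vs1.span (C0 \<union> ?D)" using C by (simp add: Un_absorb1 subsetD)
    then obtain a b where ab: "x = a + b" "a \<in> vs1.span C0" "b \<in> vs1.span ?D"
      unfolding vs1.span_Un by blast
    have "vs1.span C0 \<subseteq> {x. f x = 0}" using C0(1) f.subspace_kernel by (intro vs1.span_minimal) auto
    then have "f x = f b" using ab by (auto simp: f.add)
    then show "f x \<in> vs2.span (f ` ?D)" using ab(3) by (auto simp: f.span_image)
  qed
  moreover have "f ` ?D \<subseteq> f ` V" using C(2) by blast
  ultimately have "vs2.dim (f ` V) = card (f ` ?D)" using vs2.basis_card_eq_dim by metis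
  also have "\<dots> = card ?D"
    by (intro card_image inj_on_subset[OF inj] vs1.span_superset)
  also have "card ?D = card C - card C0" using C(1) fin by (simp add: card_Diff_subset finite_subset)
  finally have "vs2.dim (f ` V) = card C - card C0" .
  moreover have "vs1.dim ?K = card C0" using vs1.basis_card_eq_dim[OF C0(1,3,2)] ..
  moreover have "vs1.dim V = card C" using vs1.basis_card_eq_dim[OF C(2,4,3)] ..
  moreover have "card C0 \<le> card C" using C(1) fin by (rule card_mono[rotated])
  ultimately show ?thesis by simp
qed


global_interpretation chain: vector_space "\<lambda>(c::'k::field) (u :: nat set \<Rightarrow> ('n, 'k) mpoly) S. Const c * u S"
  by standard (simp_all add: fun_eq_iff plus_fun_def algebra_simps Const_add Const_mult)

global_interpretation chain_chain: vector_space_pair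
  "\<lambda>(c::'k::field) (u :: nat set \<Rightarrow> ('n, 'k) mpoly) S. Const c * u S"
  "\<lambda>(c::'k::field) (u :: nat set \<Rightarrow> ('n, 'k) mpoly) S. Const c * u S"
  by unfold_locales

global_interpretation chain_mpoly: vector_space_pair
  "\<lambda>(c::'k::field) (u :: nat set \<Rightarrow> ('n, 'k) mpoly) S. Const c * u S" "scale_mpoly :: 'k \<Rightarrow> ('n, 'k) mpoly \<Rightarrow> _"
  by unfold_locales

lemma linear_koszul_d:
  "Vector_Spaces.linear (\<lambda>(c::'k::field) (u :: nat set \<Rightarrow> ('n, 'k) mpoly) S. Const c * u S) (\<lambda>c u S. Const c * u S) (koszul_d r g)"
  unfolding Vector_Spaces.linear_iff
  by (auto simp: chain.vector_space_axioms fun_eq_iff plus_fun_def koszul_d_add koszul_d_scale)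

lemma linear_koszul_d_empty:
  "Vector_Spaces.linear (\<lambda>(c::'k::field) (u :: nat set \<Rightarrow> ('n, 'k) mpoly) S. Const c * u S) scale_mpoly (\<lambda>u. koszul_d r g u {})"
  unfolding Vector_Spaces.linear_iff
  by (auto simp: chain.vector_space_axioms mpoly.vector_space_axioms plus_fun_def koszul_d_add koszul_d_scale)

lemma subspace_koszul_chains:
  "chain.subspace (koszul_chains r \<delta> i m :: (nat set \<Rightarrow> ('n::finite, 'k::field) mpoly) set)"
proof (rule chain.subspaceI)
  show "0 \<in> koszul_chains r \<delta> i m" by (simp add: zero_fun_def)
next
  fix u v :: "nat set \<Rightarrow> ('n, 'k) mpoly"
  assume uv: "u \<in> koszul_chains r \<delta> i m" "v \<in> koszul_chains r \<delta> i m"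
  have "u S \<noteq> 0 \<or> v S \<noteq> 0" if "u S + v S \<noteq> 0" for S using that by auto
  then show "u + v \<in> koszul_chains r \<delta> i m"
    using uv keys_add[of "u S" "v S" for S] unfolding koszul_chains_def plus_fun_def by blast
next
  fix c :: 'k and u :: "nat set \<Rightarrow> ('n, 'k) mpoly"
  assume u: "u \<in> koszul_chains r \<delta> i m"
  have "u S \<noteq> 0" if "Const c * u S \<noteq> 0" for S using that by auto
  then show "(\<lambda>S. Const c * u S) \<in> koszul_chains r \<delta> i m"
    using u keys_Const_mult[of c "u S" for S] unfolding koszul_chains_def by blast
qed

lemma koszul_chains_finite_span:
  obtains B :: "(nat set \<Rightarrow> ('n::finite, 'k::field) mpoly) set"
  where "finite B" "koszul_chains r \<delta> i m \<subseteq> chain.span B"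
proof -
  let ?b = "\<lambda>(S, k) S'. if S' = S then single k 1 else 0 :: ('n, 'k) mpoly"
  let ?I = "Pow {..<r} \<times> (\<Union>e\<in>{..m}. {k :: 'n \<Rightarrow>\<^sub>0 nat. total_degree k = e})"
  have "u \<in> chain.span (?b ` ?I)" if u: "u \<in> koszul_chains r \<delta> i m" for u :: "nat set \<Rightarrow> ('n, 'k) mpoly"
  proof -
    let ?v = "\<Sum>S\<in>Pow {..<r}. \<Sum>k\<in>keys (u S). (\<lambda>S'. Const (lookup (u S) k) * ?b (S, k) S')"
    have sum_apply: "(\<Sum>x\<in>I. F x) S = (\<Sum>x\<in>I. F x S)" for I and F :: "'i \<Rightarrow> nat set \<Rightarrow> ('n, 'k) mpoly" and S
      by (induction I rule: infinite_finite_induct) (auto simp: plus_fun_def zero_fun_def)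
    have "?v S' = u S'" for S'
    proof -
      have "?v S' = (\<Sum>S\<in>Pow {..<r}. if S = S' then u S else 0)"
        unfolding sum_apply
      proof (intro sum.cong refl)
        fix S
        have "(\<Sum>k\<in>keys (u S). Const (lookup (u S) k) * single k 1) = u S"
          by (simp add: Const_mult_single flip: mpoly_eq_sum_monomials)
        then show "(\<Sum>k\<in>keys (u S). Const (lookup (u S) k) * ?b (S, k) S') = (if S = S' then u S else 0)"
          by auto
      qed
      also have "\<dots> = u S'"
        using u by (auto simp: koszul_chains_def)
      finally show ?thesis .
    qed
    then have "?v = u" by blast
    moreover have "?v \<in> chain.span (?b ` ?I)"
    proof (intro chain.span_sum chain.span_scale chain.span_base imageI)
      fix S k assume S: "S \<in> Pow {..<r}" and k: "k \<in> keys (u S)"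
      have "total_degree k \<le> m" using koszul_chains_degree[OF u k] by simp
      then show "(S, k) \<in> ?I" using S by auto
    qed
    ultimately show ?thesis by metis
  qed
  moreover have "finite (?b ` ?I)"
    by (intro finite_imageI finite_cartesian_product finite_UN_I finite_total_degree) auto
  ultimately show ?thesis by (intro that[of "?b ` ?I"] subsetI)
qed

text \<open>The two complexes have the same graded pieces. By exactness the kernel of each differential is the image of the
  next one, so rank-nullity determines the ranks successively, from the last differential to the first.\<close>

lemma dim_koszul_d_image_eq:
  fixes g g' :: "nat \<Rightarrow> ('n::finite, 'k::field) mpoly"
  assumes g: "\<And>s. s < r \<Longrightarrow> g s \<in> graded_piece (\<delta> s)" and g': "\<And>s. s < r \<Longrightarrow> g' s \<in> graded_piece (\<delta> s)"
    and exact: "\<And>i w. 0 < i \<Longrightarrow> w \<in> koszul_chains r \<delta> i m \<Longrightarrow> koszul_d r g w = 0 \<Longrightarrow>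
      w \<in> koszul_d r g ` koszul_chains r \<delta> (Suc i) m"
    and exact': "\<And>i w. 0 < i \<Longrightarrow> w \<in> koszul_chains r \<delta> i m \<Longrightarrow> koszul_d r g' w = 0 \<Longrightarrow>
      w \<in> koszul_d r g' ` koszul_chains r \<delta> (Suc i) m"
    and "0 < i"
  shows "chain.dim (koszul_d r g ` koszul_chains r \<delta> (Suc i) m) = chain.dim (koszul_d r g' ` koszul_chains r \<delta> (Suc i) m)"
  using \<open>0 < i\<close>
proof (induction "Suc r - i" arbitrary: i)
  case 0
  then have "u = 0" if "u \<in> koszul_chains r \<delta> (Suc i) m" for u :: "nat set \<Rightarrow> ('n, 'k) mpoly"
    using koszul_chains_large[OF that] by (auto simp: fun_eq_iff)
  then have "koszul_chains r \<delta> (Suc i) m \<subseteq> {0 :: nat set \<Rightarrow> ('n, 'k) mpoly}" by blast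
  moreover have "koszul_d r g 0 = 0" "koszul_d r g' 0 = 0" by (auto simp: koszul_d_def fun_eq_iff)
  ultimately have "koszul_d r g ` koszul_chains r \<delta> (Suc i) m = koszul_d r g' ` koszul_chains r \<delta> (Suc i) m"
    by force
  then show ?case by simp
next
  case (Suc t)
  let ?K = "\<lambda>i. koszul_chains r \<delta> i m :: (nat set \<Rightarrow> ('n, 'k) mpoly) set"
  have cycles: "{x \<in> ?K (Suc i). koszul_d r h x = 0} = koszul_d r h ` ?K (Suc (Suc i))"
    if "\<And>s. s < r \<Longrightarrow> h s \<in> graded_piece (\<delta> s)"
      "\<And>w. w \<in> ?K (Suc i) \<Longrightarrow> koszul_d r h w = 0 \<Longrightarrow> w \<in> koszul_d r h ` ?K (Suc (Suc i))" for h
    using that(2) koszul_d_chains[OF that(1), where i = "Suc i" and m = m] by (auto simp: koszul_d_d fun_eq_iff)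
  obtain B where B: "finite B" "?K (Suc i) \<subseteq> chain.span B" by (rule koszul_chains_finite_span)
  note rn = chain_chain.rank_nullity[OF linear_koszul_d subspace_koszul_chains B]
  have IH: "chain.dim (koszul_d r g ` ?K (Suc (Suc i))) = chain.dim (koszul_d r g' ` ?K (Suc (Suc i)))"
    using Suc.hyps(2) by (intro Suc.hyps(1)) auto
  show ?case
  proof -
    have "{x \<in> ?K (Suc i). koszul_d r g x = 0} = koszul_d r g ` ?K (Suc (Suc i))"
      by (rule cycles) (use g exact[of "Suc i"] in auto)
    moreover have "{x \<in> ?K (Suc i). koszul_d r g' x = 0} = koszul_d r g' ` ?K (Suc (Suc i))"
      by (rule cycles) (use g' exact'[of "Suc i"] in auto)
    ultimately show ?thesis using rn[of r g] rn[of r g'] IH by simp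
  qed
qed

lemma koszul_d_image_ideal_piece:
  fixes g :: "nat \<Rightarrow> ('n::finite, 'k::field) mpoly"
  assumes g: "\<And>s. s < r \<Longrightarrow> g s \<in> graded_piece (\<delta> s)"
  shows "(\<lambda>u. koszul_d r g u {}) ` koszul_chains r \<delta> 1 m = ideal (g ` {..<r}) \<inter> graded_piece m"
proof
  have d_empty: "koszul_d r g u {} = (\<Sum>s<r. g s * u {s})" for u
    by (simp add: koszul_d_def koszul_sign_def)
  show "(\<lambda>u. koszul_d r g u {}) ` koszul_chains r \<delta> 1 m \<subseteq> ideal (g ` {..<r}) \<inter> graded_piece m"
  proof safe
    fix u :: "nat set \<Rightarrow> ('n, 'k) mpoly" assume u: "u \<in> koszul_chains r \<delta> 1 m"
    show "koszul_d r g u {} \<in> ideal (g ` {..<r})"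
      unfolding d_empty
      by (intro mpoly_ideal.span_sum) (metis imageI mpoly_ideal.span_base mpoly_ideal.span_scale mult.commute)
    have "koszul_d r g u \<in> koszul_chains r \<delta> 0 m"
      using u by (intro koszul_d_chains[OF g]) auto
    from koszul_chains_degree[OF this, of _ "{}"] show "koszul_d r g u {} \<in> graded_piece m"
      by (auto simp: graded_piece_def)
  qed
  show "ideal (g ` {..<r}) \<inter> graded_piece m \<subseteq> (\<lambda>u. koszul_d r g u {}) ` koszul_chains r \<delta> 1 m"
  proof safe
    fix p assume p: "p \<in> ideal (g ` {..<r})" "p \<in> graded_piece m"
    obtain q where q: "p = (\<Sum>s<r. q s * g s)"
      and deg: "\<And>s k. s \<in> {..<r} \<Longrightarrow> k \<in> keys (q s) \<Longrightarrow> total_degree k + \<delta> s = m"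
      using graded_span_image_sum[OF finite_lessThan _ p, of \<delta>] g by (metis lessThan_iff)
    define u where "u S = (if S \<subseteq> {..<r} \<and> card S = 1 then q (the_elem S) else 0)" for S
    have "u \<in> koszul_chains r \<delta> 1 m"
      unfolding koszul_chains_def
    proof (intro CollectI allI conjI impI ballI)
      fix S k assume k: "k \<in> keys (u S)"
      then have "S \<subseteq> {..<r}" "card S = 1" by (auto simp: u_def split: if_splits)
      then obtain s where "S = {s}" "s < r" by (auto simp: card_1_singleton_iff)
      then show "total_degree k + sum \<delta> S = m" using k deg by (simp add: u_def)
    qed (auto simp: u_def split: if_splits)
    moreover have "p = koszul_d r g u {}"
      unfolding d_empty q by (intro sum.cong refl) (simp add: u_def mult.commute)
    ultimately show "p \<in> (\<lambda>u. koszul_d r g u {}) ` koszul_chains r \<delta> 1 m" by blast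
  qed
qed

lemma dim_ideal_piece_eq:
  fixes g g' :: "nat \<Rightarrow> ('n::finite, 'k::field_char_0) mpoly"
  assumes g: "\<And>s. s \<le> CARD('n) \<Longrightarrow> g s \<in> graded_piece (\<delta> s)" and g': "\<And>s. s \<le> CARD('n) \<Longrightarrow> g' s \<in> graded_piece (\<delta> s)"
    and forms: "graded_piece c \<subseteq> ideal (g ` {..CARD('n)})" "graded_piece c \<subseteq> ideal (g' ` {..CARD('n)})"
    and deg: "m + c + CARD('n) = sum \<delta> {..CARD('n)}"
  shows "mpoly.dim (ideal (g ` {..CARD('n)}) \<inter> graded_piece m) =
    mpoly.dim (ideal (g' ` {..CARD('n)}) \<inter> graded_piece m)"
proof -
  let ?r = "Suc (CARD('n))" and ?K = "\<lambda>i. koszul_chains (Suc (CARD('n))) \<delta> i m :: (nat set \<Rightarrow> ('n, 'k) mpoly) set"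
  have exact: "w \<in> koszul_d ?r h ` ?K (Suc i)"
    if h: "\<And>s. s \<le> CARD('n) \<Longrightarrow> h s \<in> graded_piece (\<delta> s)" "graded_piece c \<subseteq> ideal (h ` {..CARD('n)})"
      and w: "0 < i" "w \<in> ?K i" "koszul_d ?r h w = 0" for h w i
  proof -
    have "koszul_d ?r h w S = 0" for S using w(3) by simp
    show ?thesis
    proof (rule koszul_exact[of h \<delta> c m i w])
      show "h s \<in> graded_piece (\<delta> s)" if "s \<le> CARD('n)" for s using h(1) that .
      show "koszul_d ?r h w S = 0" for S by fact
      fix v assume "v \<in> ?K (Suc i)" "w = koszul_d ?r h v"
      then show ?thesis by blast
    qed (fact h(2) deg w)+
  qed
  obtain B where B: "finite B" "?K 1 \<subseteq> chain.span B" by (rule koszul_chains_finite_span)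
  have dim: "mpoly.dim (ideal (h ` {..CARD('n)}) \<inter> graded_piece m) + chain.dim (koszul_d ?r h ` ?K 2) = chain.dim (?K 1)"
    if h: "\<And>s. s \<le> CARD('n) \<Longrightarrow> h s \<in> graded_piece (\<delta> s)" "graded_piece c \<subseteq> ideal (h ` {..CARD('n)})" for h
  proof -
    have h': "h s \<in> graded_piece (\<delta> s)" if "s < ?r" for s using h(1) that by simp
    have "{u \<in> ?K 1. koszul_d ?r h u {} = 0} = koszul_d ?r h ` ?K 2"
    proof safe
      fix u :: "nat set \<Rightarrow> ('n, 'k) mpoly" assume u: "u \<in> ?K 1" "koszul_d ?r h u {} = 0"
      have d: "koszul_d ?r h u \<in> ?K 0" using u(1) by (intro koszul_d_chains[OF h']) auto
      have "koszul_d ?r h u S = 0" for S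
      proof (rule ccontr)
        assume "koszul_d ?r h u S \<noteq> 0"
        then have "S \<subseteq> {..<?r}" "card S = 0" using d by (auto simp: koszul_chains_def)
        then have "S = {}" by (metis card_0_eq finite_lessThan finite_subset)
        then show False using u(2) \<open>koszul_d ?r h u S \<noteq> 0\<close> by simp
      qed
      then have "koszul_d ?r h u = 0" by (simp add: fun_eq_iff)
      from exact[OF h _ u(1) this] show "u \<in> koszul_d ?r h ` ?K 2" by (simp add: numeral_2_eq_2)
    next
      fix v assume "v \<in> ?K 2"
      then show "koszul_d ?r h v \<in> ?K 1" by (intro koszul_d_chains[OF h']) (simp_all add: numeral_2_eq_2)
    qed (simp add: koszul_d_d)
    then show ?thesis
      using chain_mpoly.rank_nullity[OF linear_koszul_d_empty subspace_koszul_chains B, of ?r h]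
        koszul_d_image_ideal_piece[of ?r h \<delta> m, OF h'] by (simp add: lessThan_Suc_atMost)
  qed
  have "chain.dim (koszul_d ?r g ` ?K (Suc 1)) = chain.dim (koszul_d ?r g' ` ?K (Suc 1))"
    by (rule dim_koszul_d_image_eq) (use g g' exact[OF g forms(1)] exact[OF g' forms(2)] in auto)
  then show ?thesis using dim[OF g forms(1)] dim[OF g' forms(2)] by (simp add: numeral_2_eq_2)
qed


subsection \<open>The monomial complete intersection\<close>

lemma dim_span_monomials:
  assumes "finite M"
  shows "mpoly.dim {p :: ('n, 'k::field) mpoly. keys p \<subseteq> M} = card M"
proof -
  let ?x = "\<lambda>m. single m 1 :: ('n, 'k) mpoly"
  have inj: "inj_on ?x M" by (rule inj_onI) (metis lookup_single_eq lookup_single_not_eq zero_neq_one)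
  have "mpoly.independent (?x ` M)"
  proof (rule mpoly.independent_if_scalars_zero)
    fix f y assume sum: "(\<Sum>y\<in>?x ` M. Const (f y) * y) = 0" and "y \<in> ?x ` M"
    then obtain m where m: "m \<in> M" "y = ?x m" by blast
    have "0 = lookup (\<Sum>y\<in>?x ` M. Const (f y) * y) m" by (simp add: sum)
    also have "\<dots> = (\<Sum>m'\<in>M. if m' = m then f (?x m') else 0)"
      by (simp add: sum.reindex[OF inj] lookup_sum lookup_single when_def if_distrib cong: if_cong)
    also have "\<dots> = f y" using m assms by simp
    finally show "f y = 0" ..
  qed (use assms in simp)
  from mpoly.dim_span_eq_card_independent[OF this] show ?thesis
    by (simp add: span_monomials card_image[OF inj])
qed

lemma span_Var_powers:
  "ideal (range (\<lambda>a. Var a ^ e)) = (var_power_ideal e UNIV :: ('n::finite, 'k::comm_ring_1) mpoly set)"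
proof
  have "Var a ^ e \<in> (var_power_ideal e UNIV :: ('n, 'k) mpoly set)" for a
    by (auto simp: var_power_ideal_def Var_power intro!: exI[of _ a])
  then show "ideal (range (\<lambda>a. Var a ^ e)) \<subseteq> (var_power_ideal e UNIV :: ('n, 'k) mpoly set)"
    by (intro mpoly_ideal.span_minimal subspace_var_power_ideal) auto
  show "(var_power_ideal e UNIV :: ('n, 'k) mpoly set) \<subseteq> ideal (range (\<lambda>a. Var a ^ e))"
  proof
    fix p :: "('n, 'k) mpoly" assume p: "p \<in> var_power_ideal e UNIV"
    have "single k c \<in> ideal (range (\<lambda>a. Var a ^ e :: ('n, 'k) mpoly))"
      if k: "k \<in> keys p" for k c
    proof -
      obtain a where "e \<le> lookup k a" using p k by (auto simp: var_power_ideal_def)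
      then have "k - single a e + single a e = k"
        by (intro poly_mapping_eqI) (auto simp: lookup_add lookup_minus lookup_single when_def)
      then have "single k c = single (k - single a e) c * Var a ^ e"
        by (simp add: Var_power mult_single)
      then show ?thesis by (metis mpoly_ideal.span_base mpoly_ideal.span_scale rangeI)
    qed
    then have "(\<Sum>k\<in>keys p. single k (lookup p k)) \<in>
        ideal (range (\<lambda>a. Var a ^ e :: ('n, 'k) mpoly))"
      by (intro mpoly_ideal.span_sum)
    then show "p \<in> ideal (range (\<lambda>a. Var a ^ e :: ('n, 'k) mpoly))"
      by (simp flip: mpoly_eq_sum_monomials)
  qed
qed

text \<open>The total degree is one less than that of \<open>(x\<^sub>1 \<cdots> x\<^sub>n)\<^sup>e\<^sup>-\<^sup>1\<close>, so exactly one exponent is \<open>e - 2\<close> and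
  the others are \<open>e - 1\<close>.\<close>

lemma card_reduced_monomials:
  assumes "1 < e"
  shows "card {k :: 'n::finite \<Rightarrow>\<^sub>0 nat. total_degree k = CARD('n) * (e - 1) - 1 \<and> (\<forall>a. lookup k a < e)} = CARD('n)"
proof -
  let ?M = "{k :: 'n \<Rightarrow>\<^sub>0 nat. total_degree k = CARD('n) * (e - 1) - 1 \<and> (\<forall>a. lookup k a < e)}"
  define \<phi> :: "'n \<Rightarrow> 'n \<Rightarrow>\<^sub>0 nat" where
    "\<phi> a = (\<Sum>b\<in>UNIV. single b (if b = a then e - 2 else e - 1))" for a
  have \<phi>: "lookup (\<phi> a) b = (if b = a then e - 2 else e - 1)" for a b
    by (simp add: \<phi>_def lookup_sum lookup_single when_def)
  have iff: "k \<in> ?M \<longleftrightarrow> (\<exists>a. k = \<phi> a)" for k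
  proof -
    have pos: "1 \<le> CARD('n) * (e - 1)" using assms by (simp add: Suc_le_eq)
    let ?d = "\<lambda>b. (e - 1) - lookup k b"
    have "k \<in> ?M \<longleftrightarrow> (\<forall>b. lookup k b < e) \<and> sum ?d UNIV = 1"
    proof (cases "\<forall>b. lookup k b < e")
      case True
      have "?d b + lookup k b = e - 1" for b
        using True[rule_format, of b] by simp
      then have "(\<Sum>b\<in>UNIV. ?d b) + total_degree k = CARD('n) * (e - 1)"
        unfolding total_degree_def sum.distrib [symmetric] by simp
      then have "total_degree k = CARD('n) * (e - 1) - 1 \<longleftrightarrow> (\<Sum>b\<in>UNIV. ?d b) = 1"
        using pos by linarith
      then show ?thesis using True by simp
    qed auto
    also have "\<dots> \<longleftrightarrow> (\<forall>b. lookup k b < e) \<and> (\<exists>a. ?d a = 1 \<and> (\<forall>b. a \<noteq> b \<longrightarrow> ?d b = 0))"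
      by (subst sum_eq_1_iff) auto
    also have "\<dots> \<longleftrightarrow> (\<exists>a. \<forall>b. lookup k b = (if b = a then e - 2 else e - 1))"
    proof (intro iffI; elim conjE exE)
      fix a assume *: "\<forall>b. lookup k b < e" "?d a = 1" "\<forall>b. a \<noteq> b \<longrightarrow> ?d b = 0"
      have "lookup k b = (if b = a then e - 2 else e - 1)" for b
      proof (cases "b = a")
        case True
        then show ?thesis using *(2) by simp
      next
        case False
        then have "?d b = 0" "lookup k b < e" using * by auto
        then show ?thesis using False by simp
      qed
      then show "\<exists>a. \<forall>b. lookup k b = (if b = a then e - 2 else e - 1)" by blast
    next
      fix a assume *: "\<forall>b. lookup k b = (if b = a then e - 2 else e - 1)"
      then have "?d a = 1" "\<forall>b. lookup k b < e" "\<forall>b. a \<noteq> b \<longrightarrow> ?d b = 0"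
        using assms by simp_all
      then show "(\<forall>b. lookup k b < e) \<and> (\<exists>a. ?d a = 1 \<and> (\<forall>b. a \<noteq> b \<longrightarrow> ?d b = 0))" by blast
    qed
    also have "\<dots> \<longleftrightarrow> (\<exists>a. k = \<phi> a)"
      by (simp only: poly_mapping_eq_iff fun_eq_iff \<phi>)
    finally show ?thesis .
  qed
  have "inj \<phi>"
  proof (rule injI)
    fix a a' assume "\<phi> a = \<phi> a'"
    then have "lookup (\<phi> a) a = lookup (\<phi> a') a" by simp
    then show "a = a'" using assms by (auto simp: \<phi> split: if_splits)
  qed
  moreover have "?M = range \<phi>" using iff by blast
  ultimately show ?thesis by (simp only: card_image)
qed


lemma dim_monomial_complete_intersection:
  assumes "1 < e" and m: "m = CARD('n) * (e - 1) - 1"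
  shows "mpoly.dim (graded_piece m :: ('n::finite, 'k::field) mpoly set) =
    CARD('n) + mpoly.dim (ideal (range (\<lambda>a. Var a ^ e)) \<inter> (graded_piece m :: ('n, 'k) mpoly set))"
proof -
  let ?R = "{k :: 'n \<Rightarrow>\<^sub>0 nat. total_degree k = m}" and ?J = "{k :: 'n \<Rightarrow>\<^sub>0 nat. total_degree k = m \<and> (\<exists>a. e \<le> lookup k a)}"
  have fin: "finite ?R" "finite ?J" by (simp_all add: finite_total_degree)
  have "graded_piece m = {p :: ('n, 'k) mpoly. keys p \<subseteq> ?R}"
    by (auto simp: graded_piece_def)
  then have "mpoly.dim (graded_piece m :: ('n, 'k) mpoly set) = card ?R"
    using dim_span_monomials[OF fin(1)] by simp
  moreover have "ideal (range (\<lambda>a. Var a ^ e)) \<inter> graded_piece m = {p :: ('n, 'k) mpoly. keys p \<subseteq> ?J}"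
    by (auto simp: span_Var_powers var_power_ideal_def graded_piece_def)
  then have "mpoly.dim (ideal (range (\<lambda>a. Var a ^ e)) \<inter> (graded_piece m :: ('n, 'k) mpoly set)) = card ?J"
    using dim_span_monomials[OF fin(2)] by simp
  moreover have "card ?R = card (?R - ?J) + card ?J"
  proof -
    have "?J \<subseteq> ?R" by blast
    then show ?thesis using fin card_mono[of ?R ?J] by (simp add: card_Diff_subset)
  qed
  moreover have "?R - ?J = {k :: 'n \<Rightarrow>\<^sub>0 nat. total_degree k = CARD('n) * (e - 1) - 1 \<and> (\<forall>a. lookup k a < e)}"
    by (auto simp: m not_le) (metis not_le)
  ultimately show ?thesis using card_reduced_monomials[OF \<open>1 < e\<close>, where 'n = 'n] by simp
qed

lemma homogeneous_ideal_span:
  fixes g :: "'i \<Rightarrow> ('n::finite, 'k::comm_ring_1) mpoly"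
  assumes "finite I" "\<And>i. i \<in> I \<Longrightarrow> g i \<in> graded_piece (\<delta> i)"
  shows "homogeneous_ideal (ideal (g ` I))"
  unfolding homogeneous_ideal_def
proof (intro conjI ballI allI)
  fix p d assume "p \<in> ideal (g ` I)"
  then obtain q where "p = (\<Sum>i\<in>I. q i * g i)" by (rule span_image_sum[OF assms(1)])
  then have "hom_component d p = (\<Sum>i\<in>I. (if \<delta> i \<le> d then hom_component (d - \<delta> i) (q i) else 0) * g i)"
    by (auto simp: hom_component_sum hom_component_mult_graded[OF assms(2)] intro!: sum.cong)
  also have "\<dots> \<in> ideal (g ` I)"
    by (intro mpoly_ideal.span_sum mpoly_ideal.span_scale mpoly_ideal.span_base imageI)
  finally show "hom_component d p \<in> ideal (g ` I)" .
qed simp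

text \<open>The Koszul complex of the \<open>n + 1\<close> forms is exact in internal degree \<open>m\<close>, since
  \<open>m + (N + 1) + n\<close> is the sum \<open>n e + N\<close> of their degrees. So the ideal has the same dimension in degree
  \<open>m\<close> as for \<open>x\<^sub>1\<^sup>e, \<dots>, x\<^sub>n\<^sup>e, h\<close>, and as \<open>m < N\<close> the form \<open>h\<close> does not contribute. There the quotient has the
  monomials \<open>(x\<^sub>1 \<cdots> x\<^sub>n)\<^sup>e\<^sup>-\<^sup>1 / x\<^sub>a\<close> as a basis.\<close>

theorem dim_ideal_piece_almost_complete_intersection:
  fixes f :: "'n::finite \<Rightarrow> ('n, 'k::field_char_0) mpoly"
  assumes e: "1 < e" and f: "\<And>i. f i \<in> graded_piece e" and h: "h \<in> graded_piece N"
    and N: "CARD('n) * (e - 1) \<le> N"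
    and full: "graded_piece (Suc N) \<subseteq> ideal (insert h (range f))"
    and m: "m = CARD('n) * (e - 1) - 1"
  shows "mpoly.dim (graded_piece m :: ('n, 'k) mpoly set) =
    CARD('n) + mpoly.dim (ideal (range f) \<inter> graded_piece m)"
proof -
  obtain b where "bij_betw b {..<CARD('n)} (UNIV :: 'n set)"
    using ex_bij_betw_nat_finite[of "UNIV :: 'n set"] by (auto simp: atLeast0LessThan)
  then have b: "b ` {..<CARD('n)} = UNIV" by (rule bij_betw_imp_surj_on)
  define gen where "gen f s = (if s < CARD('n) then f (b s) else h)" for f :: "'n \<Rightarrow> ('n, 'k) mpoly" and s
  define \<delta> where "\<delta> s = (if s < CARD('n) then e else N)" for s
  have image: "gen f ` {..CARD('n)} = insert h (range f)" for f
  proof -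
    have "{..CARD('n)} = insert (CARD('n)) {..<CARD('n)}" by auto
    then have "gen f ` {..CARD('n)} = insert (gen f (CARD('n))) (gen f ` {..<CARD('n)})"
      by (simp only: image_insert)
    also have "gen f (CARD('n)) = h" by (simp add: gen_def)
    also have "gen f ` {..<CARD('n)} = f ` (b ` {..<CARD('n)})"
      unfolding image_image by (intro image_cong refl) (simp add: gen_def)
    finally show ?thesis by (simp only: b)
  qed
  have sum_\<delta>: "sum \<delta> {..CARD('n)} = CARD('n) * e + N"
    by (simp add: \<delta>_def flip: lessThan_Suc_atMost)
  have pos: "1 \<le> CARD('n) * (e - 1)" using e by (simp add: Suc_le_eq)
  have deg: "m + Suc N + CARD('n) = sum \<delta> {..CARD('n)}"
  proof -
    have "CARD('n) * e = CARD('n) * (e - 1) + CARD('n)" using e by (cases e) auto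
    then show ?thesis unfolding m sum_\<delta> using pos by linarith
  qed
  have "m < N" using N pos m by linarith
  have drop_h: "ideal (insert h (range f)) \<inter> graded_piece m = ideal (range f) \<inter> graded_piece m"
    if f: "\<And>i. f i \<in> graded_piece e" for f :: "'n \<Rightarrow> ('n, 'k) mpoly"
  proof (intro equalityI subsetI)
    fix p assume p: "p \<in> ideal (insert h (range f)) \<inter> graded_piece m"
    then obtain c where "p - c * h \<in> ideal (range f)" by (auto simp: mpoly_ideal.span_insert)
    then have "hom_component m (p - c * h) \<in> ideal (range f)"
      using homogeneous_ideal_span[of UNIV f "\<lambda>_. e"] f by (simp add: homogeneous_ideal_def)
    moreover have "p = hom_component m ((p - c * h) + c * h)"
      using p hom_component_of_graded[of p m m] by simp
    then have "p = hom_component m (p - c * h)"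
      using \<open>m < N\<close> by (simp only: hom_component_add hom_component_mult_graded[OF h]) simp
    ultimately show "p \<in> ideal (range f) \<inter> graded_piece m" using p by simp
  next
    fix p assume "p \<in> ideal (range f) \<inter> graded_piece m"
    then show "p \<in> ideal (insert h (range f)) \<inter> graded_piece m"
      using mpoly_ideal.span_mono[of "range f" "insert h (range f)"] by blast
  qed
  let ?x = "\<lambda>a. Var a ^ e :: ('n, 'k) mpoly"
  have x: "?x a \<in> graded_piece e" for a using graded_piece_power[OF graded_piece_Var(1), of a e] by simp
  have gen_graded: "gen f s \<in> graded_piece (\<delta> s)" if "\<And>i. f i \<in> graded_piece e" for f s
    using that h by (simp add: gen_def \<delta>_def)
  have full_x: "graded_piece (Suc N) \<subseteq> ideal (insert h (range ?x))"
  proof -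
    have "graded_piece (Suc N) \<subseteq> (var_power_ideal e UNIV :: ('n, 'k) mpoly set)"
      unfolding var_power_ideal_def graded_piece_def
    proof (intro subsetI CollectI ballI, rule ccontr)
      fix p :: "('n, 'k) mpoly" and k assume "p \<in> {p. \<forall>m\<in>keys p. total_degree m = Suc N}"
        and "k \<in> keys p" and small: "\<not> (\<exists>a\<in>UNIV. e \<le> lookup k a)"
      then have "total_degree k = Suc N" by simp
      moreover have "lookup k a \<le> e - 1" for a
      proof -
        have "\<not> e \<le> lookup k a" using small by blast
        then show ?thesis by linarith
      qed
      then have "total_degree k \<le> CARD('n) * (e - 1)"
        unfolding total_degree_def using sum_bounded_above[of UNIV "lookup k" "e - 1"] by simp
      ultimately show False using N by simp
    qed
    also have "\<dots> = ideal (range ?x)" by (rule span_Var_powers [symmetric])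
    also have "\<dots> \<subseteq> ideal (insert h (range ?x))" by (rule mpoly_ideal.span_mono) blast
    finally show ?thesis .
  qed
  have "mpoly.dim (ideal (gen f ` {..CARD('n)}) \<inter> graded_piece m) =
      mpoly.dim (ideal (gen ?x ` {..CARD('n)}) \<inter> graded_piece m)"
    by (rule dim_ideal_piece_eq[where c = "Suc N" and \<delta> = \<delta>])
      (use full full_x deg gen_graded f x in \<open>simp_all add: image\<close>)
  then have "mpoly.dim (ideal (range f) \<inter> graded_piece m) =
      mpoly.dim (ideal (range ?x) \<inter> graded_piece m)"
    by (simp only: image drop_h[OF f] drop_h[OF x])
  then show ?thesis using dim_monomial_complete_intersection[OF e m, where 'k = 'k] by simp
qed

section \<open>Nodes and the Hessian\<close>

lemma partial_deriv_diff: "partial_deriv i (p - q) = partial_deriv i p - partial_deriv i q"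
  for p q :: "('n, 'k::comm_ring_1) mpoly"
  by (rule poly_mapping_eqI) (simp only: lookup_partial_deriv lookup_minus right_diff_distrib)

definition hessian :: "('n::finite, 'k::comm_semiring_1) mpoly \<Rightarrow> 'k ^ 'n \<Rightarrow> 'k ^ 'n ^ 'n" where
  "hessian f v = (\<chi> i j. eval_at v (partial_deriv j (partial_deriv i f)))"

definition critical :: "('n::finite, 'k::comm_semiring_1) mpoly \<Rightarrow> 'k ^ 'n \<Rightarrow> bool" where
  "critical f v \<longleftrightarrow> (\<forall>i. eval_at v (partial_deriv i f) = 0)"

lemma hessian_symmetric: "(\<Sum>i\<in>UNIV. u $ i * (hessian f v *v w) $ i) = (\<Sum>i\<in>UNIV. w $ i * (hessian f v *v u) $ i)"
proof -
  have "(\<Sum>i\<in>UNIV. u $ i * (hessian f v *v w) $ i) =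
      (\<Sum>i\<in>UNIV. \<Sum>j\<in>UNIV. u $ i * w $ j * eval_at v (partial_deriv j (partial_deriv i f)))"
    by (simp add: matrix_vector_mult_def hessian_def sum_distrib_left ac_simps)
  also have "\<dots> = (\<Sum>j\<in>UNIV. \<Sum>i\<in>UNIV. u $ i * w $ j * eval_at v (partial_deriv i (partial_deriv j f)))"
    by (subst sum.swap) (simp add: partial_deriv_commute)
  also have "\<dots> = (\<Sum>i\<in>UNIV. w $ i * (hessian f v *v u) $ i)"
    by (simp add: matrix_vector_mult_def hessian_def sum_distrib_left ac_simps)
  finally show ?thesis .
qed

lemma hessian_mult_nth: "(hessian f v *v u) $ i = (\<Sum>j\<in>UNIV. u $ j * eval_at v (partial_deriv j (partial_deriv i f)))"
  by (simp add: matrix_vector_mult_def hessian_def ac_simps)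

lemma hessian_kernel_point:
  assumes f: "f \<in> graded_piece (Suc e)" and v: "critical f v"
  shows "hessian f v *v v = 0"
proof -
  have "(hessian f v *v v) $ i = 0" for i
    unfolding hessian_mult_nth Euler_identity_at[OF partial_deriv_graded[OF f]]
    using v by (simp add: critical_def)
  then show ?thesis by (simp add: vec_eq_iff)
qed

lemma pderiv_sum: "pderiv (sum g I) = (\<Sum>i\<in>I. pderiv (g i))"
  by (induction I rule: infinite_finite_induct) (simp_all add: pderiv_add)

lemma coeff_2_restrict_line:
  fixes f :: "('n::finite, 'k::field_char_0) mpoly"
  shows "2 * coeff (restrict_line v u f) 2 = (\<Sum>i\<in>UNIV. u $ i * (hessian f v *v u) $ i)"
proof -
  have "2 * coeff (restrict_line v u f) 2 = coeff (pderiv (pderiv (restrict_line v u f))) 0"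
    by (simp add: coeff_pderiv numeral_2_eq_2)
  also have "pderiv (pderiv (restrict_line v u f)) =
      (\<Sum>i\<in>UNIV. smult (u $ i) (\<Sum>j\<in>UNIV. smult (u $ j) (restrict_line v u (partial_deriv j (partial_deriv i f)))))"
    by (simp add: pderiv_restrict_line pderiv_sum pderiv_smult)
  also have "coeff \<dots> 0 = (\<Sum>i\<in>UNIV. u $ i * (hessian f v *v u) $ i)"
    by (simp add: coeff_sum coeff_0_restrict_line hessian_mult_nth)
  finally show ?thesis .
qed

lemma restrict_line_local_equation:
  fixes f :: "('n::finite, 'k::field) mpoly"
  assumes "v $ i = 1" "u $ i = 0"
  shows "restrict_line 0 u (local_equation i v f) = restrict_line v u f"
  unfolding local_equation_def
  by (induction f rule: mpoly_induct) (use assms in \<open>auto simp: one_pCons\<close>)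

lemma polar_form_local_equation:
  fixes f :: "('n::finite, 'k::field_char_0) mpoly"
  assumes v: "v $ i = 1" and u: "u $ i = 0" and w: "w $ i = 0"
  defines "q \<equiv> hom_component 2 (local_equation i v f)"
  shows "eval_at (u + w) q - eval_at u q - eval_at w q = (\<Sum>j\<in>UNIV. u $ j * (hessian f v *v w) $ j)"
proof -
  let ?B = "\<lambda>u w. \<Sum>j\<in>UNIV. u $ j * (hessian f v *v w) $ j"
  have q: "2 * eval_at u q = ?B u u" if "u $ i = 0" for u
    using coeff_2_restrict_line[of v u f] restrict_line_local_equation[OF v that, of f]
    by (simp add: q_def flip: coeff_restrict_line_origin)
  have "2 * (eval_at (u + w) q - eval_at u q - eval_at w q) = ?B (u + w) (u + w) - ?B u u - ?B w w"
    using q[of "u + w"] q[OF u] q[OF w] u w by (simp add: algebra_simps)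
  also have "\<dots> = ?B u w + ?B w u"
    by (simp add: matrix_vector_right_distrib distrib_left distrib_right sum.distrib)
  also have "\<dots> = 2 * ?B u w" using hessian_symmetric[of w f v u] by simp
  finally show ?thesis by (simp only: mult_cancel_left) simp
qed

text \<open>In the chart \<open>x\<^sub>i = 1\<close> the tangent directions are the vectors with \<open>u\<^sub>i = 0\<close>. They span a complement
  of the line through \<open>v\<close>, which Euler's identity puts into the kernel of the Hessian. So the quadratic part
  of the local equation is nondegenerate if and only if the kernel is this line.\<close>

lemma nondegenerate_local_equation_iff:
  fixes f :: "('n::finite, 'k::field_char_0) mpoly"
  assumes f: "f \<in> graded_piece (Suc e)" and v: "critical f v" "v $ i = 1"
  shows "nondegenerate_on {u. u $ i = 0} (hom_component 2 (local_equation i v f)) \<longleftrightarrow>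
    (\<forall>u. hessian f v *v u = 0 \<longrightarrow> u \<in> vec.span {v})"
proof -
  let ?H = "hessian f v" and ?B = "\<lambda>u w. \<Sum>j\<in>UNIV. u $ j * (hessian f v *v w) $ j"
  have Hv: "?H *v v = 0" by (rule hessian_kernel_point[OF f v(1)])
  have nd: "nondegenerate_on {u. u $ i = 0} (hom_component 2 (local_equation i v f)) \<longleftrightarrow>
      (\<forall>u. u $ i = 0 \<longrightarrow> (\<forall>w. w $ i = 0 \<longrightarrow> ?B u w = 0) \<longrightarrow> u = 0)"
    unfolding nondegenerate_on_def using polar_form_local_equation[OF v(2), of _ _ f] by auto
  show ?thesis
    unfolding nd
  proof (intro iffI allI impI)
    fix u assume nondeg: "\<forall>u. u $ i = 0 \<longrightarrow> (\<forall>w. w $ i = 0 \<longrightarrow> ?B u w = 0) \<longrightarrow> u = 0"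
      and u: "?H *v u = 0"
    let ?u = "u - (u $ i) *s v"
    have "?H *v ?u = 0"
      by (simp add: matrix_vector_mult_diff_distrib u Hv vector_scalar_commute)
    then have "?B ?u w = 0" for w
      using hessian_symmetric[of ?u f v w] by simp
    moreover have "?u $ i = 0" using v by simp
    ultimately have "?u = 0" using nondeg by blast
    then have "u = (u $ i) *s v" by simp
    then show "u \<in> vec.span {v}" unfolding vec.span_singleton by blast
  next
    fix u assume ker: "\<forall>u. ?H *v u = 0 \<longrightarrow> u \<in> vec.span {v}" and ui: "u $ i = 0"
      and u: "\<forall>w. w $ i = 0 \<longrightarrow> ?B u w = 0"
    have "(?H *v u) $ k = 0" for k
    proof -
      let ?w = "axis k 1 - (axis k 1 $ i) *s v"
      have "?B ?w u = ?B u ?w" by (rule hessian_symmetric)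
      also have "\<dots> = 0" using u v by simp
      finally have "?B (axis k 1) u - (axis k 1 $ i) * ?B v u = 0"
        by (simp add: left_diff_distrib sum_subtractf sum_distrib_left mult.assoc)
      moreover have "?B v u = 0" using hessian_symmetric[of v f v u] by (simp add: Hv)
      moreover have "?B (axis k 1) u = (?H *v u) $ k"
      proof -
        have "?B (axis k 1) u = (\<Sum>j\<in>UNIV. if j = k then (?H *v u) $ j else 0)"
          by (intro sum.cong refl) (auto simp: axis_def)
        then show ?thesis by simp
      qed
      ultimately show ?thesis by simp
    qed
    then have "u \<in> vec.span {v}" using ker by (simp add: vec_eq_iff)
    then obtain c where "u = c *s v" unfolding vec.span_singleton by blast
    then show "u = 0" using ui v(2) by simp
  qed
qed

lemma Sing_iff:
  fixes f :: "('n::finite, 'k::field_char_0) mpoly"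
  assumes f: "f \<in> graded_piece (Suc (Suc e))"
  shows "P \<in> Sing f \<longleftrightarrow> (\<exists>v. v \<noteq> 0 \<and> P = vec.span {v} \<and> critical f v)"
proof
  assume "P \<in> Sing f"
  then obtain v where v: "v \<noteq> 0" "P = vec.span {v}" and "\<forall>i. \<forall>w\<in>P. eval_at w (partial_deriv i f) = 0"
    unfolding Sing_def zero_locus_def projectivization_def by auto
  then have "critical f v" unfolding critical_def by (simp add: vec.span_base)
  with v show "\<exists>v. v \<noteq> 0 \<and> P = vec.span {v} \<and> critical f v" by blast
next
  assume "\<exists>v. v \<noteq> 0 \<and> P = vec.span {v} \<and> critical f v"
  then obtain v where v: "v \<noteq> 0" "P = vec.span {v}" "critical f v" by blast
  have "of_nat (Suc (Suc e)) * eval_at v f = 0"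
    using v(3) unfolding Euler_identity_at[OF f, symmetric] critical_def by simp
  then have fv: "eval_at v f = 0" by (simp del: of_nat_Suc)
  have "eval_at w f = 0" "eval_at w (partial_deriv i f) = 0" if "w \<in> P" for w i
  proof -
    obtain c where "w = c *s v" using \<open>w \<in> P\<close> unfolding v(2) vec.span_singleton by blast
    then show "eval_at w f = 0" "eval_at w (partial_deriv i f) = 0"
      using fv v(3) eval_at_scale[OF f, of c v] eval_at_scale[OF partial_deriv_graded[OF f], of c v]
      by (auto simp: critical_def)
  qed
  moreover have "P \<in> projectivization (*s) UNIV" using v unfolding projectivization_def by blast
  ultimately show "P \<in> Sing f" unfolding Sing_def zero_locus_def by blast
qed

lemma span_singleton_eq:
  fixes v w :: "'k::field ^ 'n"
  assumes "w \<in> vec.span {v}" "w \<noteq> 0"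
  shows "vec.span {w} = vec.span {v}"
proof -
  obtain c where "w = c *s v" using assms(1) unfolding vec.span_singleton by blast
  moreover have "c \<noteq> 0" using calculation assms(2) by auto
  ultimately show ?thesis using vec.span_image_scale[of "{v}" "\<lambda>_. c"] by simp
qed

lemma normalize_coordinate:
  fixes v :: "'k::field ^ 'n::finite"
  assumes "v \<noteq> 0"
  obtains c i where "c \<noteq> 0" "(c *s v) $ i = 1" "vec.span {c *s v} = vec.span {v}"
proof -
  obtain i where i: "v $ i \<noteq> 0" using assms by (auto simp: vec_eq_iff)
  let ?c = "inverse (v $ i)"
  have "vec.span {?c *s v} = vec.span {v}"
    using vec.span_image_scale[of "{v}" "\<lambda>_. ?c"] i by simp
  then show ?thesis using i by (intro that[of ?c i]) auto
qed

lemma critical_scale: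
  assumes f: "f \<in> graded_piece (Suc e)" and "critical f v"
  shows "critical f (c *s v)"
  using assms(2) eval_at_scale[OF partial_deriv_graded[OF f], of c v] by (simp add: critical_def)

lemma Sing_normalized:
  fixes f :: "('n::finite, 'k::field_char_0) mpoly"
  assumes f: "f \<in> graded_piece (Suc (Suc e))" and "P \<in> Sing f"
  obtains v i where "v $ i = 1" "P = vec.span {v}" "critical f v"
proof -
  obtain v where v: "v \<noteq> 0" "P = vec.span {v}" "critical f v" using assms Sing_iff[OF f] by blast
  obtain c i where "c \<noteq> 0" "(c *s v) $ i = 1" "vec.span {c *s v} = vec.span {v}"
    using v(1) by (rule normalize_coordinate)
  then show ?thesis using that critical_scale[OF f v(3)] v(2) by metis
qed

lemma is_node_D:
  fixes f :: "('n::finite, 'k::field_char_0) mpoly"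
  assumes f: "f \<in> graded_piece (Suc (Suc e))" and P: "is_node f P"
  obtains v i where "v $ i = 1" "P = vec.span {v}" "critical f v"
    "\<And>u. hessian f v *v u = 0 \<Longrightarrow> u \<in> vec.span {v}"
proof -
  obtain i v where v: "P \<in> Sing f" "v \<in> P" "v $ i = 1"
    and nd: "nondegenerate_on {u. u $ i = 0} (hom_component 2 (local_equation i v f))"
    using P unfolding is_node_def by blast
  obtain w where w: "P = vec.span {w}" "critical f w" using v(1) Sing_iff[OF f] by blast
  then obtain c where c: "v = c *s w" using v(2) unfolding w(1) vec.span_singleton by blast
  have "v \<noteq> 0" using v(3) by auto
  then have "P = vec.span {v}" using span_singleton_eq[of v w] v(2) w(1) by simp
  moreover have "critical f v" unfolding c by (rule critical_scale[OF f w(2)])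
  ultimately show ?thesis
    using nondegenerate_local_equation_iff[OF f _ v(3)] nd v(3) that by blast
qed

section \<open>The ideal of a set of nodes\<close>

text \<open>Cramer's rule without division.\<close>

lemma cramer_mult:
  fixes A :: "'a::comm_ring_1 ^ 'n::finite ^ 'n"
  shows "det (\<chi> i j. if j = k then (A *v x) $ i else A $ i $ j) = x $ k * det A"
proof -
  let ?B = "transpose A"
  have "det (\<chi> i j. if j = k then (A *v x) $ i else A $ i $ j) =
      det (\<chi> i. if i = k then (\<Sum>j\<in>UNIV. x $ j *s row j ?B) else row i ?B)"
    by (subst det_transpose [symmetric], rule arg_cong[where f = det])
      (simp add: vec_eq_iff transpose_def row_def matrix_vector_mult_def mult.commute)
  also have "\<dots> = (\<Sum>j\<in>UNIV. x $ j * det (\<chi> i. if i = k then row j ?B else row i ?B))"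
    by (simp add: det_linear_row_sum det_row_mul)
  also have "\<dots> = (\<Sum>j\<in>UNIV. if j = k then x $ k * det ?B else 0)"
  proof (intro sum.cong refl)
    fix j
    have "det (\<chi> i. if i = k then row j ?B else row i ?B) = 0" if "j \<noteq> k"
      by (rule det_identical_rows[OF that]) (use that in \<open>simp add: row_def vec_eq_iff\<close>)
    moreover have "(\<chi> i. if i = k then row k ?B else row i ?B) = ?B"
      by (simp add: vec_eq_iff row_def)
    ultimately show "x $ j * det (\<chi> i. if i = k then row j ?B else row i ?B) = (if j = k then x $ k * det ?B else 0)"
      by auto
  qed
  finally show ?thesis by simp
qed

text \<open>The product is the determinant with column \<open>k\<close> replaced by \<open>A x\<close>, and every term of its expansion has a
  factor in \<open>I\<close>.\<close>

lemma det_mult_mem_ideal: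
  fixes A :: "('n::finite, 'k::comm_ring_1) mpoly ^ 'm::finite ^ 'm"
  assumes I: "is_ideal I" and Ax: "\<And>i. (A *v x) $ i \<in> I"
  shows "det A * x $ k \<in> I"
proof -
  let ?C = "\<chi> i j. if j = k then (A *v x) $ i else A $ i $ j"
  have "of_int (sign p) * (\<Prod>i\<in>UNIV. ?C $ i $ p i) \<in> I" if p: "p permutes UNIV" for p
  proof -
    obtain i where i: "p i = k" using p by (metis permutes_surj surjD)
    have "(\<Prod>i\<in>UNIV. ?C $ i $ p i) = (\<Prod>i\<in>UNIV - {i}. ?C $ i $ p i) * ?C $ i $ p i"
      by (subst prod.remove[of _ i]) (auto simp: mult.commute)
    moreover have "?C $ i $ p i \<in> I" using Ax i by simp
    ultimately show ?thesis by (simp only: mpoly_ideal.subspace_scale[OF I])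
  qed
  then have "det ?C \<in> I" unfolding det_def by (intro mpoly_ideal.subspace_sum[OF I]) simp
  then show ?thesis by (simp only: cramer_mult mult.commute)
qed

lemma eval_at_det:
  fixes A :: "('n::finite, 'k::comm_ring_1) mpoly ^ 'm::finite ^ 'm"
  shows "eval_at v (det A) = det (\<chi> i j. eval_at v (A $ i $ j) :: 'k ^ 'm ^ 'm)"
proof -
  have "eval_at v (of_int z) = of_int z" for z
    by (cases z) (simp_all flip: Const_of_nat Const_1)
  then show ?thesis by (simp add: det_def eval_at_sum eval_at_prod)
qed

text \<open>Near a node the gradient ideal is the ideal of the point. The partial derivatives are combinations of
  the linear forms \<open>x\<^sub>b - v\<^sub>b x\<^sub>i\<close>, which cut out the point, and by nondegeneracy the matrix of coefficients
  can be chosen invertible at \<open>v\<close>: the form with \<open>b = i\<close> is zero, so that its column of coefficients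
  is free. By Cramer's rule the determinant then multiplies the linear forms into the gradient ideal.\<close>

lemma node_local_generators:
  fixes f :: "('n::finite, 'k::field_char_0) mpoly"
  assumes f: "f \<in> graded_piece (Suc e)" and v: "critical f v" "v $ i = 1"
    and ker: "\<And>u. hessian f v *v u = 0 \<Longrightarrow> u \<in> vec.span {v}"
  obtains h where "eval_at v h \<noteq> 0" "\<And>b. h * (Var b - Const (v $ b) * Var i) \<in> gradient_ideal f"
proof -
  define l where "l b = Var b - Const (v $ b) * Var i" for b
  have li: "l i = 0" and l0: "eval_at v (l b) = 0" for b using v by (simp_all add: l_def)
  have "\<exists>q. partial_deriv k f = (\<Sum>b\<in>UNIV. q b * l b)" for k
  proof -
    have "partial_deriv k f - Const (eval_at v (partial_deriv k f)) * Var i ^ e \<in> ideal (range l)"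
    proof (rule congruent_evaluation)
      show "Var j - Const (v $ j) * Var i \<in> ideal (range l)" for j
        by (rule mpoly_ideal.span_base) (auto simp: l_def)
    qed (auto intro: partial_deriv_graded f)
    then have "partial_deriv k f \<in> ideal (l ` UNIV)" using v(1) by (simp add: critical_def)
    then show ?thesis by (rule span_image_sum[OF finite]) blast
  qed
  then obtain q where q: "\<And>k. partial_deriv k f = (\<Sum>b\<in>UNIV. q k b * l b)" by metis
  define Q where "Q = (\<chi> k b. if b = i then (if k = i then 1 else 0) else q k b)"
  define M where "M = (\<chi> k b. eval_at v (Q $ k $ b))"
  have Q: "(Q *v (\<chi> b. l b)) $ k = partial_deriv k f" for k
  proof -
    have "(Q *v (\<chi> b. l b)) $ k = (\<Sum>b\<in>UNIV. Q $ k $ b * l b)" by (simp add: matrix_vector_mult_def)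
    also have "\<dots> = partial_deriv k f" unfolding q by (intro sum.cong refl) (auto simp: Q_def li)
    finally show ?thesis .
  qed
  have H: "hessian f v *v u = M *v u" if "u $ i = 0" for u
  proof -
    have "(hessian f v *v u) $ k = (M *v u) $ k" for k
    proof -
      have "eval_at v (partial_deriv a (partial_deriv k f)) = (\<Sum>b\<in>UNIV. M $ k $ b * ((if a = b then 1 else 0) - (if a = i then v $ b else 0)))" for a
      proof -
        have "partial_deriv a (partial_deriv k f) =
            (\<Sum>b\<in>UNIV. partial_deriv a (Q $ k $ b) * l b + Q $ k $ b * partial_deriv a (l b))"
          by (simp add: Q [symmetric] matrix_vector_mult_def partial_deriv_sum partial_deriv_mult)
        moreover have "eval_at v (partial_deriv a (l b)) = (if a = b then 1 else 0) - (if a = i then v $ b else 0)" for b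
          by (auto simp: l_def partial_deriv_diff partial_deriv_mult partial_deriv_Var)
        ultimately show ?thesis by (simp add: eval_at_sum l0 M_def)
      qed
      then have "(hessian f v *v u) $ k = (\<Sum>a\<in>UNIV. \<Sum>b\<in>UNIV. u $ a * (M $ k $ b * ((if a = b then 1 else 0) - (if a = i then v $ b else 0))))"
        by (simp add: hessian_mult_nth sum_distrib_left)
      also have "\<dots> = (\<Sum>a\<in>UNIV. \<Sum>b\<in>UNIV. if b = a then M $ k $ b * u $ b else 0)"
        using that by (intro sum.cong refl) auto
      also have "\<dots> = (M *v u) $ k" by (simp add: matrix_vector_mult_def)
      finally show ?thesis .
    qed
    then show ?thesis by (simp add: vec_eq_iff)
  qed
  have "z = 0" if Mz: "M *v z = 0" for z
  proof -
    have col: "(\<Sum>k\<in>UNIV. v $ k * M $ k $ b) = (if b = i then 1 else 0)" for b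
    proof (cases "b = i")
      case True
      have "(\<Sum>k\<in>UNIV. v $ k * M $ k $ i) = (\<Sum>k\<in>UNIV. if k = i then v $ k else 0)"
        by (intro sum.cong refl) (simp add: M_def Q_def)
      then show ?thesis using True v(2) by simp
    next
      case False
      then have "axis b 1 $ i = (0 :: 'k)" by (simp add: axis_def)
      from H[OF this] have "(hessian f v *v axis b 1) $ k = M $ k $ b" for k
        by (simp add: matrix_vector_mult_def axis_def if_distrib cong: if_cong)
      then have "(\<Sum>k\<in>UNIV. v $ k * M $ k $ b) = (\<Sum>k\<in>UNIV. v $ k * (hessian f v *v axis b 1) $ k)" by simp
      also have "\<dots> = 0" unfolding hessian_symmetric[of v] by (simp add: hessian_kernel_point[OF f v(1)])
      finally show ?thesis using False by simp
    qed
    have "0 = (\<Sum>k\<in>UNIV. v $ k * (M *v z) $ k)" by (simp add: Mz)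
    also have "\<dots> = (\<Sum>b\<in>UNIV. (\<Sum>k\<in>UNIV. v $ k * M $ k $ b) * z $ b)"
      unfolding matrix_vector_mult_def sum_distrib_left sum_distrib_right
      by (subst sum.swap) (simp add: sum_distrib_left mult.assoc)
    also have "\<dots> = z $ i"
    proof -
      have "(\<Sum>b\<in>UNIV. (\<Sum>k\<in>UNIV. v $ k * M $ k $ b) * z $ b) = (\<Sum>b\<in>UNIV. if b = i then z $ b else 0)"
        unfolding col by (intro sum.cong refl) simp
      then show ?thesis by simp
    qed
    finally have zi: "z $ i = 0" by simp
    then have "z \<in> vec.span {v}" using H[OF zi] Mz by (intro ker) simp
    then obtain c where "z = c *s v" unfolding vec.span_singleton by blast
    then show "z = 0" using zi v(2) by simp
  qed
  then have "det M \<noteq> 0"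
    by (metis invertible_det_nz invertible_left_inverse matrix_left_invertible_ker)
  then have "eval_at v (det Q) \<noteq> 0" by (simp add: eval_at_det M_def)
  moreover have "det Q * l b \<in> gradient_ideal f" for b
  proof -
    have "partial_deriv k f \<in> gradient_ideal f" for k
      unfolding gradient_ideal_def by (rule mpoly_ideal.span_base) simp
    then have "det Q * (\<chi> b. l b) $ b \<in> gradient_ideal f"
      by (intro det_mult_mem_ideal) (auto simp: Q gradient_ideal_def)
    then show ?thesis by simp
  qed
  ultimately show ?thesis using that[of "det Q"] by (simp add: l_def)
qed

lemma homogeneous_ideal_colon:
  fixes I :: "('n::finite, 'k::comm_ring_1) mpoly set"
  assumes I: "homogeneous_ideal I" and p: "p \<in> graded_piece s"
  shows "homogeneous_ideal {q. q * p \<in> I}"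
  unfolding homogeneous_ideal_def
proof (intro conjI ballI allI)
  have sub: "is_ideal I" using I by (simp add: homogeneous_ideal_def)
  show "is_ideal {q. q * p \<in> I}"
    using mpoly_ideal.subspace_0[OF sub] mpoly_ideal.subspace_add[OF sub] mpoly_ideal.subspace_scale[OF sub]
    by (intro mpoly_ideal.subspaceI) (simp_all add: distrib_right mult.assoc)
  fix q d assume "q \<in> {q. q * p \<in> I}"
  then have "hom_component (d + s) (q * p) \<in> I" using I by (simp add: homogeneous_ideal_def)
  then show "hom_component d q \<in> {q. q * p \<in> I}" by (simp add: hom_component_mult_graded[OF p])
qed


lemma homogeneous_ideal_gradient:
  fixes f :: "('n::finite, 'k::comm_ring_1) mpoly"
  assumes "f \<in> graded_piece (Suc e)"
  shows "homogeneous_ideal (gradient_ideal f)"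
  unfolding gradient_ideal_def
  by (rule homogeneous_ideal_span[where \<delta> = "\<lambda>_. e"]) (auto intro: partial_deriv_graded assms)

text \<open>By the local description at the nodes and the Nullstellensatz, a form that vanishes at all
  singular points lies in the saturation of the gradient ideal.\<close>

lemma vanishing_form_in_saturation:
  fixes f :: "('n::finite, 'k::{alg_closed_field, field_char_0}) mpoly"
  assumes f: "f \<in> graded_piece (Suc (Suc e))" and nodes: "\<And>P. P \<in> Sing f \<Longrightarrow> is_node f P"
    and p: "p \<in> graded_piece s" and vanish: "\<And>v. v \<noteq> 0 \<Longrightarrow> critical f v \<Longrightarrow> eval_at v p = 0"
  shows "\<exists>m. \<forall>q\<in>graded_piece m. q * p \<in> gradient_ideal f"
proof -
  let ?J = "gradient_ideal f"
  have sub: "is_ideal ?J" by (simp add: gradient_ideal_def)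
  have "\<exists>m. graded_piece m \<subseteq> {q. q * p \<in> ?J}"
  proof (rule projective_Nullstellensatz)
    show "homogeneous_ideal {q. q * p \<in> ?J}"
      by (rule homogeneous_ideal_colon[OF homogeneous_ideal_gradient[OF f] p])
    fix c :: "'k ^ 'n" assume "c \<noteq> 0"
    show "\<exists>q\<in>{q. q * p \<in> ?J}. \<exists>t. eval_at (t *s c) q \<noteq> 0"
    proof (cases "critical f c")
      case False
      then obtain i where i: "eval_at (1 *s c) (partial_deriv i f) \<noteq> 0" by (auto simp: critical_def)
      have "partial_deriv i f \<in> ?J"
        unfolding gradient_ideal_def by (rule mpoly_ideal.span_base) simp
      then have "partial_deriv i f * p \<in> ?J"
        using mpoly_ideal.subspace_scale[OF sub, of "partial_deriv i f" p] by (simp add: mult.commute)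
      then show ?thesis using i by blast
    next
      case True
      then have "vec.span {c} \<in> Sing f" using Sing_iff[OF f] \<open>c \<noteq> 0\<close> by blast
      from is_node_D[OF f nodes[OF this]] obtain v i where v: "v $ i = 1" "vec.span {c} = vec.span {v}" "critical f v"
        and ker: "\<And>u. hessian f v *v u = 0 \<Longrightarrow> u \<in> vec.span {v}" by blast
      obtain t where t: "v = t *s c"
        using v(2) vec.span_base[of v "{v}"] unfolding vec.span_singleton by blast
      obtain h where h: "eval_at v h \<noteq> 0" "\<And>b. h * (Var b - Const (v $ b) * Var i) \<in> ?J"
        using node_local_generators[OF f v(3,1) ker] by blast
      have "v \<noteq> 0" using v(1) by auto
      have "is_ideal {r. h * r \<in> ?J}"
        using mpoly_ideal.subspace_0[OF sub] mpoly_ideal.subspace_add[OF sub] mpoly_ideal.subspace_scale[OF sub]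
        by (intro mpoly_ideal.subspaceI) (simp_all add: distrib_left mult.left_commute[of h])
      then have "p - Const (eval_at v p) * Var i ^ s \<in> {r. h * r \<in> ?J}"
        by (rule congruent_evaluation) (use h(2) p in auto)
      then have "h * p \<in> ?J" using vanish[OF \<open>v \<noteq> 0\<close> v(3)] by simp
      then show ?thesis using h(1) t by blast
    qed
  qed
  then show ?thesis by blast
qed

definition linear_form :: "'k ^ 'n::finite \<Rightarrow> ('n, 'k::comm_semiring_1) mpoly" where
  "linear_form a = (\<Sum>b\<in>UNIV. Const (a $ b) * Var b)"

lemma linear_form_graded [simp]: "linear_form a \<in> graded_piece 1" "linear_form a \<in> graded_piece (Suc 0)"
  unfolding linear_form_def by (intro graded_piece_sum graded_piece_Const_mult graded_piece_Var)+

lemma eval_at_linear_form: "eval_at v (linear_form a) = (\<Sum>b\<in>UNIV. a $ b * v $ b)"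
  by (simp add: linear_form_def eval_at_sum)

lemma graded_piece_1_linear_form:
  fixes l :: "('n::finite, 'k::field_char_0) mpoly"
  assumes "l \<in> graded_piece 1"
  obtains a where "l = linear_form a"
proof -
  obtain q where q: "\<And>i. q i \<in> graded_piece 0" "l = (\<Sum>i\<in>UNIV. Var i * q i)"
    using assms graded_piece_Suc_D[of l 0] by auto
  have "Var i * q i = Const ((\<chi> i. eval_at 0 (q i)) $ i) * Var i" for i
    using graded_piece_0_D[OF q(1), of i 0] by (simp add: mult.commute)
  then have "l = linear_form (\<chi> i. eval_at 0 (q i))" using q(2) by (simp add: linear_form_def)
  then show ?thesis by (rule that)
qed

lemma linear_interpolation:
  fixes v :: "'n::finite \<Rightarrow> 'k::field ^ 'n"
  assumes "vec.span (range v) = UNIV"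
  obtains a where "\<And>j. eval_at (v j) (linear_form a) = \<alpha> j"
proof -
  let ?V = "\<chi> j. v j"
  have "rows ?V = range v" by (auto simp: rows_def row_def vec_lambda_eta)
  then obtain B where "B ** ?V = mat 1" using matrix_left_invertible_span_rows_gen[of ?V] assms by auto
  then have "?V ** B = mat 1" by (simp add: matrix_left_right_inverse)
  then have "?V *v (B *v (\<chi> j. \<alpha> j)) = (\<chi> j. \<alpha> j)" by (simp add: matrix_vector_mul_assoc)
  then have "(?V *v (B *v (\<chi> j. \<alpha> j))) $ j = \<alpha> j" for j by simp
  then have "eval_at (v j) (linear_form (B *v (\<chi> j. \<alpha> j))) = \<alpha> j" for j
    by (simp add: eval_at_linear_form matrix_vector_mult_def mult.commute)
  then show ?thesis by (rule that)
qed

text \<open>Let \<open>y\<close> be a linear form with the value \<open>1\<close> at the chosen representatives of the nodes. Modulo the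
  quadrics \<open>x\<^sub>a x\<^sub>b - y l\<^sub>a\<^sub>b\<close> through the nodes, every form of degree \<open>s + 1\<close> is \<open>y\<^sup>s\<close> times a linear form;
  and for large \<open>s\<close> the multiples of these quadrics lie in the gradient ideal.\<close>

lemma nodes_almost_complete_intersection:
  fixes f :: "('n::finite, 'k::{alg_closed_field, field_char_0}) mpoly" and v :: "'n \<Rightarrow> 'k ^ 'n"
  assumes f: "f \<in> graded_piece (Suc (Suc e))" and nodes: "\<And>P. P \<in> Sing f \<Longrightarrow> is_node f P"
    and Sing: "Sing f = range (\<lambda>j. vec.span {v j})" and span: "vec.span (range v) = UNIV"
  obtains y N where "y \<in> graded_piece 1" "N \<ge> N0"
    "graded_piece (Suc N) \<subseteq> ideal (insert (y ^ N) (range (\<lambda>i. partial_deriv i f)))"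
proof -
  let ?J = "gradient_ideal f"
  have sub: "is_ideal ?J" by (simp add: gradient_ideal_def)
  obtain y0 where y0: "\<And>j. eval_at (v j) (linear_form y0) = 1"
    using linear_interpolation[OF span, of "\<lambda>_. 1"] by blast
  have "\<exists>l. \<forall>j. eval_at (v j) (linear_form l) = v j $ a * v j $ b" for a b
    using linear_interpolation[OF span, of "\<lambda>j. v j $ a * v j $ b"] by blast
  then obtain l where l: "\<And>a b j. eval_at (v j) (linear_form (l a b)) = v j $ a * v j $ b" by metis
  define y where "y = linear_form y0"
  define p where "p a b = Var a * Var b - y * linear_form (l a b)" for a b
  have p_graded: "p a b \<in> graded_piece 2" for a b
    using graded_piece_mult[OF graded_piece_Var(1)[of a] graded_piece_Var(1)[of b]]
      graded_piece_mult[OF linear_form_graded(1)[of y0] linear_form_graded(1)[of "l a b"]]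
    by (auto simp: p_def y_def numeral_2_eq_2 intro: graded_piece_diff)
  have p_vanish: "eval_at w (p a b) = 0" if "w \<noteq> 0" "critical f w" for w a b
  proof -
    have "vec.span {w} \<in> Sing f" using Sing_iff[OF f] that by blast
    then obtain j where "vec.span {w} = vec.span {v j}" using Sing by blast
    then obtain c where "w = c *s v j"
      using vec.span_base[of w "{w}"] unfolding vec.span_singleton by blast
    moreover have "eval_at (v j) (p a b) = 0" using y0 l by (simp add: p_def y_def)
    ultimately show ?thesis using eval_at_scale[OF p_graded] by simp
  qed
  have "\<exists>m. \<forall>q\<in>graded_piece m. q * p a b \<in> ?J" for a b
    by (rule vanishing_form_in_saturation[OF f nodes p_graded p_vanish])
  then obtain m where m: "\<And>a b q. q \<in> graded_piece (m a b) \<Longrightarrow> q * p a b \<in> ?J" by metis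
  define m0 where "m0 = Max (range (\<lambda>(a, b). m a b))"
  have m0: "q * p a b \<in> ?J" if "q \<in> graded_piece t" "m0 \<le> t" for q t a b
  proof -
    have "m a b \<le> m0" unfolding m0_def by (intro Max_ge) auto
    moreover have "is_ideal {q. q * p a b \<in> ?J}"
      using homogeneous_ideal_colon[OF homogeneous_ideal_gradient[OF f] p_graded[of a b]]
      by (simp add: homogeneous_ideal_def)
    ultimately show ?thesis
      using graded_piece_subset_ideal_mono[of "{q. q * p a b \<in> ?J}" "m a b" t] m that by auto
  qed
  let ?P = "ideal ((\<lambda>(a, b). p a b) ` UNIV)"
  note P_add = mpoly_ideal.span_add and P_scale = mpoly_ideal.span_scale
  have reduce: "\<exists>l\<in>graded_piece 1. g - y ^ s * l \<in> ?P" if "g \<in> graded_piece (Suc s)" for g s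
    using that
  proof (induction s arbitrary: g)
    case 0
    then show ?case by (intro bexI[of _ g]) (auto simp: mpoly_ideal.span_zero)
  next
    case (Suc s)
    obtain q where q: "\<And>a. q a \<in> graded_piece (Suc s)" "g = (\<Sum>a\<in>UNIV. Var a * q a)"
      using graded_piece_Suc_D[OF Suc.prems] by blast
    have "\<exists>c. q a - y ^ s * linear_form c \<in> ?P" for a
      using Suc.IH[OF q(1)] graded_piece_1_linear_form by metis
    then obtain c where c: "\<And>a. q a - y ^ s * linear_form (c a) \<in> ?P" by metis
    let ?l = "\<Sum>a\<in>UNIV. \<Sum>b\<in>UNIV. Const (c a $ b) * linear_form (l a b)"
    have "g - y ^ Suc s * ?l = (\<Sum>a\<in>UNIV. Var a * (q a - y ^ s * linear_form (c a)) +
        (\<Sum>b\<in>UNIV. y ^ s * Const (c a $ b) * p a b))"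
    proof -
      have "(\<Sum>a\<in>UNIV. Var a * (q a - y ^ s * linear_form (c a)) + (\<Sum>b\<in>UNIV. y ^ s * Const (c a $ b) * p a b)) =
          g - (\<Sum>a\<in>UNIV. Var a * y ^ s * linear_form (c a)) +
          ((\<Sum>a\<in>UNIV. \<Sum>b\<in>UNIV. y ^ s * Const (c a $ b) * (Var a * Var b)) - (\<Sum>a\<in>UNIV. \<Sum>b\<in>UNIV. y ^ s * Const (c a $ b) * (y * linear_form (l a b))))"
        unfolding q(2) p_def
        by (simp add: right_diff_distrib sum.distrib sum_subtractf mult.assoc)
      also have "(\<Sum>a\<in>UNIV. \<Sum>b\<in>UNIV. y ^ s * Const (c a $ b) * (Var a * Var b)) = (\<Sum>a\<in>UNIV. Var a * y ^ s * linear_form (c a))"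
        unfolding linear_form_def sum_distrib_left by (intro sum.cong refl) (simp only: ac_simps)
      also have "(\<Sum>a\<in>UNIV. \<Sum>b\<in>UNIV. y ^ s * Const (c a $ b) * (y * linear_form (l a b))) = y ^ Suc s * ?l"
        unfolding sum_distrib_left by (intro sum.cong refl) (simp only: ac_simps power_Suc)
      finally show ?thesis by simp
    qed
    also have "\<dots> \<in> ?P"
    proof (intro mpoly_ideal.span_sum P_add)
      show "Var a * (q a - y ^ s * linear_form (c a)) \<in> ?P" for a by (rule P_scale[OF c])
      show "y ^ s * Const (c a $ b) * p a b \<in> ?P" for a b
        by (intro P_scale mpoly_ideal.span_base) force
    qed
    finally show ?case
      by (intro bexI[of _ ?l] graded_piece_sum graded_piece_Const_mult linear_form_graded)
  qed
  define N where "N = max N0 (Suc m0)"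
  have "graded_piece (Suc N) \<subseteq> ideal (insert (y ^ N) (range (\<lambda>i. partial_deriv i f)))"
  proof
    fix g :: "('n, 'k) mpoly" assume g: "g \<in> graded_piece (Suc N)"
    obtain l where l: "l \<in> graded_piece 1" "g - y ^ N * l \<in> ?P" using reduce[OF g] by blast
    have yN: "y ^ N \<in> graded_piece N" using graded_piece_power[OF linear_form_graded(1), of y0 N] by (simp add: y_def)
    have deg: "g - y ^ N * l \<in> graded_piece (Suc N)"
      using graded_piece_diff[OF g, of "y ^ N * l"] graded_piece_mult[OF yN l(1)] by simp
    obtain q where q: "g - y ^ N * l = (\<Sum>ab\<in>UNIV. q ab * (\<lambda>(a, b). p a b) ab)"
      and q_deg: "\<And>ab k. k \<in> keys (q ab) \<Longrightarrow> total_degree k + 2 = Suc N"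
    proof (rule graded_span_image_sum[OF finite _ l(2) deg, where \<delta> = "\<lambda>_. 2"])
      show "(\<lambda>(a, b). p a b) ab \<in> graded_piece 2" for ab by (cases ab) (simp add: p_graded)
    qed (rule that; simp)
    have "q ab \<in> graded_piece (N - 1)" for ab
      unfolding graded_piece_def using q_deg[of _ ab] by fastforce
    moreover have "m0 \<le> N - 1" by (simp add: N_def)
    ultimately have "q ab * (\<lambda>(a, b). p a b) ab \<in> ?J" for ab
      by (cases ab) (auto intro: m0)
    then have "g - l * y ^ N \<in> ?J"
      using q by (simp add: mult.commute mpoly_ideal.subspace_sum[OF sub])
    then show "g \<in> ideal (insert (y ^ N) (range (\<lambda>i. partial_deriv i f)))"
      unfolding mpoly_ideal.span_insert gradient_ideal_def by blast
  qed
  moreover have "y \<in> graded_piece 1" "N0 \<le> N" by (simp_all add: y_def N_def)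
  ultimately show ?thesis using that by blast
qed

section \<open>Veronese-avoiding hypersurfaces\<close>

lemma eval_at_gradient_ideal:
  assumes "g \<in> gradient_ideal f" "critical f v"
  shows "eval_at v g = 0"
proof -
  obtain q where "g = (\<Sum>i\<in>UNIV. q i * partial_deriv i f)"
    using assms(1) unfolding gradient_ideal_def by (rule span_image_sum[OF finite])
  then show ?thesis using assms(2) by (simp add: eval_at_sum critical_def)
qed

lemma eval_at_axis_linear_form: "eval_at (axis b 1) (linear_form a) = a $ b"
proof -
  have "eval_at (axis b 1) (linear_form a) = (\<Sum>c\<in>UNIV. if c = b then a $ c else 0)"
    unfolding eval_at_linear_form by (intro sum.cong refl) (auto simp: axis_def)
  then show ?thesis by simp
qed

lemma partial_deriv_linear_form: "partial_deriv i (linear_form a) = Const (a $ i)"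
proof -
  have "partial_deriv i (linear_form a) = (\<Sum>b\<in>UNIV. if b = i then Const (a $ b) else 0)"
    unfolding linear_form_def partial_deriv_sum
    by (intro sum.cong refl) (auto simp: partial_deriv_mult partial_deriv_Var)
  then show ?thesis by simp
qed

text \<open>At a critical point only the derivatives of the generators \<open>\<partial>\<^sub>i f\<close> contribute to the derivative of a
  combination of them, and the Hessian collects these.\<close>

lemma gradient_ideal_derivative:
  assumes g: "g \<in> gradient_ideal f" and v: "critical f v" and u: "hessian f v *v u = 0"
  shows "(\<Sum>j\<in>UNIV. u $ j * eval_at v (partial_deriv j g)) = 0"
proof -
  obtain q where q: "g = (\<Sum>i\<in>UNIV. q i * partial_deriv i f)"
    using g unfolding gradient_ideal_def by (rule span_image_sum[OF finite])
  have "(\<Sum>j\<in>UNIV. u $ j * eval_at v (partial_deriv j g)) =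
      (\<Sum>j\<in>UNIV. \<Sum>i\<in>UNIV. u $ j * (eval_at v (q i) * eval_at v (partial_deriv j (partial_deriv i f))))"
    using v by (simp add: q partial_deriv_sum partial_deriv_mult eval_at_sum critical_def sum_distrib_left)
  also have "\<dots> = (\<Sum>i\<in>UNIV. eval_at v (q i) * (hessian f v *v u) $ i)"
    by (subst sum.swap) (simp add: hessian_mult_nth sum_distrib_left mult.left_commute)
  finally show ?thesis by (simp add: u)
qed

lemma linear_form_eq_0:
  fixes l :: "('n::finite, 'k::field_char_0) mpoly"
  assumes l: "l \<in> graded_piece 1" and v: "\<And>j. eval_at (v j) l = 0" and span: "vec.span (range v) = UNIV"
  shows "l = 0"
proof -
  obtain a where a: "l = linear_form a" using l by (rule graded_piece_1_linear_form)
  have "vec.subspace {w. eval_at w l = 0}"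
    unfolding vec.subspace_def a eval_at_linear_form
    by (auto simp: distrib_left sum.distrib mult.left_commute simp flip: sum_distrib_left)
  then have "vec.span (range v) \<subseteq> {w. eval_at w l = 0}"
    using v by (intro vec.span_minimal) auto
  then have "eval_at (axis b 1) l = 0" for b using span by auto
  then have "a $ b = 0" for b by (simp only: a eval_at_axis_linear_form)
  then show ?thesis by (simp add: a linear_form_def)
qed

lemma veronese_point_iff:
  fixes J :: "('n::finite, 'k::field) mpoly set"
  assumes J: "mpoly.subspace J"
  shows "projectivization scale_mpoly J \<inter> veronese_variety m = {} \<longleftrightarrow>
    (\<forall>l\<in>graded_piece 1. l \<noteq> 0 \<longrightarrow> l ^ m \<in> J \<longrightarrow> l ^ m = 0)"
proof
  assume avoid: "projectivization scale_mpoly J \<inter> veronese_variety m = {}"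
  show "\<forall>l\<in>graded_piece 1. l \<noteq> 0 \<longrightarrow> l ^ m \<in> J \<longrightarrow> l ^ m = 0"
  proof (intro ballI impI, rule ccontr)
    fix l :: "('n, 'k) mpoly" assume "l \<in> graded_piece 1" "l \<noteq> 0" "l ^ m \<in> J" "l ^ m \<noteq> 0"
    then have "mpoly.span {l ^ m} \<in> projectivization scale_mpoly J \<inter> veronese_variety m"
      unfolding projectivization_def veronese_variety_def by blast
    then show False using avoid by blast
  qed
next
  assume *: "\<forall>l\<in>graded_piece 1. l \<noteq> 0 \<longrightarrow> l ^ m \<in> J \<longrightarrow> l ^ m = 0"
  show "projectivization scale_mpoly J \<inter> veronese_variety m = {}"
  proof (rule ccontr)
    assume "projectivization scale_mpoly J \<inter> veronese_variety m \<noteq> {}"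
    then obtain l g where l: "l \<in> graded_piece 1" "l \<noteq> 0" and g: "g \<in> J" "g \<noteq> 0"
      and eq: "mpoly.span {g} = mpoly.span {l ^ m}"
      unfolding projectivization_def veronese_variety_def by blast
    have "mpoly.span {g} \<subseteq> J" using g J by (intro mpoly.span_minimal) auto
    then have "l ^ m \<in> J" using eq mpoly.span_base[of "l ^ m" "{l ^ m}"] by auto
    then have "l ^ m = 0" using * l by blast
    then have "mpoly.span {g} = {0}" using eq by simp
    then show False using mpoly.span_base[of g "{g}"] g(2) by simp
  qed
qed

lemma subspace_gradient_ideal_piece:
  fixes f :: "('n::finite, 'k::field) mpoly"
  shows "mpoly.subspace (gradient_ideal f \<inter> graded_piece m)"
  unfolding gradient_ideal_def
  by (intro mpoly.subspaceI)
    (auto intro: mpoly_ideal.span_zero mpoly_ideal.span_add mpoly_ideal.span_scale graded_piece_add graded_piece_Const_mult)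

text \<open>Spanning nodes supply the form \<open>y\<^sup>N\<close> for the codimension. For the Veronese variety, a power of a linear
  form in the gradient ideal vanishes at the nodes, hence so does the linear form, which is
  impossible as they span.\<close>

lemma nodes_imp_veronese_avoiding:
  fixes f :: "('n::finite, 'k::{alg_closed_field, field_char_0}) mpoly"
  assumes d: "3 \<le> d" and f: "f \<in> graded_piece d" and card: "card (Sing f) = CARD('n)"
    and nodes: "\<And>P. P \<in> Sing f \<Longrightarrow> is_node f P" and span: "vec.span (\<Union>(Sing f)) = UNIV"
  shows "veronese_avoiding d f"
proof -
  obtain e where e: "d = Suc (Suc e)" "1 \<le> e"
  proof
    show "d = Suc (Suc (d - 2))" "1 \<le> d - 2" using d by simp_all
  qed
  have f: "f \<in> graded_piece (Suc (Suc e))" using f e by simp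
  have "finite (Sing f)" using card by (metis card_gt_0_iff zero_less_card_finite)
  then obtain b where b: "bij_betw b (UNIV :: 'n set) (Sing f)"
    using finite_same_card_bij[of "UNIV :: 'n set" "Sing f"] card by auto
  have "\<exists>v. b j = vec.span {v} \<and> critical f v" for j
    using is_node_D[OF f nodes] bij_betwE[OF b] by (metis UNIV_I)
  then obtain v where v: "\<And>j. b j = vec.span {v j}" "\<And>j. critical f (v j)" by metis
  have Sing: "Sing f = range (\<lambda>j. vec.span {v j})"
    using bij_betw_imp_surj_on[OF b] v(1) by simp
  have "vec.span {v j} \<subseteq> vec.span (range v)" for j by (rule vec.span_mono) auto
  then have "\<Union>(Sing f) \<subseteq> vec.span (range v)" unfolding Sing by blast
  then have "vec.span (\<Union>(Sing f)) \<subseteq> vec.span (range v)" by (rule vec.span_minimal) simp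
  then have span_v: "vec.span (range v) = UNIV" using span by auto
  let ?m = "CARD('n) * e - 1" and ?D = "\<lambda>i. partial_deriv i f"
  obtain y N where y: "y \<in> graded_piece 1" and N: "CARD('n) * e \<le> N"
    and full: "graded_piece (Suc N) \<subseteq> ideal (insert (y ^ N) (range ?D))"
    using nodes_almost_complete_intersection[OF f nodes Sing span_v] by blast
  have yN: "y ^ N \<in> graded_piece N" using graded_piece_power[OF y, of N] by simp
  have "mpoly.dim (graded_piece ?m :: ('n, 'k) mpoly set) = CARD('n) + mpoly.dim (gradient_ideal f \<inter> graded_piece ?m)"
    unfolding gradient_ideal_def
    by (rule dim_ideal_piece_almost_complete_intersection[where e = "Suc e", OF _ _ yN _ full])
      (use e N partial_deriv_graded[OF f] in auto)
  moreover have "l ^ m = 0" if "l \<in> graded_piece 1" "l \<noteq> 0" "l ^ m \<in> gradient_ideal f" for l m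
  proof -
    have "eval_at (v j) l ^ m = 0" for j
      using eval_at_gradient_ideal[OF that(3) v(2)] by simp
    then have "eval_at (v j) l = 0" for j by (metis power_not_zero)
    then have "l = 0" by (rule linear_form_eq_0[OF that(1) _ span_v])
    then show ?thesis using that(2) by simp
  qed
  ultimately show ?thesis
    unfolding veronese_avoiding_def Let_def proj_codim_def
    by (auto simp: e veronese_point_iff[OF subspace_gradient_ideal_piece])
qed

lemma (in vector_space) subspace_eq_of_dim_eq:
  assumes "subspace S" "S \<subseteq> T" "finite B" "T \<subseteq> span B" "dim S = dim T"
  shows "S = T"
proof (rule ccontr)
  assume "S \<noteq> T"
  then obtain x where x: "x \<in> T" "x \<notin> S" using assms(2) by blast
  obtain C where C: "C \<subseteq> S" "independent C" "S \<subseteq> span C" by (rule maximal_independent_subset)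
  obtain D where D: "D \<subseteq> T" "independent D" "T \<subseteq> span D" by (rule maximal_independent_subset)
  have "finite D" using independent_span_bound[OF assms(3) D(2)] D(1) assms(4) by blast
  have "x \<notin> span C" using x(2) C(1) assms(1) span_minimal by blast
  then have "independent (insert x C)" using C(2) by (rule independent_insertI)
  then have "finite (insert x C) \<and> card (insert x C) \<le> card D"
    using x(1) C(1) assms(2) D(3) by (intro independent_span_bound \<open>finite D\<close>) auto
  moreover have "x \<notin> C" using x(2) C(1) by blast
  ultimately have "card C < card D" by auto
  moreover have "dim S = card C" "dim T = card D"
    using basis_card_eq_dim[OF C(1,3,2)] basis_card_eq_dim[OF D(1,3,2)] by simp_all
  ultimately show False using assms(5) by simp
qed

lemma separating_linear_form:
  fixes v w :: "'k::field ^ 'n::finite"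
  assumes "v $ i = 1" "w \<notin> vec.span {v}"
  obtains l where "l \<in> graded_piece 1" "eval_at v l = 0" "eval_at w l \<noteq> 0"
proof -
  let ?l = "\<lambda>b. Var b - Const (v $ b) * Var i"
  have "\<exists>b. eval_at w (?l b) \<noteq> 0"
  proof (rule ccontr)
    assume "\<not> ?thesis"
    then have l: "eval_at w (?l b) = 0" for b by blast
    have wb: "w $ b = v $ b * w $ i" for b
      using l[of b] by (simp only: eval_at_diff eval_at_mult eval_at_Var eval_at_Const right_minus_eq)
    have "w $ b = ((w $ i) *s v) $ b" for b using wb[of b] by (simp only: vector_smult_component mult.commute)
    then have "w = (w $ i) *s v" unfolding vec_eq_iff by blast
    then show False using assms(2) unfolding vec.span_singleton by blast
  qed
  then obtain b where "eval_at w (?l b) \<noteq> 0" by blast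
  moreover have "?l b \<in> graded_piece 1" by (intro graded_piece_diff graded_piece_Const_mult graded_piece_Var)
  moreover have "eval_at v (?l b) = 0" using assms(1) by simp
  ultimately show ?thesis by (intro that[of "?l b"])
qed

text \<open>Distinct points impose independent conditions on forms of degree at least \<open>n - 1\<close>: a product of linear
  forms separates one of the points from the others.\<close>

lemma separating_form:
  fixes v :: "'n::finite \<Rightarrow> 'k::field ^ 'n"
  assumes norm: "\<And>j. v j $ \<iota> j = 1" and inj: "inj (\<lambda>j. vec.span {v j})" and m: "CARD('n) - 1 \<le> m"
  obtains g where "g \<in> graded_piece m" "eval_at (v k) g \<noteq> 0" "\<And>j. j \<noteq> k \<Longrightarrow> eval_at (v j) g = 0"
proof -
  have "\<exists>l. l \<in> graded_piece 1 \<and> eval_at (v j) l = 0 \<and> eval_at (v k) l \<noteq> 0" if "j \<noteq> k" for j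
  proof -
    have "v k \<notin> vec.span {v j}"
    proof
      assume "v k \<in> vec.span {v j}"
      moreover have "v k \<noteq> 0" using norm[of k] by auto
      ultimately have "vec.span {v k} = vec.span {v j}" by (rule span_singleton_eq)
      then show False using inj that by (simp add: inj_def)
    qed
    then show ?thesis using separating_linear_form[OF norm] by metis
  qed
  then obtain l where l: "\<And>j. j \<noteq> k \<Longrightarrow> l j \<in> graded_piece 1 \<and> eval_at (v j) (l j) = 0 \<and> eval_at (v k) (l j) \<noteq> 0"
    by metis
  let ?g = "(\<Prod>j\<in>UNIV - {k}. l j) * Var (\<iota> k) ^ (m - (CARD('n) - 1))"
  have "(\<Prod>j\<in>UNIV - {k}. l j) \<in> graded_piece (\<Sum>j\<in>UNIV - {k}. 1)"
    by (rule graded_piece_prod) (use l in auto)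
  then have "?g \<in> graded_piece ((CARD('n) - 1) + (m - (CARD('n) - 1)))"
    using graded_piece_power[OF graded_piece_Var(1), of "\<iota> k" "m - (CARD('n) - 1)"]
    by (intro graded_piece_mult) (simp_all add: card_Diff_singleton)
  then have "?g \<in> graded_piece m" using m by simp
  moreover have "eval_at (v k) ?g \<noteq> 0" using l by (simp add: eval_at_prod norm)
  moreover have "eval_at (v j) ?g = 0" if "j \<noteq> k" for j
    using l[OF that] that by (auto simp: eval_at_prod)
  ultimately show ?thesis by (rule that)
qed

lemma dim_forms_vanishing_at_points:
  fixes v :: "'n::finite \<Rightarrow> 'k::field ^ 'n"
  assumes norm: "\<And>j. v j $ \<iota> j = 1" and inj: "inj (\<lambda>j. vec.span {v j})" and m: "CARD('n) - 1 \<le> m"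
  shows "mpoly.dim {g \<in> graded_piece m. \<forall>j. eval_at (v j) g = 0} + CARD('n) = mpoly.dim (graded_piece m :: ('n, 'k) mpoly set)"
proof -
  interpret pair: vector_space_pair "scale_mpoly :: 'k \<Rightarrow> ('n, 'k) mpoly \<Rightarrow> _" "(*s) :: 'k \<Rightarrow> 'k ^ 'n \<Rightarrow> _"
    by unfold_locales
  let ?ev = "\<lambda>g :: ('n, 'k) mpoly. \<chi> j. eval_at (v j) g"
  have lin: "Vector_Spaces.linear scale_mpoly (*s) ?ev"
    unfolding Vector_Spaces.linear_iff
    by (auto simp: mpoly.vector_space_axioms vec.vector_space_axioms vec_eq_iff)
  have sub: "mpoly.subspace (graded_piece m :: ('n, 'k) mpoly set)"
    unfolding graded_piece_span by simp
  let ?B = "(\<lambda>k. single k 1) ` {k. total_degree k = m} :: ('n, 'k) mpoly set"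
  have B: "finite ?B" "graded_piece m \<subseteq> mpoly.span ?B"
    by (simp_all add: finite_total_degree graded_piece_span)
  have "?ev ` graded_piece m = UNIV"
  proof -
    have "\<exists>g. g \<in> graded_piece m \<and> eval_at (v k) g \<noteq> 0 \<and> (\<forall>j. j \<noteq> k \<longrightarrow> eval_at (v j) g = 0)" for k
      using separating_form[OF norm inj m, of k] by metis
    then obtain g where g: "\<And>k. g k \<in> graded_piece m" "\<And>k. eval_at (v k) (g k) \<noteq> 0"
      "\<And>k j. j \<noteq> k \<Longrightarrow> eval_at (v j) (g k) = 0" by metis
    have "x \<in> ?ev ` graded_piece m" for x
    proof
      let ?g = "\<Sum>k\<in>UNIV. Const (x $ k / eval_at (v k) (g k)) * g k"
      show "?g \<in> graded_piece m" by (intro graded_piece_sum graded_piece_Const_mult g)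
      have "eval_at (v j) ?g = x $ j" for j
      proof -
        have "eval_at (v j) ?g = (\<Sum>k\<in>UNIV. if k = j then x $ k else 0)"
          unfolding eval_at_sum by (intro sum.cong refl) (use g in auto)
        then show ?thesis by simp
      qed
      then show "x = ?ev ?g" by (simp add: vec_eq_iff)
    qed
    then show ?thesis by blast
  qed
  moreover have "{g \<in> graded_piece m. ?ev g = 0} = {g \<in> graded_piece m. \<forall>j. eval_at (v j) g = 0}"
    by (simp add: vec_eq_iff)
  ultimately show ?thesis
    using pair.rank_nullity[OF lin sub B] by (simp add: card_cart_basis)
qed

text \<open>A partial derivative \<open>g\<close> of a cubic is a quadratic form, so \<open>g(p + q)\<close> is the sum of \<open>g(p)\<close>, \<open>g(q)\<close> and the
  derivative of \<open>g\<close> at \<open>p\<close> in the direction \<open>q\<close>. This serves to exclude binary cubics with exactly two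
  singular points, one of them not a node.\<close>

lemma critical_sum_of_cubic:
  fixes f :: "('n::finite, 'k::field_char_0) mpoly"
  assumes f: "f \<in> graded_piece (Suc (Suc (Suc 0)))" and p: "critical f p" and q: "critical f q"
    and H: "hessian f p *v q = 0"
  shows "critical f (p + q)"
  unfolding critical_def
proof
  fix i
  let ?g = "partial_deriv i f" and ?E = "\<lambda>x y. \<Sum>j\<in>UNIV. y $ j * eval_at x (partial_deriv j (partial_deriv i f))"
  have g: "?g \<in> graded_piece (Suc (Suc 0))" by (rule partial_deriv_graded[OF f])
  have const: "eval_at x (partial_deriv k (partial_deriv j ?g)) = eval_at 0 (partial_deriv k (partial_deriv j ?g))" for x j k
    using graded_piece_0_D[OF partial_deriv_graded[OF partial_deriv_graded[OF g]], of k j 0] by (metis eval_at_Const)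
  let ?C = "hessian ?g 0"
  have lin: "eval_at x (partial_deriv j ?g) = (?C *v x) $ j" for x j
    using Euler_identity_at[OF partial_deriv_graded[OF g], of x j]
    by (simp add: hessian_mult_nth const[of x])
  let ?B = "\<lambda>x y. \<Sum>j\<in>UNIV. x $ j * (?C *v y) $ j"
  have quad: "2 * eval_at x ?g = ?B x x" for x
    using Euler_identity_at[OF g, of x] by (simp add: lin)
  have "?B q p = 0"
  proof -
    have "(hessian f p *v q) $ i = 0" using H by simp
    then show ?thesis by (simp add: hessian_mult_nth lin)
  qed
  moreover have "?B p q = ?B q p" by (rule hessian_symmetric)
  ultimately have "?B (p + q) (p + q) = ?B p p + ?B q q"
    by (simp add: matrix_vector_right_distrib distrib_left distrib_right sum.distrib)
  also have "\<dots> = 0" using quad[of p] quad[of q] p q by (simp add: critical_def)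
  finally show "eval_at (p + q) ?g = 0" using quad[of "p + q"] by simp
qed

text \<open>By the codimension the gradient ideal contains all forms of degree \<open>T - 1\<close> that vanish at the singular points.
  These include powers of linear forms, and products of linear forms with prescribed derivatives at one of
  the points.\<close>

lemma veronese_avoiding_imp_nodes:
  fixes f :: "('n::finite, 'k::field_char_0) mpoly"
  assumes d: "3 \<le> d" and f: "f \<in> graded_piece d" and card: "card (Sing f) = CARD('n)"
    and va: "veronese_avoiding d f"
  shows "vec.span (\<Union>(Sing f)) = UNIV" and "P \<in> Sing f \<Longrightarrow> is_node f P"
proof -
  obtain e where e: "d = Suc (Suc e)" "1 \<le> e"
  proof
    show "d = Suc (Suc (d - 2))" "1 \<le> d - 2" using d by simp_all
  qed
  have f: "f \<in> graded_piece (Suc (Suc e))" using f e by simp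
  have "finite (Sing f)" using card by (metis card_gt_0_iff zero_less_card_finite)
  then obtain b where b: "bij_betw b (UNIV :: 'n set) (Sing f)"
    using finite_same_card_bij[of "UNIV :: 'n set" "Sing f"] card by auto
  have "\<exists>v i. v $ i = 1 \<and> b j = vec.span {v} \<and> critical f v" for j
    using Sing_normalized[OF f] bij_betwE[OF b] by (metis UNIV_I)
  then obtain v \<iota> where norm: "\<And>j. v j $ \<iota> j = 1" and bv: "\<And>j. b j = vec.span {v j}"
    and crit: "\<And>j. critical f (v j)" by metis
  have Sing: "Sing f = range (\<lambda>j. vec.span {v j})"
    using bij_betw_imp_surj_on[OF b] bv by simp
  have inj: "inj (\<lambda>j. vec.span {v j})"
    using bij_betw_imp_inj_on[OF b] bv by (simp add: inj_on_def)
  let ?m = "CARD('n) * e - 1"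
  let ?J = "gradient_ideal f \<inter> graded_piece ?m" and ?I = "{g \<in> graded_piece ?m. \<forall>j. eval_at (v j) g = 0}"
  have codim: "mpoly.dim (graded_piece ?m :: ('n, 'k) mpoly set) - mpoly.dim ?J = CARD('n)"
    and avoid: "\<forall>l\<in>graded_piece 1. l \<noteq> 0 \<longrightarrow> l ^ ?m \<in> ?J \<longrightarrow> l ^ ?m = 0"
    using va unfolding veronese_avoiding_def Let_def proj_codim_def
    by (auto simp: e veronese_point_iff[OF subspace_gradient_ideal_piece])
  have "CARD('n) \<le> CARD('n) * e" using e by simp
  then have m: "CARD('n) - 1 \<le> ?m" by linarith
  let ?B = "(\<lambda>k. single k 1) ` {k. total_degree k = ?m} :: ('n, 'k) mpoly set"
  have J: "?J = ?I"
  proof (rule mpoly.subspace_eq_of_dim_eq[OF subspace_gradient_ideal_piece])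
    show "?J \<subseteq> ?I" using eval_at_gradient_ideal[OF _ crit] by blast
    show "finite ?B" using finite_total_degree by blast
    show "?I \<subseteq> mpoly.span ?B" by (auto simp flip: graded_piece_span)
    show "mpoly.dim ?J = mpoly.dim ?I"
      using dim_forms_vanishing_at_points[OF norm inj m] codim zero_less_card_finite[where 'a = 'n] by linarith
  qed
  have v_mem: "v j \<in> vec.span {v j}" for j by (rule vec.span_base) simp
  then have "range v \<subseteq> \<Union>(Sing f)" unfolding Sing by blast
  then have span_mono: "vec.span (range v) \<subseteq> vec.span (\<Union>(Sing f))" by (rule vec.span_mono)
  have span_v: "vec.span (range v) = UNIV"
  proof (rule ccontr)
    assume not_span: "vec.span (range v) \<noteq> UNIV"
    let ?V = "\<chi> j. v j"
    have "rows ?V = range v" by (auto simp: rows_def row_def vec_lambda_eta)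
    then have "\<not> (\<exists>B. B ** ?V = mat 1)" using not_span by (simp add: matrix_left_invertible_span_rows_gen)
    then obtain a where a: "?V *v a = 0" "a \<noteq> 0" by (auto simp: matrix_left_invertible_ker)
    let ?l = "linear_form a"
    have l_v: "eval_at (v j) ?l = 0" for j
    proof -
      have "eval_at (v j) ?l = (?V *v a) $ j"
        by (simp add: eval_at_linear_form matrix_vector_mult_def mult.commute)
      then show ?thesis using a(1) by simp
    qed
    obtain c where c: "a $ c \<noteq> 0" using a(2) by (auto simp: vec_eq_iff)
    have l_pow: "?l ^ k \<noteq> 0" for k
    proof
      assume "?l ^ k = 0"
      then have "eval_at (axis c 1) (?l ^ k) = 0" by simp
      then show False using c by (simp add: eval_at_axis_linear_form)
    qed
    show False
    proof (cases "?m = 0")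
      case False
      have "?l ^ ?m \<in> graded_piece ?m" using graded_piece_power[OF linear_form_graded(1), of a ?m] by simp
      then have "?l ^ ?m \<in> ?J" unfolding J using l_v False by (simp add: zero_power)
      then show False using avoid l_pow[of 1] l_pow[of ?m] by simp
    next
      case True
      then have "CARD('n) \<le> 1" using \<open>CARD('n) \<le> CARD('n) * e\<close> by linarith
      then have eq: "x = y" for x y :: 'n by (metis UNIV_I card_le_Suc0_iff_eq finite One_nat_def)
      have "(UNIV :: 'n set) = {\<iota> c}" using eq by blast
      then have "eval_at (v c) ?l = (\<Sum>b\<in>{\<iota> c}. a $ b * v c $ b)" unfolding eval_at_linear_form by (rule arg_cong)
      then have "a $ \<iota> c = 0" by (simp add: l_v norm)
      then show False using c eq[of "\<iota> c" c] by simp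
    qed
  qed
  then show "vec.span (\<Union>(Sing f)) = UNIV" using span_mono by auto
  show "is_node f P" if P: "P \<in> Sing f"
  proof -
    obtain k where k: "P = vec.span {v k}" using P Sing by blast
    have kernel: "u \<in> vec.span {v k}" if u: "hessian f (v k) *v u = 0" for u
    proof (rule ccontr)
      assume not_mem: "u \<notin> vec.span {v k}"
      obtain l where l: "l \<in> graded_piece 1" "eval_at (v k) l = 0" "eval_at u l \<noteq> 0"
        using separating_linear_form[OF norm not_mem] by blast
      obtain a where a: "l = linear_form a" using l(1) by (rule graded_piece_1_linear_form)
      show False
      proof (cases "2 \<le> ?m")
        case True
        \<comment> \<open>The form \<open>?g\<close> vanishes at all singular points, at \<open>v k\<close> to first order only: its derivative there
          in the direction \<open>u\<close> is \<open>l(u)\<close>.\<close>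
        obtain c where c: "\<And>j. eval_at (v j) (linear_form c) = (if j = k then 1 else 0)"
          using linear_interpolation[OF span_v, of "\<lambda>j. if j = k then 1 else 0"] by blast
        let ?r = "linear_form c ^ (?m - 1)" let ?g = "l * ?r"
        have "?g \<in> graded_piece (1 + (?m - 1) * 1)"
          by (intro graded_piece_mult graded_piece_power l linear_form_graded)
        moreover have "1 + (?m - 1) * 1 = ?m" using True by linarith
        ultimately have "?g \<in> graded_piece ?m" by (simp only:)
        moreover have "eval_at (v j) ?g = 0" for j using l(2) c True by (cases "j = k") (auto simp: zero_power)
        ultimately have "?g \<in> ?J" unfolding J by blast
        then have "?g \<in> gradient_ideal f" by blast
        from gradient_ideal_derivative[OF this crit u]
        have "(\<Sum>j\<in>UNIV. u $ j * (a $ j * eval_at (v k) ?r)) = 0"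
          using l(2) by (simp add: partial_deriv_mult a partial_deriv_linear_form)
        moreover have "eval_at (v k) ?r = 1" by (simp add: c)
        ultimately show False using l(3) by (simp add: a eval_at_linear_form mult.commute)
      next
        case False
        have "\<not> CARD('n) \<le> 1"
        proof
          assume "CARD('n) \<le> 1"
          then have eq: "x = y" for x y :: 'n by (metis UNIV_I card_le_Suc0_iff_eq finite One_nat_def)
          have "u $ c = ((u $ \<iota> k) *s v k) $ c" for c using norm[of k] eq[of c "\<iota> k"] by simp
          then have "u = (u $ \<iota> k) *s v k" unfolding vec_eq_iff by blast
          then show False using not_mem unfolding vec.span_singleton by blast
        qed
        then have "2 \<le> CARD('n)" by simp
        \<comment> \<open>In degree \<open>?m \<le> 1\<close> there is no room for the product. This happens only for binary cubics, for
          which a third singular point gives a contradiction.\<close>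
        have "CARD('n) = 2 \<and> e = 1"
        proof -
          have ne: "CARD('n) * e \<le> 2" using False by linarith
          have "2 * e \<le> CARD('n) * e" using \<open>2 \<le> CARD('n)\<close> by (rule mult_le_mono1)
          then have "e = 1" using ne e(2) by linarith
          then show ?thesis using ne \<open>2 \<le> CARD('n)\<close> by simp
        qed
        then have f3: "f \<in> graded_piece (Suc (Suc (Suc 0)))" and two: "CARD('n) = 2" using f by simp_all
        obtain j where j: "j \<noteq> k" "UNIV = {j, k}"
        proof -
          obtain x y where "(UNIV :: 'n set) = {x, y}" "x \<noteq> y" using two by (auto simp: card_2_iff)
          then show ?thesis using that[of x] that[of y] by (cases "k = x") auto
        qed
        let ?H = "hessian f (v k)"
        have Hk: "?H *v v k = 0" by (rule hessian_kernel_point[OF f crit])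
        have "u \<in> vec.span (insert (v k) {v j})"
          using span_v unfolding j(2) by (simp add: insert_commute)
        then obtain \<alpha> where "u - \<alpha> *s v k \<in> vec.span {v j}" unfolding vec.span_insert by blast
        then obtain \<beta> where \<beta>: "u - \<alpha> *s v k = \<beta> *s v j" unfolding vec.span_singleton by blast
        have "\<beta> \<noteq> 0"
        proof
          assume "\<beta> = 0"
          then have "u = \<alpha> *s v k" using \<beta> by simp
          then show False using not_mem unfolding vec.span_singleton by blast
        qed
        have "\<beta> *s (?H *v v j) = ?H *v (u - \<alpha> *s v k)" unfolding \<beta> by (simp add: vector_scalar_commute)
        also have "\<dots> = 0" by (simp add: matrix_vector_mult_diff_distrib vector_scalar_commute u Hk)
        finally have "?H *v v j = 0" using \<open>\<beta> \<noteq> 0\<close> by simp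
        then have crit': "critical f (v k + v j)" by (rule critical_sum_of_cubic[OF f3 crit crit])
        have ne: "vec.span {v k} \<noteq> vec.span {v j}" using inj j(1) by (auto simp: inj_def)
        have "v x \<noteq> 0" for x using norm[of x] by auto
        then have not_multiple: "v x \<notin> vec.span {v y}" if "vec.span {v x} \<noteq> vec.span {v y}" for x y
          using span_singleton_eq that by blast
        have not_k: "v k + v j \<notin> vec.span {v k}" and not_j: "v k + v j \<notin> vec.span {v j}"
          using not_multiple[of k j] not_multiple[of j k] ne vec.span_add_eq[OF v_mem[of k], of "v j"] vec.span_add_eq2[OF v_mem[of j], of "v k"]
          by auto
        then have "v k + v j \<noteq> 0" using vec.span_zero by metis
        then have "vec.span {v k + v j} \<in> Sing f" using crit' Sing_iff[OF f] by blast
        then obtain x where "vec.span {v k + v j} = vec.span {v x}" using Sing by blast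
        then have "v k + v j \<in> vec.span {v x}" using vec.span_base[of "v k + v j" "{v k + v j}"] by auto
        moreover have "x = j \<or> x = k" using j(2) by blast
        ultimately show False using not_k not_j by auto
      qed
    qed
    then have "nondegenerate_on {u. u $ \<iota> k = 0} (hom_component 2 (local_equation (\<iota> k) (v k) f))"
      using nondegenerate_local_equation_iff[OF f crit norm] by blast
    then show ?thesis unfolding is_node_def using P norm v_mem k by blast
  qed
qed

theorem theorem2p15:
  fixes f :: "('n::finite, 'k::{alg_closed_field, field_char_0}) mpoly"
    and d :: nat
  assumes "d \<ge> 3"
    and "f \<in> graded_piece d"
    and "squarefree f"
    and "isolated_singularities f"
    and "card (Sing f) = CARD('n)"
  shows "veronese_avoiding d f \<longleftrightarrow>
    (card (Sing f) = CARD('n) \<and> (\<forall>P\<in>Sing f. is_node f P) \<and> general_linear_position (Sing f))"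
proof
  assume "veronese_avoiding d f"
  note nodes = veronese_avoiding_imp_nodes[OF assms(1,2,5) this]
  then show "card (Sing f) = CARD('n) \<and> (\<forall>P\<in>Sing f. is_node f P) \<and> general_linear_position (Sing f)"
    using assms(5) by (auto simp: general_linear_position_def)
next
  assume "card (Sing f) = CARD('n) \<and> (\<forall>P\<in>Sing f. is_node f P) \<and> general_linear_position (Sing f)"
  then show "veronese_avoiding d f"
    using nodes_imp_veronese_avoiding[OF assms(1,2,5)] by (simp add: general_linear_position_def)
qed

end
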